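(* Let $l\ge3$ and $0\le 2p\le l$. Up to conjugation by automorphisms, the real Lie algebra $\mathfrak{sp}_{p,l-p}$ has exactly $p$ non-zero abelian inner ideals, which form a chain (of maximal length), namely $$\mathcal B_{\{2\}}\subset\mathcal B_{\{4\}}\subset\dots\subset\mathcal B_{\{2p\}}.$$
   Context: $\mathfrak{sp}_{p,q}=\{x\in\mathfrak{gl}_{p+q}(\mathbb H):I_{p,q}x+\bar x^tI_{p,q}=0\}$ with $I_{p,q}=\mathrm{diag}(I_p,-I_q)$, a real form of $\mathfrak{sp}_{2(p+q)}(\mathbb C)$. A subspace $B$ of a Lie algebra $L$ is an inner ideal if $[B,[B,L]]\subseteq B$; abelian if $[B,B]=0$. Subspaces $B,B'$ of $\mathfrak g$ are conjugate if $\varphi(B)=B'$ for some $\varphi\in\mathrm{Aut}(\mathfrak g)$. Setting, for a real form $\mathfrak g$ of a simple complex Lie algebra. Fix a maximal abelian subspace $\mathfrak a\subseteq\mathfrak g$ on which the Killing form is positive definite and such that some Cartan involution $\theta$ satisfies $\theta|_{\mathfrak a}=-\mathrm{id}$; put $\mathfrak g_\lambda=\{x\in\mathfrak g:[h,x]=\lambda(h)x\ \forall h\in\mathfrak a\}$ for $\lambda\in\mathfrak a^*$. Let $\mathfrak h\supseteq\mathfrak a$ be a maximal abelian subalgebra of $\mathfrak g$, $\Phi$ the root system of $\mathfrak g^{\mathbb C}$ relative to $\mathfrak h^{\mathbb C}$, $\bar\alpha=\alpha|_{\mathfrak a}$, $\Phi_0=\{\alpha\in\Phi:\bar\alpha=0\}$,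 $\Sigma=\{\bar\alpha:\alpha\in\Phi\setminus\Phi_0\}$. Let $\Delta=\{\alpha_1,\dots,\alpha_l\}$ be a basis of $\Phi$ as for Satake diagrams: $\Delta\cap\Phi_0$ is a basis of $\Phi_0$ and the positive roots in $\Phi\setminus\Phi_0$ restrict to a positive system of $\Sigma$. In the Satake diagram, nodes in $\Phi_0$ are black, others are white, and distinct white nodes with equal restriction to $\mathfrak a$ are joined by an arrow. If $\tilde\alpha=\sum m_i\alpha_i$ is the maximal root and $I\subseteq\{1,\dots,l\}$ is non-empty, consists of white nodes and is closed under arrows, put $\Phi_I=\{\sum p_i\alpha_i\in\Phi:p_j=m_j\ \forall j\in I\}$ and $\mathcal B_I=\bigoplus\{\mathfrak g_{\bar\alpha}:\alpha\in\Phi_I\}$ (sum over distinct restrictions). Labelling: $C_l$ is the chain $1-2-\dots-l$ with $\alpha_l$ the long simple root; maximal root $2\alpha_1+\dots+2\alpha_{l-1}+\alpha_l$. The Satake diagram of $\mathfrak{sp}_{p,l-p}$ has white nodes exactly $\{2,4,\dots,2p\}$ (none if $p=0$) and no arrows. *)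

theory Defs
  imports "HOL-Analysis.Analysis"
begin

section \<open>Quaternions\<close>

datatype quat = Quat (qre: real) (qi: real) (qj: real) (qk: real)

lemma quat_eqI:
  "\<lbrakk>qre x = qre y; qi x = qi y; qj x = qj y; qk x = qk y\<rbrakk> \<Longrightarrow> x = y"
  by (rule quat.expand) simp

instantiation quat :: real_algebra_1
begin

definition zero_quat :: quat where "0 = Quat 0 0 0 0"

definition one_quat :: quat where "1 = Quat 1 0 0 0"

definition plus_quat :: "quat \<Rightarrow> quat \<Rightarrow> quat" where
  "x + y = Quat (qre x + qre y) (qi x + qi y) (qj x + qj y) (qk x + qk y)"

definition uminus_quat :: "quat \<Rightarrow> quat" where
  "- x = Quat (- qre x) (- qi x) (- qj x) (- qk x)"

definition minus_quat :: "quat \<Rightarrow> quat \<Rightarrow> quat" where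
  "x - y = Quat (qre x - qre y) (qi x - qi y) (qj x - qj y) (qk x - qk y)"

definition scaleR_quat :: "real \<Rightarrow> quat \<Rightarrow> quat" where
  "r *\<^sub>R x = Quat (r * qre x) (r * qi x) (r * qj x) (r * qk x)"

definition times_quat :: "quat \<Rightarrow> quat \<Rightarrow> quat" where
  "x * y = Quat
     (qre x * qre y - qi x * qi y - qj x * qj y - qk x * qk y)
     (qre x * qi y + qi x * qre y + qj x * qk y - qk x * qj y)
     (qre x * qj y - qi x * qk y + qj x * qre y + qk x * qi y)
     (qre x * qk y + qi x * qj y - qj x * qi y + qk x * qre y)"

instance
  by standard
    (auto intro!: quat_eqI simp: zero_quat_def one_quat_def plus_quat_def uminus_quat_def
      minus_quat_def scaleR_quat_def times_quat_def algebra_simps)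

end

definition qcnj :: "quat \<Rightarrow> quat" where
  "qcnj x = Quat (qre x) (- qi x) (- qj x) (- qk x)"


section \<open>The Lie algebras of type $\mathfrak{sp}_{p,q}$\<close>

text \<open>
  The index type \<open>'n\<close> has \<open>p + q\<close> elements. It is linearly ordered, so that the first \<open>p\<close>
  positions on the diagonal make sense; \<open>card {k. k < i}\<close> is the (zero-based) position of \<open>i\<close>.
\<close>

type_synonym 'n qmat = "quat ^ 'n ^ 'n"

definition I_pq :: "nat \<Rightarrow> ('n :: {finite, linorder}) qmat" where
  "I_pq p = (\<chi> i j. if i = j then (if card {k. k < i} < p then 1 else - 1) else 0)"

definition conj_transpose :: "quat ^ 'n ^ 'm \<Rightarrow> quat ^ 'm ^ 'n" where
  "conj_transpose x = (\<chi> i j. qcnj (x $ j $ i))"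

definition sp :: "nat \<Rightarrow> ('n :: {finite, linorder}) qmat set" where
  "sp p = {x. I_pq p ** x + conj_transpose x ** I_pq p = 0}"

definition commutator :: "('n::finite) qmat \<Rightarrow> 'n qmat \<Rightarrow> 'n qmat" where
  "commutator x y = x ** y - y ** x"


section \<open>Real Lie algebras\<close>

text \<open>
  The trace of a linear endomorphism \<open>T\<close> of a finite-dimensional subspace \<open>V\<close>; it does not
  depend on the basis that is chosen.
\<close>

definition trace_on :: "'a::real_vector set \<Rightarrow> ('a \<Rightarrow> 'a) \<Rightarrow> real" where
  "trace_on V T =
     (let b = (SOME b. b \<subseteq> V \<and> independent b \<and> span b = V)
      in \<Sum>v\<in>b. representation b (T v) v)"

text \<open>
  The complexification of a real space consists of the pairs \<open>(x, y)\<close>, standing for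
  \<open>x + \<i> y\<close>; thus \<open>W \<times> W\<close> is the complexification of a subspace \<open>W\<close>.
\<close>

definition cscale :: "complex \<Rightarrow> 'a::real_vector \<times> 'a \<Rightarrow> 'a \<times> 'a" where
  "cscale c X = (Re c *\<^sub>R fst X - Im c *\<^sub>R snd X, Re c *\<^sub>R snd X + Im c *\<^sub>R fst X)"

text \<open>
  The complex dual of \<open>W \<times> W\<close>. Functionals are extended by \<open>0\<close> outside of \<open>W \<times> W\<close>, so that
  equality of functionals is equality of functions.
\<close>

definition cdual :: "'a::real_vector set \<Rightarrow> ('a \<times> 'a \<Rightarrow> complex) set" where
  "cdual W =
     {f. (\<forall>X\<in>W \<times> W. \<forall>Y\<in>W \<times> W. f (X + Y) = f X + f Y) \<and>
         (\<forall>c. \<forall>X\<in>W \<times> W. f (cscale c X) = c * f X) \<and>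
         (\<forall>X. X \<notin> W \<times> W \<longrightarrow> f X = 0)}"

locale real_lie_algebra =
  fixes g :: "'a::real_vector set"
    and br :: "'a \<Rightarrow> 'a \<Rightarrow> 'a"
  assumes subspace_g: "subspace g"
    and br_closed: "\<lbrakk>x \<in> g; y \<in> g\<rbrakk> \<Longrightarrow> br x y \<in> g"
    and br_add_left: "\<lbrakk>x \<in> g; y \<in> g; z \<in> g\<rbrakk> \<Longrightarrow> br (x + y) z = br x z + br y z"
    and br_add_right: "\<lbrakk>x \<in> g; y \<in> g; z \<in> g\<rbrakk> \<Longrightarrow> br x (y + z) = br x y + br x z"
    and br_scale_left: "\<lbrakk>x \<in> g; y \<in> g\<rbrakk> \<Longrightarrow> br (r *\<^sub>R x) y = r *\<^sub>R br x y"
    and br_scale_right: "\<lbrakk>x \<in> g; y \<in> g\<rbrakk> \<Longrightarrow> br x (r *\<^sub>R y) = r *\<^sub>R br x y"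
    and br_self: "x \<in> g \<Longrightarrow> br x x = 0"
    and jacobi: "\<lbrakk>x \<in> g; y \<in> g; z \<in> g\<rbrakk> \<Longrightarrow>
      br x (br y z) + br y (br z x) + br z (br x y) = 0"
begin

subsection \<open>Inner ideals and conjugacy\<close>

definition abelian :: "'a set \<Rightarrow> bool" where
  "abelian B \<longleftrightarrow> (\<forall>b\<in>B. \<forall>c\<in>B. br b c = 0)"

definition inner_ideal :: "'a set \<Rightarrow> bool" where
  "inner_ideal B \<longleftrightarrow>
     subspace B \<and> B \<subseteq> g \<and> (\<forall>b\<in>B. \<forall>c\<in>B. \<forall>x\<in>g. br b (br c x) \<in> B)"

definition nonzero_abelian_inner_ideals :: "'a set set" where
  "nonzero_abelian_inner_ideals = {B. inner_ideal B \<and> abelian B \<and> B \<noteq> {0}}"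

definition automorphism :: "('a \<Rightarrow> 'a) \<Rightarrow> bool" where
  "automorphism \<phi> \<longleftrightarrow>
     bij_betw \<phi> g g \<and>
     (\<forall>x\<in>g. \<forall>y\<in>g. \<phi> (x + y) = \<phi> x + \<phi> y) \<and>
     (\<forall>r. \<forall>x\<in>g. \<phi> (r *\<^sub>R x) = r *\<^sub>R \<phi> x) \<and>
     (\<forall>x\<in>g. \<forall>y\<in>g. \<phi> (br x y) = br (\<phi> x) (\<phi> y))"

definition conjugate :: "'a set \<Rightarrow> 'a set \<Rightarrow> bool" where
  "conjugate B B' \<longleftrightarrow> (\<exists>\<phi>. automorphism \<phi> \<and> \<phi> ` B = B')"

definition conjugacy :: "('a set \<times> 'a set) set" where
  "conjugacy = {(B, B'). conjugate B B'}"

subsection \<open>Killing form, Cartan involutions and split abelian subspaces\<close>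

definition killing :: "'a \<Rightarrow> 'a \<Rightarrow> real" where
  "killing x y = trace_on g (\<lambda>z. br x (br y z))"

definition cartan_involution :: "('a \<Rightarrow> 'a) \<Rightarrow> bool" where
  "cartan_involution \<theta> \<longleftrightarrow>
     automorphism \<theta> \<and> (\<forall>x\<in>g. \<theta> (\<theta> x) = x) \<and>
     (\<forall>x\<in>g. x \<noteq> 0 \<longrightarrow> - killing x (\<theta> x) > 0)"

definition split_abelian :: "'a set \<Rightarrow> bool" where
  "split_abelian A \<longleftrightarrow>
     subspace A \<and> A \<subseteq> g \<and> abelian A \<and>
     (\<forall>x\<in>A. x \<noteq> 0 \<longrightarrow> killing x x > 0) \<and>
     (\<exists>\<theta>. cartan_involution \<theta> \<and> (\<forall>x\<in>A. \<theta> x = - x))"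

definition maximal_split_abelian :: "'a set \<Rightarrow> bool" where
  "maximal_split_abelian A \<longleftrightarrow>
     split_abelian A \<and> (\<forall>A'. split_abelian A' \<and> A \<subseteq> A' \<longrightarrow> A' = A)"

definition maximal_abelian_subalgebra :: "'a set \<Rightarrow> bool" where
  "maximal_abelian_subalgebra h \<longleftrightarrow>
     subspace h \<and> h \<subseteq> g \<and> abelian h \<and>
     (\<forall>h'. subspace h' \<and> h' \<subseteq> g \<and> abelian h' \<and> h \<subseteq> h' \<longrightarrow> h' = h)"

definition restricted_space :: "'a set \<Rightarrow> ('a \<Rightarrow> real) \<Rightarrow> 'a set" where
  "restricted_space a f = {x \<in> g. \<forall>u\<in>a. br u x = f u *\<^sub>R x}"

subsection \<open>Roots of the complexification\<close>

text \<open>The complex bilinear extensions of the bracket and of the Killing form.\<close>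

definition cbr :: "'a \<times> 'a \<Rightarrow> 'a \<times> 'a \<Rightarrow> 'a \<times> 'a" where
  "cbr X Y = (br (fst X) (fst Y) - br (snd X) (snd Y), br (fst X) (snd Y) + br (snd X) (fst Y))"

definition ckilling :: "'a \<times> 'a \<Rightarrow> 'a \<times> 'a \<Rightarrow> complex" where
  "ckilling X Y =
     Complex (killing (fst X) (fst Y) - killing (snd X) (snd Y))
             (killing (fst X) (snd Y) + killing (snd X) (fst Y))"

definition root_space :: "'a set \<Rightarrow> ('a \<times> 'a \<Rightarrow> complex) \<Rightarrow> ('a \<times> 'a) set" where
  "root_space h f = {Z \<in> g \<times> g. \<forall>H\<in>h \<times> h. cbr H Z = cscale (f H) Z}"

definition roots :: "'a set \<Rightarrow> ('a \<times> 'a \<Rightarrow> complex) set" where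
  "roots h = {f \<in> cdual h. f \<noteq> (\<lambda>_. 0) \<and> root_space h f \<noteq> {0}}"

text \<open>
  The form on the dual of \<open>h \<times> h\<close> induced by the Killing form: \<open>dual_vec h f\<close> is the element
  of \<open>h \<times> h\<close> that represents \<open>f\<close>.
\<close>

definition dual_vec :: "'a set \<Rightarrow> ('a \<times> 'a \<Rightarrow> complex) \<Rightarrow> 'a \<times> 'a" where
  "dual_vec h f = (THE T. T \<in> h \<times> h \<and> (\<forall>H\<in>h \<times> h. ckilling T H = f H))"

definition dual_form ::
    "'a set \<Rightarrow> ('a \<times> 'a \<Rightarrow> complex) \<Rightarrow> ('a \<times> 'a \<Rightarrow> complex) \<Rightarrow> complex" where
  "dual_form h f f' = ckilling (dual_vec h f) (dual_vec h f')"

definition cartan_number ::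
    "'a set \<Rightarrow> ('a \<times> 'a \<Rightarrow> complex) \<Rightarrow> ('a \<times> 'a \<Rightarrow> complex) \<Rightarrow> complex" where
  "cartan_number h f f' = 2 * dual_form h f f' / dual_form h f' f'"

end

text \<open>
  A basis of a root system \<open>\<Phi>\<close>, whose elements are functionals. Linear independence is over the
  reals, in the real span of the roots.
\<close>

definition root_basis :: "('b \<Rightarrow> complex) set \<Rightarrow> ('b \<Rightarrow> complex) set \<Rightarrow> bool" where
  "root_basis \<Phi> D \<longleftrightarrow>
     finite D \<and> D \<subseteq> \<Phi> \<and>
     (\<forall>c :: ('b \<Rightarrow> complex) \<Rightarrow> real.
        (\<forall>X. (\<Sum>f\<in>D. of_real (c f) * f X) = 0) \<longrightarrow> (\<forall>f\<in>D. c f = 0)) \<and>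
     (\<forall>b\<in>\<Phi>. \<exists>c :: ('b \<Rightarrow> complex) \<Rightarrow> int.
        b = (\<lambda>X. \<Sum>f\<in>D. of_int (c f) * f X) \<and>
        ((\<forall>f\<in>D. c f \<ge> 0) \<or> (\<forall>f\<in>D. c f \<le> 0)))"

definition positive_roots :: "('b \<Rightarrow> complex) set \<Rightarrow> ('b \<Rightarrow> complex) set \<Rightarrow> ('b \<Rightarrow> complex) set"
where
  "positive_roots \<Phi> D =
     {b \<in> \<Phi>. \<exists>c :: ('b \<Rightarrow> complex) \<Rightarrow> int.
        b = (\<lambda>X. \<Sum>f\<in>D. of_int (c f) * f X) \<and> (\<forall>f\<in>D. c f \<ge> 0)}"

text \<open>
  A positive system of a (possibly non-reduced) root system in the dual of a real space \<open>a\<close>: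
  the roots that are positive at some regular element of \<open>a\<close>.
\<close>

definition positive_system :: "'a set \<Rightarrow> ('a \<Rightarrow> real) set \<Rightarrow> ('a \<Rightarrow> real) set \<Rightarrow> bool" where
  "positive_system a S P \<longleftrightarrow>
     (\<exists>x\<in>a. (\<forall>f\<in>S. f x \<noteq> 0) \<and> P = {f \<in> S. f x > 0})"

text \<open>
  Restriction of a functional on \<open>h \<times> h\<close> to \<open>a \<subseteq> h\<close>, extended by \<open>0\<close> outside of \<open>a\<close>. Roots
  take real values on \<open>a\<close>, so that nothing is lost by taking the real part.
\<close>

definition restr :: "'a::real_vector set \<Rightarrow> ('a \<times> 'a \<Rightarrow> complex) \<Rightarrow> ('a \<Rightarrow> real)" where
  "restr a f = (\<lambda>x. if x \<in> a then Re (f (x, 0)) else 0)"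

definition black_roots ::
    "'a::real_vector set \<Rightarrow> ('a \<times> 'a \<Rightarrow> complex) set \<Rightarrow> ('a \<times> 'a \<Rightarrow> complex) set" where
  "black_roots a \<Phi> = {f \<in> \<Phi>. restr a f = (\<lambda>_. 0)}"

definition restricted_roots ::
    "'a::real_vector set \<Rightarrow> ('a \<times> 'a \<Rightarrow> complex) set \<Rightarrow> ('a \<Rightarrow> real) set" where
  "restricted_roots a \<Phi> = restr a ` (\<Phi> - black_roots a \<Phi>)"


section \<open>Satake diagrams and the spaces $\mathcal{B}_I$\<close>

text \<open>The simple roots are \<open>\<alpha> 1, \<dots>, \<alpha> l\<close>; other values of \<open>\<alpha>\<close> are irrelevant.\<close>

locale satake_data = real_lie_algebra g br
  for g :: "'a::real_vector set" and br :: "'a \<Rightarrow> 'a \<Rightarrow> 'a" +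
  fixes a h :: "'a set"
    and l :: nat
    and \<alpha> :: "nat \<Rightarrow> 'a \<times> 'a \<Rightarrow> complex"
  assumes a_maximal: "maximal_split_abelian a"
    and h_maximal: "maximal_abelian_subalgebra h"
    and a_subset_h: "a \<subseteq> h"
    and inj_simple: "inj_on \<alpha> {1..l}"
    and basis: "root_basis (roots h) (\<alpha> ` {1..l})"
    and black_basis:
      "root_basis (black_roots a (roots h)) (\<alpha> ` {1..l} \<inter> black_roots a (roots h))"
    and restricted_positive:
      "positive_system a (restricted_roots a (roots h))
         (restr a ` (positive_roots (roots h) (\<alpha> ` {1..l}) - black_roots a (roots h)))"
begin

definition root_coords :: "('a \<times> 'a \<Rightarrow> complex) \<Rightarrow> nat \<Rightarrow> int" where
  "root_coords b =
     (THE c. b = (\<lambda>X. \<Sum>i=1..l. of_int (c i) * \<alpha> i X) \<and> (\<forall>i. i \<notin> {1..l} \<longrightarrow> c i = 0))"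

definition maximal_root :: "'a \<times> 'a \<Rightarrow> complex" where
  "maximal_root =
     (THE b. b \<in> roots h \<and>
        (\<forall>b'\<in>roots h. \<forall>i\<in>{1..l}. root_coords b' i \<le> root_coords b i))"

definition white :: "nat \<Rightarrow> bool" where
  "white i \<longleftrightarrow> i \<in> {1..l} \<and> \<alpha> i \<notin> black_roots a (roots h)"

definition arrow :: "nat \<Rightarrow> nat \<Rightarrow> bool" where
  "arrow i j \<longleftrightarrow> white i \<and> white j \<and> i \<noteq> j \<and> restr a (\<alpha> i) = restr a (\<alpha> j)"

definition admissible :: "nat set \<Rightarrow> bool" where
  "admissible I \<longleftrightarrow>
     I \<noteq> {} \<and> (\<forall>i\<in>I. white i) \<and> (\<forall>i\<in>I. \<forall>j. arrow i j \<longrightarrow> j \<in> I)"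

definition Phi_I :: "nat set \<Rightarrow> ('a \<times> 'a \<Rightarrow> complex) set" where
  "Phi_I I = {b \<in> roots h. \<forall>j\<in>I. root_coords b j = root_coords maximal_root j}"

definition B_I :: "nat set \<Rightarrow> 'a set" where
  "B_I I = span (\<Union>b\<in>Phi_I I. restricted_space a (restr a b))"

text \<open>
  The nodes are numbered as in the diagram \<open>1 - 2 - \<dots> - l\<close> of type \<open>C\<^sub>l\<close>, with \<open>\<alpha> l\<close> the long
  simple root. Since \<open>cartan_number h f f'\<close> is normalised by \<open>f'\<close>, the entry \<open>-2\<close> is the one
  for the pair \<open>(\<alpha> l, \<alpha> (l - 1))\<close>.
\<close>

definition C_labelling :: bool where
  "C_labelling \<longleftrightarrow>
     (\<forall>i\<in>{1..l}. \<forall>j\<in>{1..l}.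
        cartan_number h (\<alpha> i) (\<alpha> j) =
          (if i = j then 2
           else if i = l \<and> j + 1 = l then - 2
           else if i + 1 = j \<or> j + 1 = i then - 1
           else 0))"

end


section \<open>The algebra $\mathfrak{sp}_{p,q}$ as a real Lie algebra\<close>

lemma matrix_mul_lneg: "(- x) ** y = - (x ** y)" for x y :: "quat ^ 'n ^ 'n"
  by (simp add: vec_eq_iff matrix_matrix_mult_def sum_negf)

lemma matrix_mul_rneg: "x ** (- y) = - (x ** y)" for x y :: "quat ^ 'n ^ 'n"
  by (simp add: vec_eq_iff matrix_matrix_mult_def sum_negf)

lemma matrix_mul_ladd: "(x + y) ** z = x ** z + y ** z" for x y z :: "quat ^ 'n ^ 'n"
  by (simp add: vec_eq_iff matrix_matrix_mult_def sum.distrib distrib_right)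

lemma matrix_mul_radd: "z ** (x + y) = z ** x + z ** y" for x y z :: "quat ^ 'n ^ 'n"
  by (simp add: vec_eq_iff matrix_matrix_mult_def sum.distrib distrib_left)

lemma matrix_mul_lsub: "(x - y) ** z = x ** z - y ** z" for x y z :: "quat ^ 'n ^ 'n"
  by (simp add: vec_eq_iff matrix_matrix_mult_def sum_subtractf left_diff_distrib)

lemma matrix_mul_rsub: "z ** (x - y) = z ** x - z ** y" for x y z :: "quat ^ 'n ^ 'n"
  by (simp add: vec_eq_iff matrix_matrix_mult_def sum_subtractf right_diff_distrib)

lemma matrix_mul_lscale: "(r *\<^sub>R x) ** y = r *\<^sub>R (x ** y)" for x y :: "quat ^ 'n ^ 'n"
  by (simp add: vec_eq_iff matrix_matrix_mult_def scaleR_sum_right)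

lemma matrix_mul_rscale: "x ** (r *\<^sub>R y) = r *\<^sub>R (x ** y)" for x y :: "quat ^ 'n ^ 'n"
  by (simp add: vec_eq_iff matrix_matrix_mult_def scaleR_sum_right)

lemma qcnj_add: "qcnj (x + y) = qcnj x + qcnj y"
  by (simp add: qcnj_def plus_quat_def)

lemma qcnj_diff: "qcnj (x - y) = qcnj x - qcnj y"
  by (simp add: qcnj_def minus_quat_def)

lemma qcnj_zero: "qcnj 0 = 0"
  by (simp add: qcnj_def zero_quat_def)

lemma qcnj_scale: "qcnj (r *\<^sub>R x) = r *\<^sub>R qcnj x"
  by (simp add: qcnj_def scaleR_quat_def)

lemma qcnj_mult: "qcnj (x * y) = qcnj y * qcnj x"
  by (simp add: qcnj_def times_quat_def algebra_simps)

lemma qcnj_sum: "qcnj (sum f S) = (\<Sum>i\<in>S. qcnj (f i))"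
  by (induction S rule: infinite_finite_induct) (simp_all add: qcnj_zero qcnj_add)

lemma conj_transpose_mult:
  "conj_transpose (x ** y) = conj_transpose y ** conj_transpose x"
  for x y :: "quat ^ 'n ^ 'n"
  by (simp add: vec_eq_iff conj_transpose_def matrix_matrix_mult_def qcnj_sum qcnj_mult)

lemma conj_transpose_add: "conj_transpose (x + y) = conj_transpose x + conj_transpose y"
  by (simp add: vec_eq_iff conj_transpose_def qcnj_add)

lemma conj_transpose_diff: "conj_transpose (x - y) = conj_transpose x - conj_transpose y"
  by (simp add: vec_eq_iff conj_transpose_def qcnj_diff)

lemma conj_transpose_scale: "conj_transpose (r *\<^sub>R x) = r *\<^sub>R conj_transpose x"
  by (simp add: vec_eq_iff conj_transpose_def qcnj_scale)

lemma sp_iff: "x \<in> sp p \<longleftrightarrow> conj_transpose x ** I_pq p = - (I_pq p ** x)"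
  by (auto simp: sp_def eq_neg_iff_add_eq_0 add.commute)

lemma sp_subspace: "subspace (sp p)"
proof (rule subspaceI)
  show "(0 :: ('n::{finite,linorder}) qmat) \<in> sp p"
    by (simp add: sp_def vec_eq_iff matrix_matrix_mult_def conj_transpose_def qcnj_zero)
next
  fix x y :: "('n::{finite,linorder}) qmat" assume "x \<in> sp p" "y \<in> sp p"
  then show "x + y \<in> sp p"
    by (simp add: sp_iff conj_transpose_add matrix_mul_ladd matrix_mul_radd)
next
  fix r and x :: "('n::{finite,linorder}) qmat" assume "x \<in> sp p"
  then show "r *\<^sub>R x \<in> sp p"
    by (simp add: sp_iff conj_transpose_scale matrix_mul_lscale matrix_mul_rscale)
qed

lemma sp_commutator: "commutator x y \<in> sp p" if "x \<in> sp p" "y \<in> sp p"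
proof -
  let ?I = "I_pq p"
  have *: "conj_transpose u ** conj_transpose v ** ?I = ?I ** (u ** v)"
    if "u \<in> sp p" "v \<in> sp p" for u v
  proof -
    have "conj_transpose u ** conj_transpose v ** ?I = conj_transpose u ** - (?I ** v)"
      using that by (simp add: sp_iff flip: matrix_mul_assoc)
    also have "\<dots> = - (conj_transpose u ** ?I ** v)"
      by (simp add: matrix_mul_rneg matrix_mul_assoc)
    also have "\<dots> = ?I ** (u ** v)"
      using that by (simp add: sp_iff matrix_mul_lneg matrix_mul_assoc)
    finally show ?thesis .
  qed
  show ?thesis
    using *[OF that] *[OF that(2,1)]
    by (simp add: sp_iff commutator_def conj_transpose_diff conj_transpose_mult
        matrix_mul_lsub matrix_mul_rsub)
qed

lemma real_lie_algebra_sp: "real_lie_algebra (sp p) commutator"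
proof
  show "subspace (sp p)"
    by (rule sp_subspace)
qed (simp_all add: sp_commutator[unfolded commutator_def] commutator_def matrix_mul_ladd matrix_mul_radd matrix_mul_lsub
    matrix_mul_rsub matrix_mul_lscale matrix_mul_rscale matrix_mul_assoc scaleR_diff_right)

end

theory Submission
  imports Defs "HOL-Computational_Algebra.Fundamental_Theorem_Algebra"
begin

text \<open>
  Every element \<open>b\<close> of an abelian inner ideal \<open>B\<close> satisfies \<open>b\<^sup>2 = 0\<close>, and \<open>B\<close> consists of all
  skew-adjoint matrices with image in one totally isotropic subspace \<open>U\<close> of the quaternionic hermitian
  space. By Witt's theorem the conjugacy class of \<open>B\<close> is determined by the dimension \<open>k \<le> p\<close> of \<open>U\<close>.

  For a maximal split abelian subspace \<open>a\<close>, each \<open>ad x\<close> with \<open>x\<close> in \<open>a\<close> is self-adjoint with respect to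
  \<open>- killing y (\<theta> z)\<close>; hence \<open>a\<close> is the space of real diagonal matrices in some Witt basis, which can be
  chosen such that \<open>h\<close> is the space of complex diagonal matrices. The roots are then
  \<open>\<plusminus> \<epsilon>\<^sub>i \<plusminus> \<epsilon>\<^sub>j\<close>, and the Cartan matrix forces \<open>\<alpha>\<^sub>i = \<delta>\<^sub>i - \<delta>\<^sub>i\<^sub>+\<^sub>1\<close> and \<open>\<alpha>\<^sub>l = 2 \<delta>\<^sub>l\<close>, where \<open>\<delta>\<close> is
  a signed permutation of \<open>\<epsilon>\<close>. At a regular positive element of \<open>a\<close> one has
  \<open>\<delta>\<^sub>1 = \<delta>\<^sub>2 > \<delta>\<^sub>3 = \<delta>\<^sub>4 > \<dots>\<close>, because each nonzero restricted weight occurs exactly twice. So the ideal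
  attached to the node \<open>2 k\<close> belongs to the isotropic span of the first \<open>k\<close> weight lines of \<open>a\<close>.
\<close>

section \<open>Quaternions as a Euclidean division algebra\<close>

text \<open>Over the quaternions an eigenvalue is defined only up to conjugacy, so eigenvectors are
  taken for the right action of the copy of the complex numbers spanned by 1 and i. Every commuting
  family then has a joint eigenvector, but it may be isotropic, and a Witt basis of eigenvectors
  needs for each isotropic one another eigenvector that pairs with it. For a split abelian subspace
  this partner and the reality of the weights are both extracted from self-adjointness; the Cartan
  involution enters only through the positive definite form, so the Cartan involutions need not be
  classified. Conversely, an explicit involution is built to see that all real diagonal matrices of
  a Witt basis form a split abelian subspace; only then does maximality of a give equality.

  Ideals for different k are told apart by their real dimension, which every automorphism preserves,
  whether or not it comes from an isometry. The condition 2 p <= l makes p the smaller index of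
  inertia and hence the Witt index.\<close>

lemma quat_sel [simp]:
  "qre 0 = 0" "qi 0 = 0" "qj 0 = 0" "qk 0 = 0"
  "qre 1 = 1" "qi 1 = 0" "qj 1 = 0" "qk 1 = 0"
  "qre (x + y) = qre x + qre y" "qi (x + y) = qi x + qi y"
  "qj (x + y) = qj x + qj y" "qk (x + y) = qk x + qk y"
  "qre (x - y) = qre x - qre y" "qi (x - y) = qi x - qi y"
  "qj (x - y) = qj x - qj y" "qk (x - y) = qk x - qk y"
  "qre (- x) = - qre x" "qi (- x) = - qi x" "qj (- x) = - qj x" "qk (- x) = - qk x"
  "qre (r *\<^sub>R x) = r * qre x" "qi (r *\<^sub>R x) = r * qi x"
  "qj (r *\<^sub>R x) = r * qj x" "qk (r *\<^sub>R x) = r * qk x"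
  "qre (x * y) = qre x * qre y - qi x * qi y - qj x * qj y - qk x * qk y"
  "qi (x * y) = qre x * qi y + qi x * qre y + qj x * qk y - qk x * qj y"
  "qj (x * y) = qre x * qj y - qi x * qk y + qj x * qre y + qk x * qi y"
  "qk (x * y) = qre x * qk y + qi x * qj y - qj x * qi y + qk x * qre y"
  "qre (qcnj x) = qre x" "qi (qcnj x) = - qi x" "qj (qcnj x) = - qj x" "qk (qcnj x) = - qk x"
  by (simp_all add: zero_quat_def one_quat_def plus_quat_def uminus_quat_def
      minus_quat_def scaleR_quat_def times_quat_def qcnj_def)

lemma quat_eq_iff: "x = y \<longleftrightarrow> qre x = qre y \<and> qi x = qi y \<and> qj x = qj y \<and> qk x = qk y"
  by (auto intro: quat_eqI)

lemma qre_sum: "qre (sum f S) = (\<Sum>i\<in>S. qre (f i))"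
  by (induction S rule: infinite_finite_induct) simp_all

lemma qcnj_simps [simp]:
  "qcnj (qcnj x) = x" "qcnj 0 = 0" "qcnj 1 = 1" "qcnj (- x) = - qcnj x"
  "qcnj (x + y) = qcnj x + qcnj y" "qcnj (x - y) = qcnj x - qcnj y"
  "qcnj (r *\<^sub>R x) = r *\<^sub>R qcnj x" "qcnj (x * y) = qcnj y * qcnj x"
  "qcnj (of_real r) = of_real r"
  by (simp_all add: quat_eq_iff of_real_def algebra_simps)

lemma qcnj_eq_0_iff [simp]: "qcnj x = 0 \<longleftrightarrow> x = 0"
  by (auto simp: quat_eq_iff)

text \<open>Matrices over \<open>quat\<close> thereby form a Euclidean space, which supplies
  \<open>DIM\<close> for the counting arguments and \<open>Basis\<close> for the computation of
  traces.\<close>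

instantiation quat :: euclidean_space
begin

definition inner_quat :: "quat \<Rightarrow> quat \<Rightarrow> real" where
  "inner_quat x y = qre x * qre y + qi x * qi y + qj x * qj y + qk x * qk y"

definition norm_quat :: "quat \<Rightarrow> real" where
  "norm_quat x = sqrt (qre x * qre x + qi x * qi x + qj x * qj x + qk x * qk x)"

definition sgn_quat :: "quat \<Rightarrow> quat" where
  "sgn_quat x = x /\<^sub>R norm x"

definition dist_quat :: "quat \<Rightarrow> quat \<Rightarrow> real" where
  "dist_quat x y = norm (x - y)"

definition uniformity_quat :: "(quat \<times> quat) filter" where
  "uniformity_quat = (INF e\<in>{0 <..}. principal {(x, y). dist x y < e})"

definition open_quat :: "quat set \<Rightarrow> bool" where
  "open_quat U \<longleftrightarrow> (\<forall>x\<in>U. eventually (\<lambda>(x', y). x' = x \<longrightarrow> y \<in> U) uniformity)"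

definition Basis_quat :: "quat set" where
  "Basis_quat = {1, Quat 0 1 0 0, Quat 0 0 1 0, Quat 0 0 0 1}"

instance
proof
  fix x y z :: quat and r :: real and S :: "quat set"
  show "dist x y = norm (x - y)"
    by (rule dist_quat_def)
  show "sgn x = x /\<^sub>R norm x"
    by (rule sgn_quat_def)
  show "uniformity = (INF e\<in>{0 <..}. principal {(x :: quat, y). dist x y < e})"
    by (rule uniformity_quat_def)
  show "open S \<longleftrightarrow> (\<forall>x\<in>S. eventually (\<lambda>(x', y). x' = x \<longrightarrow> y \<in> S) uniformity)"
    by (rule open_quat_def)
  show "inner x y = inner y x"
    by (simp add: inner_quat_def mult.commute)
  show "inner (x + y) z = inner x z + inner y z"
    by (simp add: inner_quat_def algebra_simps)
  show "inner (r *\<^sub>R x) y = r * inner x y"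
    by (simp add: inner_quat_def algebra_simps)
  show "0 \<le> inner x x"
    by (simp add: inner_quat_def)
  show "inner x x = 0 \<longleftrightarrow> x = 0"
    by (simp add: inner_quat_def quat_eq_iff add_nonneg_eq_0_iff)
  show "norm x = sqrt (inner x x)"
    by (simp add: norm_quat_def inner_quat_def)
  show "finite (Basis :: quat set)" "(Basis :: quat set) \<noteq> {}"
    by (simp_all add: Basis_quat_def)
  show "(\<forall>u\<in>Basis. inner x u = 0) \<longleftrightarrow> x = 0"
    by (simp add: Basis_quat_def inner_quat_def) (simp add: quat_eq_iff)
next
  fix u v :: quat
  assume "u \<in> Basis" "v \<in> Basis"
  then show "inner u v = (if u = v then 1 else 0)"
    by (auto simp: Basis_quat_def inner_quat_def quat_eq_iff)
qed

end

instantiation quat :: real_div_algebra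
begin

definition inverse_quat :: "quat \<Rightarrow> quat" where
  "inverse_quat x = (1 / (qre x * qre x + qi x * qi x + qj x * qj x + qk x * qk x)) *\<^sub>R qcnj x"

definition divide_quat :: "quat \<Rightarrow> quat \<Rightarrow> quat" where
  "divide_quat x y = x * inverse y"

instance
proof (standard, goal_cases)
  case (1 x)
  let ?n = "qre x * qre x + qi x * qi x + qj x * qj x + qk x * qk x"
  have "qcnj x * x = ?n *\<^sub>R 1"
    by (simp add: quat_eq_iff)
  moreover from 1 have "?n \<noteq> 0"
    by (auto simp: quat_eq_iff add_nonneg_eq_0_iff)
  ultimately show ?case
    by (simp add: inverse_quat_def)
next
  case (2 x)
  let ?n = "qre x * qre x + qi x * qi x + qj x * qj x + qk x * qk x"
  have "x * qcnj x = ?n *\<^sub>R 1"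
    by (simp add: quat_eq_iff)
  moreover from 2 have "?n \<noteq> 0"
    by (auto simp: quat_eq_iff add_nonneg_eq_0_iff)
  ultimately show ?case
    by (simp add: inverse_quat_def)
next
  case (3 x y)
  show ?case
    by (rule divide_quat_def)
next
  case 4
  show ?case
    by (simp add: inverse_quat_def quat_eq_iff)
qed

end

lemma DIM_quat: "DIM(quat) = 4"
  by (simp add: Basis_quat_def quat_eq_iff)

lemma sum_Basis_quat:
  "(\<Sum>u\<in>Basis. f u) = f 1 + f (Quat 0 1 0 0) + f (Quat 0 0 1 0) + f (Quat 0 0 0 1)"
  for f :: "quat \<Rightarrow> 'b::comm_monoid_add"
  by (simp add: Basis_quat_def quat_eq_iff add_ac)

lemma qcnj_mult_self: "qcnj x * x = of_real ((norm x)\<^sup>2)"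
  by (simp add: quat_eq_iff of_real_def norm_quat_def)

lemma qre_mult_commute: "qre (x * y) = qre (y * x)"
  by (simp add: mult.commute)

text \<open>The plane spanned by 1 and i. Acting on columns from the right it commutes with the
  action of matrices, so columns form a complex space on which matrices are complex linear.\<close>

definition cq :: "complex \<Rightarrow> quat" where
  "cq z = Quat (Re z) (Im z) 0 0"

definition jq :: quat where
  "jq = Quat 0 0 1 0"

lemma cq_sel [simp]: "qre (cq z) = Re z" "qi (cq z) = Im z" "qj (cq z) = 0" "qk (cq z) = 0"
  by (simp_all add: cq_def)

lemma jq_sel [simp]: "qre jq = 0" "qi jq = 0" "qj jq = 1" "qk jq = 0"
  by (simp_all add: jq_def)

lemma cq_simps [simp]:
  "cq 0 = 0" "cq 1 = 1" "cq (y + z) = cq y + cq z" "cq (y - z) = cq y - cq z"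
  "cq (- z) = - cq z" "cq (y * z) = cq y * cq z" "qcnj (cq z) = cq (cnj z)"
  "cq (of_real r) = of_real r" "qcnj jq = - jq" "cq (r *\<^sub>R z) = r *\<^sub>R cq z"
  by (simp_all add: quat_eq_iff of_real_def)

lemma cq_eq_iff [simp]: "cq y = cq z \<longleftrightarrow> y = z"
  by (auto simp: quat_eq_iff complex_eq_iff)

lemma cq_eq_0_iff [simp]: "cq z = 0 \<longleftrightarrow> z = 0"
  using cq_eq_iff[of z 0] by (simp del: cq_eq_iff)

lemma cq_jq: "cq z * jq = jq * cq (cnj z)"
  by (simp add: quat_eq_iff)

lemma jq_neq_0 [simp]: "jq \<noteq> 0"
  by (simp add: quat_eq_iff)

lemma sum_Basis_matrix:
  "(\<Sum>b\<in>Basis. f b) = (\<Sum>i\<in>UNIV. \<Sum>j\<in>UNIV. \<Sum>u\<in>Basis. f (axis i (axis j u)))"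
  for f :: "'a::euclidean_space ^ 'm ^ 'n \<Rightarrow> 'b::comm_monoid_add"
proof -
  have vec: "(\<Sum>b\<in>Basis. h b) = (\<Sum>i\<in>UNIV. \<Sum>u\<in>Basis. h (axis i u))"
    for h :: "'c::euclidean_space ^ 'k \<Rightarrow> 'b"
  proof -
    let ?f = "\<lambda>(i :: 'k, u :: 'c). axis i u"
    have "sum h Basis = sum h (?f ` (UNIV \<times> Basis))"
      by (rule arg_cong[where f = "sum h"]) (auto simp: Basis_vec_def)
    also have "\<dots> = sum (h \<circ> ?f) (UNIV \<times> Basis)"
      by (rule sum.reindex) (auto simp: inj_on_def axis_eq_axis)
    also have "\<dots> = (\<Sum>i\<in>UNIV. \<Sum>u\<in>Basis. h (axis i u))"
      by (simp add: sum.cartesian_product case_prod_unfold)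
    finally show ?thesis .
  qed
  show ?thesis
    by (simp add: vec)
qed

section \<open>Hermitian forms over the quaternions\<close>

text \<open>Scalars sit on the right because left multiplication by a quaternion does not commute
  with the action of matrices.\<close>

definition rsc :: "quat ^ 'n \<Rightarrow> quat \<Rightarrow> quat ^ 'n" where
  "rsc v q = (\<chi> i. v $ i * q)"

lemma rsc_nth [simp]: "rsc v q $ i = v $ i * q"
  by (simp add: rsc_def)

lemma rsc_simps [simp]:
  "rsc 0 q = 0" "rsc v 0 = 0" "rsc v 1 = v" "rsc (rsc v q) r = rsc v (q * r)"
  "rsc (- v) q = - rsc v q" "rsc v (- q) = - rsc v q"
  by (simp_all add: vec_eq_iff mult.assoc)

lemma rsc_add: "rsc (u + v) q = rsc u q + rsc v q" "rsc v (q + r) = rsc v q + rsc v r"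
  by (simp_all add: vec_eq_iff algebra_simps)

lemma rsc_diff: "rsc (u - v) q = rsc u q - rsc v q" "rsc v (q - r) = rsc v q - rsc v r"
  by (simp_all add: vec_eq_iff algebra_simps)

lemma rsc_scaleR: "rsc (r *\<^sub>R v) q = r *\<^sub>R rsc v q" "rsc v (r *\<^sub>R q) = r *\<^sub>R rsc v q"
  by (simp_all add: vec_eq_iff)

lemma rsc_of_real: "rsc v (of_real r) = r *\<^sub>R v"
  by (simp add: vec_eq_iff of_real_def)

lemma rsc_sum: "rsc (sum f S) q = (\<Sum>i\<in>S. rsc (f i) q)" "rsc v (sum h S) = (\<Sum>i\<in>S. rsc v (h i))"
  by (induction S rule: infinite_finite_induct) (simp_all add: rsc_add)

lemma rsc_eq_0_iff [simp]: "rsc v q = 0 \<longleftrightarrow> v = 0 \<or> q = 0"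
  by (auto simp: vec_eq_iff)

lemma mv_rsc: "x *v rsc v q = rsc (x *v v) q"
  by (simp add: vec_eq_iff matrix_vector_mult_def sum_distrib_right mult.assoc)

lemma mv_diff_left: "(x - y) *v v = x *v v - y *v v" for x y :: "quat ^ 'n ^ 'm"
  by (simp add: vec_eq_iff matrix_vector_mult_def sum_subtractf left_diff_distrib)

lemma mv_minus_left: "(- x) *v v = - (x *v v)" for x :: "quat ^ 'n ^ 'm"
  by (simp add: vec_eq_iff matrix_vector_mult_def sum_negf)

lemma mv_add_left: "(x + y) *v v = x *v v + y *v v" for x y :: "quat ^ 'n ^ 'm"
  by (simp add: vec_eq_iff matrix_vector_mult_def sum.distrib distrib_right)

lemma mv_scaleR_left: "(r *\<^sub>R x) *v v = r *\<^sub>R (x *v v)" for x :: "quat ^ 'n ^ 'm"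
  by (simp add: vec_eq_iff matrix_vector_mult_def scaleR_sum_right)

lemma mv_scaleR_right: "x *v (r *\<^sub>R v) = r *\<^sub>R (x *v v)" for x :: "quat ^ 'n ^ 'm"
  by (simp add: vec_eq_iff matrix_vector_mult_def scaleR_sum_right)

lemma mv_diff_right: "x *v (u - v) = x *v u - x *v v" for x :: "quat ^ 'n ^ 'm"
  by (simp add: vec_eq_iff matrix_vector_mult_def sum_subtractf right_diff_distrib)

lemma mv_add_right: "x *v (u + v) = x *v u + x *v v" for x :: "quat ^ 'n ^ 'm"
  by (simp add: vec_eq_iff matrix_vector_mult_def sum.distrib distrib_left)

lemma mv_minus_right: "x *v (- v) = - (x *v v)" for x :: "quat ^ 'n ^ 'm"
  by (simp add: vec_eq_iff matrix_vector_mult_def sum_negf)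

lemma mv_zero [simp]: "x *v 0 = 0" "0 *v v = 0" for x :: "quat ^ 'n ^ 'm"
  by (simp_all add: vec_eq_iff matrix_vector_mult_def)

lemma mv_sum_right: "x *v (sum f S) = (\<Sum>i\<in>S. x *v f i)" for x :: "quat ^ 'n ^ 'm"
  by (induction S rule: infinite_finite_induct) (simp_all add: mv_add_right)

lemma mv_sum_left: "sum f S *v v = (\<Sum>i\<in>S. f i *v v)" for v :: "quat ^ 'n"
  by (induction S rule: infinite_finite_induct) (simp_all add: mv_add_left)

lemma mv_assoc: "(x ** y) *v v = x *v (y *v v)" for x y :: "quat ^ 'n ^ 'n"
  by (simp add: matrix_vector_mul_assoc)

lemmas mv_simps = mv_rsc mv_diff_left mv_minus_left mv_add_left mv_scaleR_left mv_scaleR_right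
  mv_diff_right mv_add_right mv_minus_right mv_assoc

lemma mv_axis: "x *v axis j q = (\<chi> i. x $ i $ j * q)" for x :: "quat ^ 'n ^ 'm"
  by (simp add: vec_eq_iff matrix_vector_mult_def axis_def if_distrib cong: if_cong)

lemma matrix_eqI: "(\<And>v. x *v v = y *v v) \<Longrightarrow> x = y" for x y :: "quat ^ 'n ^ 'm"
proof -
  assume *: "\<And>v. x *v v = y *v v"
  show "x = y"
    using *[of "axis _ 1"] by (simp add: vec_eq_iff mv_axis)
qed

lemma commutator_mv: "commutator x y *v v = x *v (y *v v) - y *v (x *v v)"
  by (simp add: commutator_def mv_simps)

text \<open>Over the quaternions the trace is not invariant under cyclic permutation, but its real
  part is.\<close>

definition retr :: "quat ^ 'n ^ 'n \<Rightarrow> real" where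
  "retr x = (\<Sum>i\<in>UNIV. qre (x $ i $ i))"

lemma retr_mult_commute: "retr (x ** y) = retr (y ** x)"
proof -
  have "retr (x ** y) = (\<Sum>i\<in>UNIV. \<Sum>j\<in>UNIV. qre (x $ i $ j * y $ j $ i))"
    by (simp add: retr_def matrix_matrix_mult_def qre_sum del: quat_sel(25))
  also have "\<dots> = (\<Sum>j\<in>UNIV. \<Sum>i\<in>UNIV. qre (y $ j $ i * x $ i $ j))"
    by (subst sum.swap, simp only: qre_mult_commute)
  also have "\<dots> = retr (y ** x)"
    by (simp add: retr_def matrix_matrix_mult_def qre_sum del: quat_sel(25))
  finally show ?thesis .
qed

lemma retr_simps: "retr (x + y) = retr x + retr y" "retr (x - y) = retr x - retr y"
  "retr (r *\<^sub>R x) = r * retr x" "retr (- x) = - retr x"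
  by (simp_all add: retr_def sum.distrib sum_subtractf sum_distrib_left sum_negf)

text \<open>The sign function \<open>s\<close> stands for the diagonal matrix that defines the form.\<close>

locale quat_form =
  fixes s :: "'n::finite \<Rightarrow> real"
  assumes s_cases: "s i = 1 \<or> s i = - 1"
begin

definition form :: "quat ^ 'n \<Rightarrow> quat ^ 'n \<Rightarrow> quat" where
  "form u v = (\<Sum>i\<in>UNIV. s i *\<^sub>R (qcnj (u $ i) * v $ i))"

text \<open>The defining equation of \<open>sp\<close> as skew-adjointness, which frees the argument
  from coordinates; \<open>sp_eq_skew\<close> identifies the two sets.\<close>

definition skew :: "'n qmat set" where
  "skew = {x. \<forall>u v. form (x *v u) v = - form u (x *v v)}"

lemma skewD: "x \<in> skew \<Longrightarrow> form (x *v u) v = - form u (x *v v)"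
  by (simp add: skew_def)

lemma form_simps [simp]:
  "form 0 v = 0" "form u 0 = 0"
  "form (- u) v = - form u v" "form u (- v) = - form u v"
  by (simp_all add: form_def sum_negf)

lemma form_rsc [simp]: "form u (rsc v q) = form u v * q" "form (rsc u q) v = qcnj q * form u v"
  by (simp_all add: form_def sum_distrib_left sum_distrib_right mult.assoc)

lemma form_add: "form (u + u') v = form u v + form u' v" "form u (v + v') = form u v + form u v'"
  by (simp_all add: form_def sum.distrib algebra_simps)

lemma form_diff: "form (u - u') v = form u v - form u' v" "form u (v - v') = form u v - form u v'"
  by (simp_all add: form_def sum_subtractf algebra_simps)

lemma form_scaleR: "form (r *\<^sub>R u) v = r *\<^sub>R form u v" "form u (r *\<^sub>R v) = r *\<^sub>R form u v"
  by (simp_all add: form_def scaleR_sum_right algebra_simps)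

lemma form_sum: "form (sum f S) v = (\<Sum>i\<in>S. form (f i) v)" "form u (sum f S) = (\<Sum>i\<in>S. form u (f i))"
  by (induction S rule: infinite_finite_induct) (simp_all add: form_add)

lemma qcnj_form [simp]: "qcnj (form u v) = form v u"
  by (simp add: form_def qcnj_sum)

lemma form_eq_0_commute: "form u v = 0 \<longleftrightarrow> form v u = 0"
  by (metis qcnj_form qcnj_eq_0_iff)

lemma form_self_real: "form v v = of_real (qre (form v v))"
proof -
  have "qcnj (form v v) = form v v"
    by (rule qcnj_form)
  then show ?thesis
    unfolding quat_eq_iff by (simp add: of_real_def del: qcnj_form)
qed

lemma form_axis: "form (axis i q) v = s i *\<^sub>R (qcnj q * v $ i)"
proof -
  have "form (axis i q) v = (\<Sum>k\<in>UNIV. if k = i then s i *\<^sub>R (qcnj q * v $ i) else 0)"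
    unfolding form_def by (rule sum.cong) (auto simp: axis_def)
  then show ?thesis
    by simp
qed

lemma s_neq_0 [simp]: "s i \<noteq> 0"
  using s_cases[of i] by auto

lemma s_mult_self [simp]: "s i * s i = 1"
  using s_cases[of i] by auto

lemma form_nondegenerate: "v = 0" if "\<And>u. form u v = 0"
  using that[of "axis _ 1"] by (simp add: form_axis vec_eq_iff)

lemma ex_form_eq: "\<exists>u. form u v = q" if "v \<noteq> 0"
proof -
  from that form_nondegenerate obtain u where u: "form u v \<noteq> 0"
    by blast
  have "form (rsc u (qcnj (q * inverse (form u v)))) v = q"
    using u by (simp add: mult.assoc)
  then show ?thesis ..
qed

lemma ex_form_separate:
  assumes w: "w \<noteq> 0" and v: "\<And>q. v \<noteq> rsc w q"
  shows "\<exists>y. form y w = 0 \<and> form y v = 1"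
proof -
  obtain i where i: "w $ i \<noteq> 0"
    using w by (auto simp: vec_eq_iff)
  define c where "c = inverse (w $ i) * v $ i"
  from v obtain j where j: "v $ j \<noteq> w $ j * c"
    by (auto simp: vec_eq_iff)
  \<comment> \<open>Chosen so that \<open>form y\<close> takes u to
    \<open>u $ j - w $ j * inverse (w $ i) * u $ i\<close>, a functional that vanishes on the line
    of w; the signs and the conjugation cancel those in \<open>form_axis\<close>.\<close>
  define y where "y = s j *\<^sub>R axis j 1 - s i *\<^sub>R axis i (qcnj (w $ j * inverse (w $ i)))"
  have y: "form y u = u $ j - w $ j * inverse (w $ i) * u $ i" for u
    by (simp add: y_def form_diff form_scaleR form_axis)
  have 1: "form y w = 0"
    using i by (simp add: y mult.assoc)
  have 2: "form y v \<noteq> 0"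
    using j by (simp add: y c_def mult.assoc)
  have "form (rsc y (qcnj (inverse (form y v)))) w = 0 \<and> form (rsc y (qcnj (inverse (form y v)))) v = 1"
    using 1 2 by simp
  then show ?thesis ..
qed

text \<open>The rank-one operator u q v^* with the adjoint taken for \<open>form\<close>; the factor
  \<open>s j\<close> turns the conjugate transpose of v into that adjoint.\<close>

definition outer :: "quat ^ 'n \<Rightarrow> quat \<Rightarrow> quat ^ 'n \<Rightarrow> 'n qmat" where
  "outer u q v = (\<chi> i j. s j *\<^sub>R (u $ i * q * qcnj (v $ j)))"

lemma outer_mv [simp]: "outer u q v *v w = rsc u (q * form v w)"
  by (simp add: vec_eq_iff matrix_vector_mult_def outer_def form_def sum_distrib_left mult.assoc)

text \<open>The adjoint of \<open>outer u q v\<close> for \<open>form\<close> is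
  \<open>outer v (qcnj q) u\<close>, so this is an operator minus its adjoint.\<close>

definition skew_outer :: "quat ^ 'n \<Rightarrow> quat \<Rightarrow> quat ^ 'n \<Rightarrow> 'n qmat" where
  "skew_outer u q v = outer u q v - outer v (qcnj q) u"

lemma skew_outer_mv: "skew_outer u q v *v w = rsc u (q * form v w) - rsc v (qcnj q * form u w)"
  by (simp add: skew_outer_def mv_diff_left)

lemma skew_outer_in_skew: "skew_outer u q v \<in> skew"
  by (simp add: skew_def skew_outer_mv form_diff mult.assoc)

lemma outer_self_in_skew: "outer u q u \<in> skew" if "qre q = 0"
proof -
  have "qcnj q = - q"
    using that by (simp add: quat_eq_iff)
  then show ?thesis
    by (simp add: skew_def mult.assoc)
qed

text \<open>Since x is skew-adjoint, right multiplication of \<open>outer u q v\<close> by x amounts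
  to applying -x to v; hence ad x acts as a derivation on rank-one operators.\<close>

lemma skew_mult_outer: "commutator x (outer u q v) = outer (x *v u) q v + outer u q (x *v v)"
  if "x \<in> skew"
  by (rule matrix_eqI) (simp add: commutator_mv mv_simps skewD[OF that])

lemma retr_outer: "retr (outer u q v) = qre (q * form v u)"
proof -
  have "retr (outer u q v) = (\<Sum>i\<in>UNIV. qre (s i *\<^sub>R (u $ i * (q * qcnj (v $ i)))))"
    by (simp only: retr_def outer_def vec_lambda_beta mult.assoc)
  also have "\<dots> = (\<Sum>i\<in>UNIV. qre (s i *\<^sub>R ((q * qcnj (v $ i)) * u $ i)))"
    by (intro sum.cong refl) (simp only: quat_sel(21) qre_mult_commute[of "u $ _"])
  also have "\<dots> = qre (q * form v u)"
    by (simp add: form_def sum_distrib_left qre_sum mult.assoc del: quat_sel(25))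
  finally show ?thesis .
qed

end

definition sign_pq :: "nat \<Rightarrow> 'n::{finite,linorder} \<Rightarrow> real" where
  "sign_pq p i = (if card {k. k < i} < p then 1 else - 1)"

lemma quat_form_sign_pq: "quat_form (sign_pq p)"
  by standard (simp add: sign_pq_def)

lemma scaleR_3: "3 *\<^sub>R x = x + x + x" for x :: "'a::real_vector"
proof -
  have "3 *\<^sub>R x = (1 + 1 + 1) *\<^sub>R x"
    by simp
  then show ?thesis
    by (simp only: scaleR_left_distrib scaleR_one)
qed

lemma quat_scaleR_collect: "x + 3 *\<^sub>R x + 3 *\<^sub>R y + y = 4 *\<^sub>R (x + y)" for x y :: quat
  by (simp add: quat_eq_iff)

lemma commutator_simps:
  "commutator (x + y) z = commutator x z + commutator y z"
  "commutator x (y + z) = commutator x y + commutator x z"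
  "commutator (r *\<^sub>R x) y = r *\<^sub>R commutator x y"
  "commutator x (r *\<^sub>R y) = r *\<^sub>R commutator x y"
  "commutator 0 y = 0" "commutator x 0 = 0" "commutator x x = 0"
  "commutator (- x) y = - commutator x y" "commutator x (- y) = - commutator x y"
  "commutator (x - y) z = commutator x z - commutator y z"
  "commutator x (y - z) = commutator x y - commutator x z"
  by (rule matrix_eqI, simp add: commutator_mv mv_simps algebra_simps)+

context quat_form
begin

lemma skew_iff: "x \<in> skew \<longleftrightarrow> (\<forall>i j. s i *\<^sub>R x $ i $ j = - (s j *\<^sub>R qcnj (x $ j $ i)))"
proof
  assume x: "x \<in> skew"
  show "\<forall>i j. s i *\<^sub>R x $ i $ j = - (s j *\<^sub>R qcnj (x $ j $ i))"
  proof (intro allI)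
    fix i j
    have "form (x *v axis j 1) (axis i 1) = - form (axis j 1) (x *v axis i 1)"
      by (rule skewD[OF x])
    then have "qcnj (form (axis i 1) (x *v axis j 1)) = - form (axis j 1) (x *v axis i 1)"
      by simp
    then have "s i *\<^sub>R qcnj (x $ i $ j) = - (s j *\<^sub>R x $ j $ i)"
      by (simp add: form_axis mv_axis del: qcnj_form)
    then have "qcnj (s i *\<^sub>R qcnj (x $ i $ j)) = qcnj (- (s j *\<^sub>R x $ j $ i))"
      by (rule arg_cong)
    then show "s i *\<^sub>R x $ i $ j = - (s j *\<^sub>R qcnj (x $ j $ i))"
      by simp
  qed
next
  assume *: "\<forall>i j. s i *\<^sub>R x $ i $ j = - (s j *\<^sub>R qcnj (x $ j $ i))"
  show "x \<in> skew"
    unfolding skew_def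
  proof (intro CollectI allI)
    fix u v
    have "form (x *v u) v = (\<Sum>i\<in>UNIV. \<Sum>j\<in>UNIV. qcnj (u $ j) * (s i *\<^sub>R qcnj (x $ i $ j)) * v $ i)"
      by (simp add: form_def matrix_vector_mult_def qcnj_sum sum_distrib_right scaleR_sum_right)
    also have "\<dots> = (\<Sum>j\<in>UNIV. \<Sum>i\<in>UNIV. - (qcnj (u $ j) * (s j *\<^sub>R x $ j $ i) * v $ i))"
      by (subst sum.swap) (intro sum.cong refl, simp only: *[rule_format], simp)
    also have "\<dots> = - form u (x *v v)"
      by (simp add: form_def matrix_vector_mult_def sum_distrib_left scaleR_sum_right sum_negf mult.assoc)
    finally show "form (x *v u) v = - form u (x *v v)" .
  qed
qed

lemma subspace_skew: "subspace skew"
  by (rule subspaceI) (simp_all add: skew_def form_add form_scaleR mv_simps)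

lemma commutator_in_skew: "x \<in> skew \<Longrightarrow> y \<in> skew \<Longrightarrow> commutator x y \<in> skew"
  by (simp add: skew_def commutator_mv form_diff)

sublocale real_lie_algebra skew commutator
  by standard
    (simp_all add: subspace_skew commutator_in_skew commutator_simps,
      rule matrix_eqI, simp add: commutator_mv mv_simps)

section \<open>Abelian inner ideals and totally isotropic subspaces\<close>

text \<open>For imaginary q the expression is twice the imaginary part of f q. So f q is always
  real, which makes f a real multiple of both i and j.\<close>

lemma sylvester_eq_zero: "f = 0" if "\<And>q. qre q = 0 \<Longrightarrow> f * q + q * qcnj f = 0" for f :: quat
  using that[of "Quat 0 1 0 0"] that[of "Quat 0 0 1 0"] that[of "Quat 0 0 0 1"]
  by (simp add: quat_eq_iff)

text \<open>An imaginary q orthogonal to the imaginary part of c anticommutes with it and so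
  satisfies the equation. The case distinction only picks a nonzero one.\<close>

lemma quat_orthogonal_imaginary: "\<exists>q. qre q = 0 \<and> q \<noteq> 0 \<and> q * qcnj c = c * q" for c :: quat
proof (cases "qi c = 0 \<and> qj c = 0")
  case True
  then show ?thesis
    by (intro exI[of _ "Quat 0 1 0 0"]) (simp add: quat_eq_iff)
next
  case False
  then show ?thesis
    by (intro exI[of _ "Quat 0 (- qj c) (qi c) 0"]) (auto simp: quat_eq_iff algebra_simps)
qed

text \<open>
  Write \<open>w\<^sub>k = b^k w\<close>. Evaluating \<open>(ad b)^3\<close> on the rank-one elements \<open>w q w\<^sup>*\<close> gives the relation
  \<open>w\<^sub>3 q w\<^sup>* + 3 w\<^sub>2 q w\<^sub>1\<^sup>* + 3 w\<^sub>1 q w\<^sub>2\<^sup>* + w q w\<^sub>3\<^sup>* = 0\<close> for all imaginary \<open>q\<close>.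
\<close>

lemma ad_cube_zero_imp_square_zero:
  assumes b: "b \<in> skew"
    and ad: "\<And>x. x \<in> skew \<Longrightarrow> commutator b (commutator b (commutator b x)) = 0"
  shows "b *v (b *v w) = 0"
proof -
  define f where "f y k = form y (((*v) b ^^ k) w)" for y k
  \<comment> \<open>Pairing the cubic relation with y on both sides turns it into one between
    quaternions, in which suitable y isolate single terms.\<close>
  have K: "f y 3 * q * qcnj (f y 0) + 3 *\<^sub>R (f y 2 * q * qcnj (f y 1))
      + 3 *\<^sub>R (f y 1 * q * qcnj (f y 2)) + f y 0 * q * qcnj (f y 3) = 0"
    if q: "qre q = 0" for y q
  proof -
    have "form y (commutator b (commutator b (commutator b (outer w q w))) *v y) = 0"
      by (simp add: ad outer_self_in_skew q)
    then show ?thesis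
      by (simp add: skew_mult_outer[OF b] commutator_simps mv_add_left form_add f_def eval_nat_numeral
          mult.assoc algebra_simps scaleR_3)
  qed
  show ?thesis
  proof (cases "\<exists>c. b *v w = rsc w c")
    case True
    then obtain c where c: "b *v w = rsc w c" ..
    show ?thesis
    proof (cases "w = 0")
      case False
      then obtain y where y: "form y w = 1"
        using ex_form_eq by blast
      have f: "f y 0 = 1" "f y 1 = c" "f y 2 = c * c" "f y 3 = c * c * c"
        by (simp_all add: f_def eval_nat_numeral y c mv_rsc mult.assoc)
      obtain q where q: "qre q = 0" "q \<noteq> 0" "q * qcnj c = c * q"
        using quat_orthogonal_imaginary by blast
      have q': "x * (q * qcnj c) = x * (c * q)" for x
        by (simp only: q)
      have q3: "q * (qcnj c * z) = c * (q * z)" for z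
        using q(3) by (metis mult.assoc)
      have "c * c * c * q + 3 *\<^sub>R (c * c * c * q) + 3 *\<^sub>R (c * c * c * q) + c * c * c * q = 0"
        using K[OF q(1), of y] by (simp add: f mult.assoc q3 q(3) del: One_nat_def)
      then have "c = 0"
        using q(2) by (simp add: quat_scaleR_collect flip: scaleR_2)
      then show ?thesis
        by (simp add: c)
    qed simp
  next
    case False
    then have "w \<noteq> 0"
      by auto
    then obtain y0 where y0: "form y0 w = 0" "form y0 (b *v w) = 1"
      using ex_form_separate[of w "b *v w"] False by blast
    \<comment> \<open>With these values of \<open>f y 0\<close> and \<open>f y 1\<close> only the
      two middle terms of K survive.\<close>
    have f2: "form y (b *v (b *v w)) = 0" if "form y w = 0" "form y (b *v w) = 1" for y
    proof (rule sylvester_eq_zero)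
      fix q :: quat assume "qre q = 0"
      from K[OF this, of y] that
      have "3 *\<^sub>R (form y (b *v (b *v w)) * q + q * qcnj (form y (b *v (b *v w)))) = 0"
        by (simp add: f_def eval_nat_numeral algebra_simps del: qcnj_form)
      then show "form y (b *v (b *v w)) * q + q * qcnj (form y (b *v (b *v w))) = 0"
        by (simp del: qcnj_form)
    qed
    have f2': "form y (b *v (b *v w)) = 0" if y: "form y w = 0" for y
    proof -
      define y' where "y' = y - rsc y0 (qcnj (form y (b *v w))) + y0"
      have "form y' w = 0" "form y' (b *v w) = 1"
        using y y0 by (simp_all add: y'_def form_add form_diff del: qcnj_form)
      then have "form y' (b *v (b *v w)) = 0"
        by (rule f2)
      then show ?thesis
        using f2[OF y0] by (simp add: y'_def form_add form_diff)
    qed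
    obtain c where c: "b *v (b *v w) = rsc w c"
      using ex_form_separate[OF \<open>w \<noteq> 0\<close>, of "b *v (b *v w)"] f2' by force
    obtain y1 where y1: "form y1 w = 1"
      using ex_form_eq[OF \<open>w \<noteq> 0\<close>] by blast
    \<comment> \<open>Now both pairings equal 1. Together with \<open>c\<close> this gives
      \<open>f y 2 = f y 3 = c\<close>, and the relation becomes 4 times the Sylvester expression in
      c.\<close>
    define y where "y = y1 + rsc y0 (qcnj (1 - form y1 (b *v w)))"
    have y: "form y w = 1" "form y (b *v w) = 1"
      using y1 y0 by (simp_all add: y_def form_add del: qcnj_form)
    have "c = 0"
    proof (rule sylvester_eq_zero)
      fix q :: quat assume "qre q = 0"
      from K[OF this, of y]
      have "c * q + 3 *\<^sub>R (c * q) + 3 *\<^sub>R (q * qcnj c) + q * qcnj c = 0"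
        by (simp add: f_def eval_nat_numeral y c mv_rsc)
      then have "4 *\<^sub>R (c * q + q * qcnj c) = 0"
        by (simp only: quat_scaleR_collect)
      then show "c * q + q * qcnj c = 0"
        by simp
    qed
    then show ?thesis
      by (simp add: c)
  qed
qed

definition hsubspace :: "(quat ^ 'n) set \<Rightarrow> bool" where
  "hsubspace U \<longleftrightarrow> 0 \<in> U \<and> (\<forall>u\<in>U. \<forall>v\<in>U. u + v \<in> U) \<and> (\<forall>u\<in>U. \<forall>q. rsc u q \<in> U)"

definition isotropic :: "(quat ^ 'n) set \<Rightarrow> bool" where
  "isotropic U \<longleftrightarrow> (\<forall>u\<in>U. \<forall>v\<in>U. form u v = 0)"

definition ideal_of :: "(quat ^ 'n) set \<Rightarrow> 'n qmat set" where
  "ideal_of U = {x \<in> skew. \<forall>v. x *v v \<in> U}"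

text \<open>The candidate for the isotropic subspace of B. Only imaginary q occur because for
  nonzero u exactly these make \<open>outer u q u\<close> skew-adjoint.\<close>

definition core :: "'n qmat set \<Rightarrow> (quat ^ 'n) set" where
  "core B = {u. \<forall>q. qre q = 0 \<longrightarrow> outer u q u \<in> B}"

lemma hsubspace_minus: "hsubspace U \<Longrightarrow> u \<in> U \<Longrightarrow> - u \<in> U"
  unfolding hsubspace_def by (metis rsc_simps(3,6))

lemma hsubspace_diff: "hsubspace U \<Longrightarrow> u \<in> U \<Longrightarrow> v \<in> U \<Longrightarrow> u - v \<in> U"
  using hsubspace_minus[of U v] unfolding hsubspace_def by (metis diff_conv_add_uminus)

lemma hsubspace_scaleR: "hsubspace U \<Longrightarrow> u \<in> U \<Longrightarrow> r *\<^sub>R u \<in> U"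
  unfolding hsubspace_def by (metis rsc_of_real)

lemma hsubspace_sum: "hsubspace U \<Longrightarrow> (\<And>i. i \<in> S \<Longrightarrow> f i \<in> U) \<Longrightarrow> sum f S \<in> U"
  by (induction S rule: infinite_finite_induct) (simp_all add: hsubspace_def)

lemma subspace_ideal_of: "hsubspace U \<Longrightarrow> subspace (ideal_of U)"
  using subspace_skew
  by (auto simp: ideal_of_def subspace_def mv_simps hsubspace_scaleR) (auto simp: hsubspace_def)

text \<open>The product b c of two elements vanishes, since moving b across the form leaves two
  vectors of U. So [b, c] = 0, and of [b, [c, x]] only - b x c - c x b remains, whose image lies in
  U.\<close>

lemma ideal_of_inner_ideal:
  assumes U: "hsubspace U" "isotropic U"
  shows "inner_ideal (ideal_of U)" "abelian (ideal_of U)"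
proof -
  have prod: "b *v (c *v v) = 0" if "b \<in> ideal_of U" "c \<in> ideal_of U" for b c v
  proof (rule form_nondegenerate)
    fix y
    have "form y (b *v (c *v v)) = - form (b *v y) (c *v v)"
      using that by (simp add: ideal_of_def skewD)
    then show "form y (b *v (c *v v)) = 0"
      using that U by (simp add: ideal_of_def isotropic_def)
  qed
  show "abelian (ideal_of U)"
    unfolding abelian_def by (auto intro!: matrix_eqI simp: commutator_mv prod)
  show "inner_ideal (ideal_of U)"
    unfolding inner_ideal_def
  proof (intro conjI ballI)
    show "subspace (ideal_of U)"
      by (rule subspace_ideal_of) fact
    show "ideal_of U \<subseteq> skew"
      by (auto simp: ideal_of_def)
    fix b c x
    assume bc: "b \<in> ideal_of U" "c \<in> ideal_of U" and x: "x \<in> skew"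
    have "commutator b (commutator c x) *v v \<in> U" for v
    proof -
      have "commutator b (commutator c x) *v v
          = - (b *v (x *v (c *v v))) - c *v (x *v (b *v v))"
        by (simp add: commutator_mv mv_simps prod bc)
      then show ?thesis
        using bc U by (simp add: ideal_of_def hsubspace_diff hsubspace_minus)
    qed
    then show "commutator b (commutator c x) \<in> ideal_of U"
      using bc x by (simp add: ideal_of_def commutator_in_skew)
  qed
qed

context
  fixes B assumes inner: "inner_ideal B" and ab: "abelian B"
begin

lemma inner_ideal_subset: "b \<in> B \<Longrightarrow> b \<in> skew"
  using inner by (auto simp: inner_ideal_def)

lemma inner_ideal_subspace: "subspace B"
  using inner by (auto simp: inner_ideal_def)

text \<open>[b, [b, x]] lies in B and therefore commutes with b, so the cube of ad b vanishes on
  \<open>skew\<close>.\<close>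

lemma inner_ideal_square_zero: "b *v (b *v w) = 0" if "b \<in> B"
proof (rule ad_cube_zero_imp_square_zero)
  show "b \<in> skew"
    by (rule inner_ideal_subset) fact
  fix x assume "x \<in> skew"
  then show "commutator b (commutator b (commutator b x)) = 0"
    using inner ab that by (simp add: inner_ideal_def abelian_def)
qed

text \<open>Polarising the vanishing of squares gives b c + c b = 0, while commutativity gives b c =
  c b.\<close>

lemma inner_ideal_mult_zero: "b *v (c *v w) = 0" if bc: "b \<in> B" "c \<in> B"
proof -
  have "(b + c) *v ((b + c) *v w) = 0"
    using bc inner_ideal_subspace by (intro inner_ideal_square_zero) (simp add: subspace_add)
  then have 1: "b *v (c *v w) + c *v (b *v w) = 0"
    using inner_ideal_square_zero[OF bc(1)] inner_ideal_square_zero[OF bc(2)]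
    by (simp add: mv_simps add.commute)
  have "commutator b c = 0"
    using ab bc by (simp add: abelian_def)
  then have "commutator b c *v w = 0"
    by simp
  then have "b *v (c *v w) = c *v (b *v w)"
    by (simp add: commutator_mv)
  with 1 have "2 *\<^sub>R (b *v (c *v w)) = 0"
    by (simp add: scaleR_2)
  then show ?thesis
    by simp
qed

text \<open>In -[b, [c, x]] the terms containing b c or c b vanish, and the two sandwiched ones
  remain.\<close>

lemma inner_ideal_sandwich: "b ** x ** c + c ** x ** b \<in> B" if bc: "b \<in> B" "c \<in> B" and x: "x \<in> skew"
proof -
  have "b ** x ** c + c ** x ** b = - commutator b (commutator c x)"
    by (rule matrix_eqI) (simp add: commutator_mv mv_simps inner_ideal_mult_zero bc)
  moreover have "commutator b (commutator c x) \<in> B"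
    using inner bc x by (simp add: inner_ideal_def)
  ultimately show ?thesis
    using inner_ideal_subspace by (simp add: subspace_neg)
qed

lemma core_rsc: "rsc u t \<in> core B" if "u \<in> core B"
  unfolding core_def
proof (intro CollectI allI impI)
  fix q :: quat assume q: "qre q = 0"
  have "outer (rsc u t) q (rsc u t) = outer u (t * q * qcnj t) u"
    by (rule matrix_eqI) (simp add: mult.assoc)
  moreover have "qre (t * q * qcnj t) = 0"
    using q by (simp add: algebra_simps)
  ultimately show "outer (rsc u t) q (rsc u t) \<in> B"
    using that by (simp add: core_def del: quat_sel)
qed

text \<open>For independent u and w the mixed element arises by sandwiching a suitable x between
  \<open>outer u r u\<close> and \<open>outer w r w\<close>. If u is zero or w lies on the line of
  u, it is zero or a rank-one element of the core.\<close>

lemma skew_outer_in_inner_ideal: "skew_outer u q w \<in> B" if u: "u \<in> core B" and w: "w \<in> core B"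
proof -
  consider "u = 0" | t where "w = rsc u t" | "u \<noteq> 0" "\<And>t. w \<noteq> rsc u t"
    by blast
  then show ?thesis
  proof cases
    case 1
    then have "skew_outer u q w = 0"
      by (intro matrix_eqI) (simp add: skew_outer_mv)
    then show ?thesis
      using inner_ideal_subspace by (simp add: subspace_0)
  next
    case 2
    have "skew_outer u q w = outer u (q * qcnj t - t * qcnj q) u"
      by (rule matrix_eqI) (simp add: skew_outer_mv 2 algebra_simps rsc_diff)
    moreover have "qre (q * qcnj t - t * qcnj q) = 0"
      by simp
    ultimately show ?thesis
      using u by (simp add: core_def del: quat_sel)
  next
    case 3
    have "w \<noteq> 0"
      using 3(2)[of 0] by simp
    have ne: "u \<noteq> rsc w t" for t
    proof
      assume u: "u = rsc w t"
      then have "t \<noteq> 0"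
        using 3 by auto
      then have "w = rsc u (inverse t)"
        by (simp add: u)
      then show False
        using 3 by blast
    qed
    obtain a where a: "form a w = 0" "form a u = 1"
      using ex_form_separate[OF \<open>w \<noteq> 0\<close> ne] by blast
    obtain c where c: "form c w = 1"
      using ex_form_eq[OF \<open>w \<noteq> 0\<close>] by blast
    define r where "r = Quat 0 1 0 0"
    have r: "qre r = 0" "qcnj r = - r" "r * r = - 1"
      by (simp_all add: r_def quat_eq_iff)
    have rr: "r * (r * z) = - z" for z
      by (simp add: r flip: mult.assoc)
    \<comment> \<open>The sandwich multiplies \<open>form u (x *v w)\<close> by r on both sides; the
      value \<open>r * q * r\<close> compensates for this because r squares to -1.\<close>
    define x where "x = skew_outer a (r * q * r) c"
    have ua: "form u a = 1"
      using a(2) qcnj_form[of a u] by simp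
    have x: "x \<in> skew" "form u (x *v w) = r * q * r"
      using a c ua by (simp_all add: x_def skew_outer_in_skew skew_outer_mv)
    have "form (x *v w) u = qcnj (r * q * r)"
      by (simp flip: x(2))
    moreover have "form w (x *v u) = - form (x *v w) u"
      by (simp add: skewD[OF x(1)])
    ultimately have x3: "form w (x *v u) = - (r * qcnj q * r)"
      by (simp add: r mult.assoc)
    have "outer u r u ** x ** outer w r w + outer w r w ** x ** outer u r u = skew_outer u q w"
      by (rule matrix_eqI)
        (simp add: mv_simps x(2) x3 skew_outer_mv mult.assoc rr)
    moreover have "outer u r u \<in> B" "outer w r w \<in> B"
      using u w r by (auto simp: core_def)
    ultimately show ?thesis
      using inner_ideal_sandwich[OF _ _ x(1)] by metis
  qed
qed

text \<open>Closure under sums amounts to the mixed term of \<open>outer (u + w) q (u + w)\<close>,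
  which is \<open>skew_outer u q w\<close> because q is imaginary.\<close>

lemma hsubspace_core: "hsubspace (core B)"
  unfolding hsubspace_def
proof (intro conjI ballI allI core_rsc)
  have "outer 0 q 0 = 0" for q
    by (rule matrix_eqI) simp
  then show "0 \<in> core B"
    using inner_ideal_subspace by (simp add: core_def subspace_0)
next
  fix u w assume uw: "u \<in> core B" "w \<in> core B"
  show "u + w \<in> core B"
    unfolding core_def
  proof (intro CollectI allI impI)
    fix q :: quat assume q: "qre q = 0"
    then have "qcnj q = - q"
      by (simp add: quat_eq_iff)
    then have "outer (u + w) q (u + w) = outer u q u + outer w q w + skew_outer u q w"
      by (intro matrix_eqI) (simp add: mv_add_left skew_outer_mv form_add rsc_add algebra_simps)
    moreover have "outer u q u \<in> B" "outer w q w \<in> B"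
      using uw q by (auto simp: core_def)
    ultimately show "outer (u + w) q (u + w) \<in> B"
      using inner_ideal_subspace skew_outer_in_inner_ideal[OF uw, of q] by (simp add: subspace_add)
  qed
qed

text \<open>Products of elements of B vanish; for \<open>outer u r u\<close> and
  \<open>outer w r w\<close> the product contains \<open>form u w\<close> as a factor between
  invertible ones.\<close>

lemma isotropic_core: "isotropic (core B)"
  unfolding isotropic_def
proof (intro ballI)
  fix u w assume uw: "u \<in> core B" "w \<in> core B"
  define r where "r = Quat 0 1 0 0"
  have r: "qre r = 0" "r \<noteq> 0"
    by (simp_all add: r_def quat_eq_iff)
  then have B: "outer u r u \<in> B" "outer w r w \<in> B"
    using uw by (auto simp: core_def)
  show "form u w = 0"
  proof (cases "u = 0 \<or> w = 0")
    case False
    then obtain v where "form v w = 1"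
      using ex_form_eq by blast
    then have v: "form w v = 1"
      using qcnj_form[of v w] by simp
    have "outer u r u *v (outer w r w *v v) = 0"
      by (rule inner_ideal_mult_zero) fact+
    then show ?thesis
      using False v r by simp
  qed auto
qed

text \<open>Sandwiching \<open>outer z q z\<close> between two copies of b gives minus
  \<open>outer (b *v z) q (b *v z)\<close>, one sign coming from moving b across the form. The
  factor -1/2 undoes this sign and the doubling in \<open>inner_ideal_sandwich\<close>.\<close>

lemma inner_ideal_image: "b *v z \<in> core B" if b: "b \<in> B"
  unfolding core_def
proof (intro CollectI allI impI)
  fix q :: quat assume q: "qre q = 0"
  let ?x = "outer z q z"
  have "outer (b *v z) q (b *v z) = (- 1 / 2) *\<^sub>R (b ** ?x ** b + b ** ?x ** b)"
    by (rule matrix_eqI) (simp add: mv_simps skewD inner_ideal_subset[OF b] flip: scaleR_2)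
  moreover have "b ** ?x ** b + b ** ?x ** b \<in> B"
    by (intro inner_ideal_sandwich b outer_self_in_skew q)
  ultimately show "outer (b *v z) q (b *v z) \<in> B"
    using subspace_scale[OF inner_ideal_subspace] by metis
qed

lemma inner_ideal_subset_ideal_of: "B \<subseteq> ideal_of (core B)"
  using inner_ideal_image inner_ideal_subset by (auto simp: ideal_of_def)

end

text \<open>The dual system resolves the image of x; by skewness it can be applied again to the
  vectors \<open>x *v f' i\<close>, giving coefficients on both sides. Each pair is counted twice by
  \<open>skew_outer\<close>, hence the factor 1/2.\<close>

lemma ideal_of_expansion:
  assumes x: "x \<in> ideal_of U" and S: "\<And>v. v \<in> U \<Longrightarrow> v = (\<Sum>i\<in>S. rsc (f i) (form (f' i) v))"
  shows "x = (1 / 2) *\<^sub>R (\<Sum>i\<in>S. \<Sum>j\<in>S. skew_outer (f i) (form (f' i) (x *v f' j)) (f j))"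
proof (rule matrix_eqI)
  fix w
  have xs: "x \<in> skew" and im: "x *v v \<in> U" for v
    using x by (auto simp: ideal_of_def)
  define a where "a i j = form (f' i) (x *v f' j)" for i j
  have a: "qcnj (a i j) = - a j i" for i j
    by (simp add: a_def skewD[OF xs])
  have "x *v w = (\<Sum>i\<in>S. rsc (f i) (form (f' i) (x *v w)))"
    by (rule S[OF im])
  also have "\<dots> = (\<Sum>i\<in>S. rsc (f i) (- form (x *v f' i) w))"
    by (simp add: skewD[OF xs])
  also have "\<dots> = (\<Sum>i\<in>S. rsc (f i) (- form (\<Sum>j\<in>S. rsc (f j) (a j i)) w))"
    by (simp only: a_def flip: S[OF im])
  also have "\<dots> = (\<Sum>i\<in>S. \<Sum>j\<in>S. rsc (f i) (a i j * form (f j) w))"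
    by (simp add: form_sum a rsc_sum sum_negf)
  finally have 1: "x *v w = (\<Sum>i\<in>S. \<Sum>j\<in>S. rsc (f i) (a i j * form (f j) w))" .
  have "(\<Sum>i\<in>S. \<Sum>j\<in>S. skew_outer (f i) (a i j) (f j)) *v w
      = (\<Sum>i\<in>S. \<Sum>j\<in>S. rsc (f i) (a i j * form (f j) w)) + (\<Sum>i\<in>S. \<Sum>j\<in>S. rsc (f j) (a j i * form (f i) w))"
    by (simp add: mv_sum_left skew_outer_mv a sum.distrib)
  also have "(\<Sum>i\<in>S. \<Sum>j\<in>S. rsc (f j) (a j i * form (f i) w)) = x *v w"
    unfolding 1 by (rule sum.swap)
  also have "(\<Sum>i\<in>S. \<Sum>j\<in>S. rsc (f i) (a i j * form (f j) w)) = x *v w"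
    by (rule 1[symmetric])
  finally show "x *v w = ((1 / 2) *\<^sub>R (\<Sum>i\<in>S. \<Sum>j\<in>S. skew_outer (f i) (form (f' i) (x *v f' j)) (f j))) *v w"
    by (simp add: mv_scaleR_left a_def flip: scaleR_2)
qed

end

lemma sp_eq_skew: "sp p = quat_form.skew (sign_pq p)"
proof -
  interpret quat_form "sign_pq p"
    by (rule quat_form_sign_pq)
  have I: "I_pq p = (\<chi> i j. if i = j then of_real (sign_pq p i) else 0)"
    by (simp add: I_pq_def sign_pq_def vec_eq_iff)
  have 1: "(I_pq p ** x) $ i $ j = sign_pq p i *\<^sub>R x $ i $ j"
    and 2: "(conj_transpose x ** I_pq p) $ i $ j = sign_pq p j *\<^sub>R qcnj (x $ j $ i)" for x i j
    by (simp_all add: I matrix_matrix_mult_def conj_transpose_def if_distrib[of "\<lambda>t. t * _"]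
        if_distrib[of "\<lambda>t. _ * t"] of_real_def cong: if_cong)
  show ?thesis
    by (auto simp: sp_def skew_iff vec_eq_iff 1 2 eq_neg_iff_add_eq_0)
qed

text \<open>Indexed families may repeat vectors; the independence assumed here excludes this, so the
  bound for independent sets applies to the image.\<close>

lemma family_card_le:
  fixes h :: "'k \<Rightarrow> 'a::euclidean_space"
  assumes K: "finite K" and indep: "\<And>c k. (\<Sum>k\<in>K. c k *\<^sub>R h k) = 0 \<Longrightarrow> k \<in> K \<Longrightarrow> c k = 0"
  shows "card K \<le> DIM('a)"
proof -
  have inj: "inj_on h K"
  proof (rule inj_onI, rule ccontr)
    fix k k' assume kk: "k \<in> K" "k' \<in> K" "h k = h k'" "k \<noteq> k'"
    define c :: "'k \<Rightarrow> real" where "c x = (if x = k then 1 else 0) - (if x = k' then 1 else 0)" for x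
    have "(\<Sum>x\<in>K. c x *\<^sub>R h x) = 0"
      using kk K by (simp add: c_def scaleR_left_diff_distrib sum_subtractf if_distrib[of "\<lambda>t. t *\<^sub>R _"] cong: if_cong)
    then have "c k = 0"
      using kk by (intro indep)
    then show False
      using kk by (simp add: c_def)
  qed
  have "independent (h ` K)"
  proof (rule independent_if_scalars_zero)
    fix c y assume "(\<Sum>x\<in>h ` K. c x *\<^sub>R x) = 0" "y \<in> h ` K"
    then show "c y = 0"
      using indep[of "c \<circ> h"] by (auto simp: sum.reindex[OF inj])
  qed (use K in simp)
  then have "card (h ` K) \<le> DIM('a)"
    using independent_bound by blast
  then show ?thesis
    by (simp add: card_image[OF inj])
qed

section \<open>Joint eigenvectors of commuting families\<close>

definition csubspace :: "(quat ^ 'n) set \<Rightarrow> bool" where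
  "csubspace W \<longleftrightarrow> 0 \<in> W \<and> (\<forall>u\<in>W. \<forall>v\<in>W. u + v \<in> W) \<and> (\<forall>u\<in>W. \<forall>z. rsc u (cq z) \<in> W)"

lemma csubspace_subspace: "csubspace W \<Longrightarrow> subspace W"
  unfolding csubspace_def subspace_def by (metis cq_simps(8) rsc_of_real)

lemma csubspace_diff: "csubspace W \<Longrightarrow> u \<in> W \<Longrightarrow> v \<in> W \<Longrightarrow> u - v \<in> W"
  using subspace_diff csubspace_subspace by blast

definition poly_act :: "'n::finite qmat \<Rightarrow> complex poly \<Rightarrow> quat ^ 'n \<Rightarrow> quat ^ 'n" where
  "poly_act x P w = (\<Sum>i\<le>degree P. rsc (((*v) x ^^ i) w) (cq (coeff P i)))"

lemma funpow_mv: "((*v) x ^^ i) (v + w) = ((*v) x ^^ i) v + ((*v) x ^^ i) w"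
  "((*v) x ^^ i) (rsc v q) = rsc (((*v) x ^^ i) v) q" for x :: "quat ^ 'n ^ 'n"
  by (induction i) (simp_all add: mv_simps)

lemma poly_act_altdef:
  assumes "degree P \<le> N"
  shows "poly_act x P w = (\<Sum>i\<le>N. rsc (((*v) x ^^ i) w) (cq (coeff P i)))"
  unfolding poly_act_def using assms
  by (intro sum.mono_neutral_left) (auto simp: coeff_eq_0)

text \<open>Complex coefficients act on the right and so commute with x; hence products of
  polynomials act by composition.\<close>

lemma poly_act_linear_factor:
  "poly_act x ([:- z, 1:] * Q) w = poly_act x Q (x *v w - rsc w (cq z))"
proof -
  define N where "N = Suc (degree Q)"
  have d: "degree ([:- z, 1:] * Q) \<le> N" "degree Q \<le> N"
    using degree_mult_le[of "[:- z, 1:]" Q] by (simp_all add: N_def)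
  have PQ: "[:- z, 1:] * Q = pCons 0 Q + smult (- z) Q"
    by simp
  have "(\<Sum>i\<le>N. rsc (((*v) x ^^ i) w) (cq (coeff (pCons 0 Q) i)))
      = (\<Sum>i\<le>degree Q. rsc (((*v) x ^^ i) (x *v w)) (cq (coeff Q i)))"
    unfolding N_def by (subst sum.atMost_Suc_shift) (simp add: funpow_swap1)
  then have shift: "(\<Sum>i\<le>N. rsc (((*v) x ^^ i) w) (cq (coeff (pCons 0 Q) i))) = poly_act x Q (x *v w)"
    by (simp add: poly_act_def)
  have "x *v w - rsc w (cq z) = x *v w + rsc w (cq (- z))"
    by simp
  then have "poly_act x Q (x *v w - rsc w (cq z))
      = poly_act x Q (x *v w) + poly_act x Q (rsc w (cq (- z)))"
    by (simp only: poly_act_def funpow_mv rsc_add sum.distrib)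
  also have "\<dots> = (\<Sum>i\<le>N. rsc (((*v) x ^^ i) w) (cq (coeff (pCons 0 Q) i)))
      + (\<Sum>i\<le>N. rsc (((*v) x ^^ i) w) (cq (coeff (smult (- z) Q) i)))"
    by (simp only: shift poly_act_altdef[OF d(2), of x "rsc w (cq (- z))"] funpow_mv rsc_simps(4)
        coeff_smult cq_simps(6))
  also have "\<dots> = poly_act x ([:- z, 1:] * Q) w"
    by (simp only: poly_act_altdef[OF d(1)[unfolded PQ]] PQ coeff_add cq_simps(3) rsc_add sum.distrib)
  finally show ?thesis ..
qed

text \<open>The iterates of w are real-linearly dependent by dimension, so some polynomial
  annihilates w. Splitting off a root z either exhibits w as an eigenvector or replaces w by the
  nonzero vector \<open>x *v w - rsc w (cq z)\<close> and lowers the degree.\<close>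

lemma eigenvector_exists:
  fixes x :: "'n::finite qmat"
  assumes W: "csubspace W" "\<And>w. w \<in> W \<Longrightarrow> x *v w \<in> W" and w: "w \<in> W" "w \<noteq> 0"
  shows "\<exists>v\<in>W. v \<noteq> 0 \<and> (\<exists>z. x *v v = rsc v (cq z))"
proof -
  have main: "\<exists>v\<in>W. v \<noteq> 0 \<and> (\<exists>z. x *v v = rsc v (cq z))"
    if "P \<noteq> 0" "w \<in> W" "w \<noteq> 0" "poly_act x P w = 0" for P w
    using that
  proof (induction "degree P" arbitrary: P w rule: less_induct)
    case less
    show ?case
    proof (cases "degree P = 0")
      case True
      then obtain c where "P = [:c:]"
        by (rule degree_eq_zeroE)
      then show ?thesis
        using less by (simp add: poly_act_def)
    next
      case False
      then have "\<not> constant (poly P)"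
        by (simp add: constant_degree)
      then obtain z where "poly P z = 0"
        using fundamental_theorem_of_algebra by blast
      then obtain Q where P: "P = [:- z, 1:] * Q"
        by (auto simp: poly_eq_0_iff_dvd elim: dvdE)
      with less.prems have Q: "Q \<noteq> 0"
        by auto
      have "degree P = degree Q + 1"
        unfolding P using Q by (subst degree_mult_eq) auto
      then have deg: "degree Q < degree P"
        by simp
      show ?thesis
      proof (cases "x *v w = rsc w (cq z)")
        case True
        with less.prems show ?thesis
          by blast
      next
        case False
        show ?thesis
        proof (rule less.hyps[OF deg Q])
          show "x *v w - rsc w (cq z) \<in> W"
            using W less.prems by (intro csubspace_diff) (auto simp: csubspace_def)
          show "x *v w - rsc w (cq z) \<noteq> 0"
            using False by simp
          show "poly_act x Q (x *v w - rsc w (cq z)) = 0"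
            using less.prems(4) unfolding P by (simp only: poly_act_linear_factor)
        qed
      qed
    qed
  qed
  define N where "N = DIM(quat ^ 'n)"
  have "\<not> card {..N} \<le> DIM(quat ^ 'n)"
    by (simp add: N_def)
  then obtain c k where c: "(\<Sum>i\<le>N. c i *\<^sub>R ((*v) x ^^ i) w) = 0" "k \<le> N" "c k \<noteq> 0"
    using family_card_le[of "{..N}" "\<lambda>i. ((*v) x ^^ i) w"] by (metis atMost_iff finite_atMost)
  define P where "P = (\<Sum>i\<le>N. monom (of_real (c i) :: complex) i)"
  have coeff: "coeff P i = (if i \<le> N then of_real (c i) else 0)" for i
    by (simp add: P_def coeff_sum if_distrib cong: if_cong)
  have "degree P \<le> N"
    by (rule degree_le) (simp add: coeff)
  then have "poly_act x P w = (\<Sum>i\<le>N. rsc (((*v) x ^^ i) w) (cq (coeff P i)))"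
    by (rule poly_act_altdef)
  also have "\<dots> = 0"
    using c(1) by (simp add: coeff rsc_of_real)
  finally have "poly_act x P w = 0" .
  moreover have "P \<noteq> 0"
    using c(2,3) coeff[of k] by auto
  ultimately show ?thesis
    using main w by blast
qed

definition joint_eigenvector :: "'n::finite qmat set \<Rightarrow> quat ^ 'n \<Rightarrow> bool" where
  "joint_eigenvector C v \<longleftrightarrow> (\<forall>x\<in>C. \<exists>z. x *v v = rsc v (cq z))"

text \<open>In a nonzero invariant complex subspace of least dimension every eigenspace of every x
  is again invariant, by commutativity, and so is everything. This also covers infinite
  families.\<close>

lemma joint_eigenvector_exists:
  fixes C :: "'n::finite qmat set"
  assumes W: "csubspace W" "\<And>x w. x \<in> C \<Longrightarrow> w \<in> W \<Longrightarrow> x *v w \<in> W" "W \<noteq> {0}"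
    and comm: "\<And>x y. x \<in> C \<Longrightarrow> y \<in> C \<Longrightarrow> commutator x y = 0"
  shows "\<exists>v\<in>W. v \<noteq> 0 \<and> joint_eigenvector C v"
proof -
  define Inv where "Inv V \<longleftrightarrow> csubspace V \<and> V \<noteq> {0} \<and> V \<subseteq> W \<and> (\<forall>x\<in>C. \<forall>w\<in>V. x *v w \<in> V)" for V
  have "Inv W"
    using W by (auto simp: Inv_def)
  then obtain V where V: "Inv V" and min: "\<And>V'. Inv V' \<Longrightarrow> dim V \<le> dim V'"
    using ex_has_least_nat[of Inv W dim] by blast
  have eig: "\<exists>z. \<forall>v\<in>V. x *v v = rsc v (cq z)" if x: "x \<in> C" for x
  proof -
    obtain w where w: "w \<in> V" "w \<noteq> 0"
      using V by (auto simp: Inv_def csubspace_def)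
    have "\<exists>v\<in>V. v \<noteq> 0 \<and> (\<exists>z. x *v v = rsc v (cq z))"
      using V x w by (intro eigenvector_exists[where W = V and w = w]) (auto simp: Inv_def)
    then obtain v z where v: "v \<in> V" "v \<noteq> 0" "x *v v = rsc v (cq z)"
      by blast
    define E where "E = {v \<in> V. x *v v = rsc v (cq z)}"
    have swap: "cq y * cq z = cq z * cq y" for y
      by (metis cq_simps(6) mult.commute)
    have "csubspace E"
      using V swap by (auto simp: csubspace_def E_def Inv_def mv_simps rsc_add)
    moreover have "y *v w \<in> E" if "y \<in> C" "w \<in> E" for y w
    proof -
      have "commutator x y *v w = 0"
        by (simp add: comm x that)
      then have "x *v (y *v w) = y *v (x *v w)"
        by (simp add: commutator_mv)
      then show ?thesis
        using V that by (auto simp: E_def Inv_def mv_rsc)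
    qed
    ultimately have "Inv E"
      using V v by (auto simp: Inv_def E_def)
    then have "E = V"
      using min[of E] V by (intro subspace_dim_equal csubspace_subspace) (auto simp: Inv_def E_def)
    then show ?thesis
      by (auto simp: E_def)
  qed
  obtain w where w: "w \<in> V" "w \<noteq> 0"
    using V by (auto simp: Inv_def csubspace_def)
  then have "w \<in> W" "joint_eigenvector C w"
    using V eig unfolding joint_eigenvector_def Inv_def by blast+
  with w show ?thesis
    by blast
qed

section \<open>Witt systems\<close>

definition tau :: "nat \<Rightarrow> nat \<Rightarrow> nat" where
  "tau m k = (if k < 2 * m then if even k then k + 1 else k - 1 else k)"

lemma tau_less_iff [simp]: "tau m k < 2 * m \<longleftrightarrow> k < 2 * m"
  by (auto simp: tau_def elim!: evenE oddE)

lemma tau_tau [simp]: "tau m (tau m k) = k"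
  by (cases "k < 2 * m") (auto simp: tau_def elim!: oddE)

lemma tau_eq_iff [simp]: "tau m k = tau m l \<longleftrightarrow> k = l"
  by (metis tau_tau)

lemma tau_less_bound: "2 * m \<le> N \<Longrightarrow> tau m k < N \<longleftrightarrow> k < N"
  using tau_less_iff[of m k] by (cases "k < 2 * m") (auto simp: tau_def)

lemma tau_neq: "k < 2 * m \<Longrightarrow> tau m k \<noteq> k"
  by (auto simp: tau_def elim: oddE)

lemma tau_outside: "\<not> k < 2 * m \<Longrightarrow> tau m k = k"
  by (simp add: tau_def)

context quat_form
begin

text \<open>A vector in both spans has a nonnegative and a nonpositive value of the form, so it is
  zero. The two families together are thus linearly independent.\<close>

lemma inertia_le:
  assumes "finite A" "finite B"
    and f: "\<And>i j. i \<in> A \<Longrightarrow> j \<in> A \<Longrightarrow> form (f i) (f j) = (if i = j then 1 else 0)"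
    and g: "\<And>i j. i \<in> B \<Longrightarrow> j \<in> B \<Longrightarrow> form (g i) (g j) = (if i = j then - 1 else 0)"
  shows "card A + card B \<le> CARD('n)"
proof -
  \<comment> \<open>Each vector is multiplied by the four quaternion units, so that real dimensions
    can be compared; the factor 4 cancels at the end.\<close>
  define h where "h = (\<lambda>(k, b). rsc (case_sum f g k) b)"
  have "card ((A <+> B) \<times> (Basis :: quat set)) \<le> DIM(quat ^ 'n)"
  proof (rule family_card_le)
    show "finite ((A <+> B) \<times> (Basis :: quat set))"
      using assms by simp
    fix c kb assume 0: "(\<Sum>k\<in>(A <+> B) \<times> Basis. c k *\<^sub>R h k) = 0" and kb: "kb \<in> (A <+> B) \<times> (Basis :: quat set)"
    define X where "X k = (\<Sum>b\<in>Basis. c (k, b) *\<^sub>R b)" for k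
    have "(\<Sum>k\<in>(A <+> B) \<times> Basis. c k *\<^sub>R h k) = (\<Sum>k\<in>A <+> B. \<Sum>b\<in>Basis. c (k, b) *\<^sub>R rsc (case_sum f g k) b)"
      by (simp add: sum.cartesian_product h_def case_prod_unfold)
    also have "\<dots> = (\<Sum>k\<in>A <+> B. rsc (case_sum f g k) (X k))"
      by (simp add: X_def rsc_sum rsc_scaleR)
    also have "\<dots> = (\<Sum>i\<in>A. rsc (f i) (X (Inl i))) + (\<Sum>j\<in>B. rsc (g j) (X (Inr j)))"
      using assms by (simp add: sum.Plus)
    finally have fg: "(\<Sum>i\<in>A. rsc (f i) (X (Inl i))) = - (\<Sum>j\<in>B. rsc (g j) (X (Inr j)))"
      using 0 by (simp add: eq_neg_iff_add_eq_0)
    let ?F = "\<Sum>i\<in>A. rsc (f i) (X (Inl i))" and ?G = "\<Sum>j\<in>B. rsc (g j) (X (Inr j))"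
    have "form ?F ?F = (\<Sum>j\<in>A. \<Sum>i\<in>A. qcnj (X (Inl i)) * form (f i) (f j) * X (Inl j))"
      by (simp only: form_sum form_rsc sum_distrib_right)
    also have "\<dots> = (\<Sum>i\<in>A. of_real ((norm (X (Inl i)))\<^sup>2))"
      using assms by (simp add: f if_distrib[of "\<lambda>t. t * _"] if_distrib[of "\<lambda>t. _ * t"] qcnj_mult_self cong: if_cong)
    finally have 1: "qre (form ?F ?F) = (\<Sum>i\<in>A. (norm (X (Inl i)))\<^sup>2)"
      by (simp add: qre_sum of_real_def)
    have "form ?G ?G = (\<Sum>j\<in>B. \<Sum>i\<in>B. qcnj (X (Inr i)) * form (g i) (g j) * X (Inr j))"
      by (simp only: form_sum form_rsc sum_distrib_right)
    also have "\<dots> = (\<Sum>i\<in>B. - of_real ((norm (X (Inr i)))\<^sup>2))"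
      using assms by (simp add: g if_distrib[of "\<lambda>t. t * _"] if_distrib[of "\<lambda>t. _ * t"] qcnj_mult_self cong: if_cong)
    finally have 2: "qre (form ?G ?G) = - (\<Sum>i\<in>B. (norm (X (Inr i)))\<^sup>2)"
      by (simp add: qre_sum of_real_def sum_negf)
    have "qre (form ?F ?F) = qre (form ?G ?G)"
      by (simp add: fg)
    then have "(\<Sum>i\<in>A. (norm (X (Inl i)))\<^sup>2) + (\<Sum>i\<in>B. (norm (X (Inr i)))\<^sup>2) = 0"
      by (simp add: 1 2)
    then have "(\<Sum>i\<in>A. (norm (X (Inl i)))\<^sup>2) = 0" "(\<Sum>i\<in>B. (norm (X (Inr i)))\<^sup>2) = 0"
      by (smt (verit) sum_nonneg zero_le_power2)+
    then have "\<And>i. i \<in> A \<Longrightarrow> X (Inl i) = 0" "\<And>i. i \<in> B \<Longrightarrow> X (Inr i) = 0"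
      using assms by (simp_all add: sum_nonneg_eq_0_iff)
    then have "X (fst kb) = 0"
      using kb by auto
    then have "inner (X (fst kb)) (snd kb) = 0"
      by simp
    then show "c kb = 0"
      using kb by (auto simp: X_def inner_sum_left inner_Basis if_distrib[of "\<lambda>t. _ * t"] cong: if_cong)
  qed
  then show ?thesis
    using assms by (simp add: card_cartesian_product card_Plus DIM_quat)
qed

text \<open>
  A Witt system of \<open>m\<close> hyperbolic pairs \<open>(e (2 i), e (2 i + 1))\<close>, \<open>i < m\<close>, followed by \<open>N - 2 m\<close>
  mutually orthogonal anisotropic vectors; \<open>tau m\<close> sends an index to the one it is paired with.
\<close>

definition wsys :: "nat \<Rightarrow> nat \<Rightarrow> (nat \<Rightarrow> real) \<Rightarrow> (nat \<Rightarrow> quat ^ 'n) \<Rightarrow> bool" where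
  "wsys m N \<sigma> e \<longleftrightarrow> 2 * m \<le> N \<and> (\<forall>k<2 * m. \<sigma> k = 1) \<and> (\<forall>k. \<sigma> k = 1 \<or> \<sigma> k = - 1) \<and>
     (\<forall>k<N. \<forall>l<N. form (e k) (e l) = (if l = tau m k then of_real (\<sigma> k) else 0))"

definition wcompl :: "nat \<Rightarrow> (nat \<Rightarrow> quat ^ 'n) \<Rightarrow> (quat ^ 'n) set" where
  "wcompl N e = {w. \<forall>k<N. form (e k) w = 0}"

text \<open>The projection onto the span of the system along \<open>wcompl\<close>: the vector dual
  to \<open>e k\<close> is \<open>\<sigma> k\<close> times \<open>e (tau m k)\<close>.\<close>

definition wproj :: "nat \<Rightarrow> nat \<Rightarrow> (nat \<Rightarrow> real) \<Rightarrow> (nat \<Rightarrow> quat ^ 'n) \<Rightarrow> quat ^ 'n \<Rightarrow> quat ^ 'n" where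
  "wproj m N \<sigma> e v = (\<Sum>k<N. rsc (e k) (\<sigma> k *\<^sub>R form (e (tau m k)) v))"

lemma wsysD:
  assumes "wsys m N \<sigma> e"
  shows "2 * m \<le> N" "k < 2 * m \<Longrightarrow> \<sigma> k = 1" "\<sigma> k = 1 \<or> \<sigma> k = - 1"
    "k < N \<Longrightarrow> l < N \<Longrightarrow> form (e k) (e l) = (if l = tau m k then of_real (\<sigma> k) else 0)"
    "\<sigma> (tau m k) = \<sigma> k" "\<sigma> k * \<sigma> k = 1" "tau m k < N \<longleftrightarrow> k < N"
proof -
  note * = assms[unfolded wsys_def]
  show "2 * m \<le> N" "k < 2 * m \<Longrightarrow> \<sigma> k = 1" "\<sigma> k = 1 \<or> \<sigma> k = - 1"
    "k < N \<Longrightarrow> l < N \<Longrightarrow> form (e k) (e l) = (if l = tau m k then of_real (\<sigma> k) else 0)"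
    using * by blast+
  then show "\<sigma> k * \<sigma> k = 1" "tau m k < N \<longleftrightarrow> k < N"
    by (auto simp: tau_less_bound)
  show "\<sigma> (tau m k) = \<sigma> k"
    using * by (cases "k < 2 * m") (auto simp: tau_outside)
qed

lemma form_wproj:
  assumes w: "wsys m N \<sigma> e" and l: "l < N"
  shows "form (e l) (wproj m N \<sigma> e v) = form (e l) v"
proof -
  have "form (e l) (wproj m N \<sigma> e v)
      = (\<Sum>k<N. if k = tau m l then of_real (\<sigma> l) * (\<sigma> k *\<^sub>R form (e (tau m k)) v) else 0)"
    unfolding wproj_def form_sum
    by (intro sum.cong refl) (auto simp: wsysD(4)[OF w l])
  also have "\<dots> = form (e l) v"
    using l wsysD(5-7)[OF w, of l] by (simp add: of_real_def)
  finally show ?thesis .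
qed

lemma diff_wproj_in_wcompl: "wsys m N \<sigma> e \<Longrightarrow> v - wproj m N \<sigma> e v \<in> wcompl N e"
  by (simp add: wcompl_def form_diff form_wproj)

lemma wproj_orthogonal: "wsys m N \<sigma> e \<Longrightarrow> u \<in> wcompl N e \<Longrightarrow> form u (wproj m N \<sigma> e v) = 0"
  by (auto simp: wproj_def form_sum wcompl_def intro!: sum.neutral) (metis form_eq_0_commute)

lemma hsubspace_wcompl: "hsubspace (wcompl N e)"
  by (simp add: hsubspace_def wcompl_def form_add)

lemma hsubspace_imp_csubspace: "hsubspace W \<Longrightarrow> csubspace W"
  by (simp add: hsubspace_def csubspace_def)

lemma wcompl_invariant:
  assumes "C \<subseteq> skew" "\<And>k. k < N \<Longrightarrow> joint_eigenvector C (e k)" "x \<in> C" "w \<in> wcompl N e"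
  shows "x *v w \<in> wcompl N e"
  unfolding wcompl_def
proof (intro CollectI allI impI)
  fix k assume k: "k < N"
  then obtain z where z: "x *v e k = rsc (e k) (cq z)"
    using assms unfolding joint_eigenvector_def by blast
  have "form (e k) (x *v w) = - form (x *v e k) w"
    using assms by (simp add: skewD subset_iff)
  then show "form (e k) (x *v w) = 0"
    using assms k by (simp add: z wcompl_def)
qed

text \<open>A hyperbolic pair contains one positive and one negative unit vector, the normalised sum
  and difference. These and the leftover vectors of one sign are compared with the standard vectors
  of the other sign.\<close>

lemma wsys_positive_negative:
  assumes w: "wsys m N \<sigma> e" 
  shows "m + card {k. 2 * m \<le> k \<and> k < N \<and> \<sigma> k = 1} + card {i. s i = - 1} \<le> CARD('n)"
    and "m + card {k. 2 * m \<le> k \<and> k < N \<and> \<sigma> k = - 1} + card {i. s i = 1} \<le> CARD('n)"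
proof -
  define P where "P t = {2 * i | i. i < m} \<union> {k. 2 * m \<le> k \<and> k < N \<and> \<sigma> k = t}" for t
  have fin: "finite (P t)" for t
    by (simp add: P_def)
  have "{2 * i | i. i < m} = (*) 2 ` {..<m}"
    by auto
  then have "card {2 * i | i. i < m} = m"
    by (simp add: card_image inj_on_def)
  moreover have "card (P t) = card {2 * i | i. i < m} + card {k. 2 * m \<le> k \<and> k < N \<and> \<sigma> k = t}" for t
    unfolding P_def by (rule card_Un_disjoint) auto
  ultimately have card: "card (P t) = m + card {k. 2 * m \<le> k \<and> k < N \<and> \<sigma> k = t}" for t
    by simp
  define f where "f t k = (if k < 2 * m then (1 / sqrt 2) *\<^sub>R (e k + t *\<^sub>R e (Suc k)) else e k)" for t :: real and k
  have form_f: "form (f t k) (f t l) = (if k = l then of_real t else 0)"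
    if kl: "k \<in> P t" "l \<in> P t" and t: "t = 1 \<or> t = - 1" for k l t
  proof -
    have [simp]: "tau m (2 * i) = Suc (2 * i)" "tau m (Suc (2 * i)) = 2 * i" if "i < m" for i
      using that by (simp_all add: tau_def)
    have N: "2 * m \<le> N"
      by (rule wsysD(1)[OF w])
    have "Suc (2 * i) < 2 * m" if "i < m" for i
      using that by simp
    then have N': "Suc (2 * i) < N" "2 * i < N" if "i < m" for i
      using that N by (meson less_le_trans Suc_lessD)+
    have half: "(1 / sqrt 2) * (1 / sqrt 2) = 1 / 2"
      by simp
    consider i j where "k = 2 * i" "l = 2 * j" "i < m" "j < m"
      | i where "k = 2 * i" "i < m" "2 * m \<le> l" "l < N"
      | j where "l = 2 * j" "j < m" "2 * m \<le> k" "k < N"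
      | "2 * m \<le> k" "2 * m \<le> l" "k < N" "l < N" "\<sigma> k = t"
      using kl by (auto simp: P_def)
    then show ?thesis
    proof cases
      case 1
      then show ?thesis
        using t N' by (auto simp: f_def form_scaleR form_add wsysD(4)[OF w] wsysD(2)[OF w] quat_eq_iff of_real_def)
    next
      case 2
      then show ?thesis
        using N' by (simp add: f_def form_scaleR form_add wsysD(4)[OF w])
    next
      case 3
      then show ?thesis
        using N' by (simp add: f_def form_scaleR form_add wsysD(4)[OF w] tau_outside)
    next
      case 4
      then show ?thesis
        by (simp add: f_def wsysD(4)[OF w] tau_outside eq_commute)
    qed
  qed
  have ax: "form (axis i 1) (axis j 1) = (if i = j then of_real (s i) else 0)" for i j
    by (simp add: form_axis) (simp add: axis_def of_real_def)
  have "card (P 1) + card {i. s i = - 1} \<le> CARD('n)"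
    by (rule inertia_le[where f = "f 1" and g = "\<lambda>i. axis i 1"]) (use fin form_f ax in auto)
  then show "m + card {k. 2 * m \<le> k \<and> k < N \<and> \<sigma> k = 1} + card {i. s i = - 1} \<le> CARD('n)"
    by (simp add: card)
  have "card {i. s i = 1} + card (P (- 1)) \<le> CARD('n)"
    by (rule inertia_le[where f = "\<lambda>i. axis i 1" and g = "f (- 1)"]) (use fin form_f ax in auto)
  then show "m + card {k. 2 * m \<le> k \<and> k < N \<and> \<sigma> k = - 1} + card {i. s i = 1} \<le> CARD('n)"
    by (simp add: card)
qed

lemma card_signs: "card {i. s i = 1} + card {i. s i = - 1} = CARD('n)"
proof -
  have "card ({i. s i = 1} \<union> {i. s i = - 1}) = card {i. s i = 1} + card {i. s i = - 1}"
    by (rule card_Un_disjoint) auto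
  moreover have "{i. s i = 1} \<union> {i. s i = - 1} = UNIV"
    using s_cases by auto
  ultimately show ?thesis
    by simp
qed

text \<open>Adding both inertia bounds counts each pair twice, each leftover vector once and each
  standard vector once.\<close>

lemma wsys_bound: "wsys m N \<sigma> e \<Longrightarrow> N \<le> CARD('n)"
proof -
  assume w: "wsys m N \<sigma> e"
  have "{2 * m..<N} = {k. 2 * m \<le> k \<and> k < N \<and> \<sigma> k = 1} \<union> {k. 2 * m \<le> k \<and> k < N \<and> \<sigma> k = - 1}"
    using wsysD(3)[OF w] by auto
  moreover have "card ({k. 2 * m \<le> k \<and> k < N \<and> \<sigma> k = 1} \<union> {k. 2 * m \<le> k \<and> k < N \<and> \<sigma> k = - 1})
      = card {k. 2 * m \<le> k \<and> k < N \<and> \<sigma> k = 1} + card {k. 2 * m \<le> k \<and> k < N \<and> \<sigma> k = - 1}"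
    by (rule card_Un_disjoint) auto
  ultimately have "card {2 * m..<N} = card {k. 2 * m \<le> k \<and> k < N \<and> \<sigma> k = 1} + card {k. 2 * m \<le> k \<and> k < N \<and> \<sigma> k = - 1}"
    by simp
  then show ?thesis
    using wsys_positive_negative[OF w] card_signs wsysD(1)[OF w] by simp
qed

end

section \<open>Extension of Witt systems by eigenvectors\<close>

context quat_form
begin

definition real_eigenvector :: "'n qmat set \<Rightarrow> quat ^ 'n \<Rightarrow> bool" where
  "real_eigenvector C v \<longleftrightarrow> (\<forall>x\<in>C. \<exists>r. x *v v = r *\<^sub>R v)"

text \<open>
  The last clause provides the partner that is needed to complete an isotropic eigenvector to a
  hyperbolic pair of eigenvectors; it replaces the simultaneous diagonalisability of \<open>C\<close>.
\<close>

definition split_family :: "'n qmat set \<Rightarrow> bool" where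
  "split_family C \<longleftrightarrow> C \<subseteq> skew \<and> (\<forall>x\<in>C. \<forall>y\<in>C. commutator x y = 0) \<and>
     (\<forall>v. joint_eigenvector C v \<longrightarrow> real_eigenvector C v) \<and>
     (\<forall>v. real_eigenvector C v \<and> v \<noteq> 0 \<and> form v v = 0 \<longrightarrow> (\<exists>v'. real_eigenvector C v' \<and> form v v' \<noteq> 0))"

lemma real_imp_joint_eigenvector: "real_eigenvector C v \<Longrightarrow> joint_eigenvector C v"
  unfolding real_eigenvector_def joint_eigenvector_def by (metis cq_simps(8) rsc_of_real)

lemma opposite_weights:
  assumes "x \<in> skew" "x *v v = r *\<^sub>R v" "x *v v' = r' *\<^sub>R v'" "form v v' \<noteq> 0"
  shows "r' = - r"
proof -
  have "form (x *v v) v' = - form v (x *v v')"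
    by (rule skewD) fact
  then have "(r + r') *\<^sub>R form v v' = 0"
    using assms by (simp add: form_scaleR scaleR_left_distrib del: scaleR_eq_0_iff)
  then show ?thesis
    using assms by simp
qed

lemma split_family_empty: "split_family {}"
  using form_nondegenerate form_eq_0_commute
  by (auto simp: split_family_def real_eigenvector_def joint_eigenvector_def) blast

text \<open>A partner is projected into the complement, scaled to pairing 1, and made isotropic by
  subtracting half of its own norm times v. The point is that each correction only adds vectors of
  the same weight, so an eigenvector remains.\<close>

lemma partner_in_wcompl:
  assumes C: "split_family C" and w: "wsys m (2 * m) \<sigma> e"
    and e: "\<And>k. k < 2 * m \<Longrightarrow> real_eigenvector C (e k)"
    and v: "v \<in> wcompl (2 * m) e" "real_eigenvector C v" "v \<noteq> 0" "form v v = 0"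
  shows "\<exists>v'\<in>wcompl (2 * m) e. real_eigenvector C v' \<and> form v v' = 1 \<and> form v' v' = 0"
proof -
  obtain v0 where v0: "real_eigenvector C v0" "form v v0 \<noteq> 0"
    using C v unfolding split_family_def by blast
  define v1 where "v1 = v0 - wproj m (2 * m) \<sigma> e v0"
  have v1: "v1 \<in> wcompl (2 * m) e" "form v v1 = form v v0"
    using diff_wproj_in_wcompl[OF w] wproj_orthogonal[OF w v(1)] by (simp_all add: v1_def form_diff)
  define v2 where "v2 = rsc v1 (inverse (form v v1))"
  have v2: "v2 \<in> wcompl (2 * m) e" "form v v2 = 1"
    using v1 v0 by (simp_all add: v2_def wcompl_def)
  then have v2': "form v2 v = 1"
    using qcnj_form[of v v2] by simp
  define \<rho> where "\<rho> = qre (form v2 v2)"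
  have \<rho>: "form v2 v2 = of_real \<rho>"
    unfolding \<rho>_def by (rule form_self_real)
  define v3 where "v3 = v2 - (\<rho> / 2) *\<^sub>R v"
  have "real_eigenvector C v3"
    unfolding real_eigenvector_def
  proof
    fix x assume x: "x \<in> C"
    then have xs: "x \<in> skew"
      using C by (auto simp: split_family_def)
    obtain r where r: "x *v v0 = r *\<^sub>R v0"
      using v0 x by (auto simp: real_eigenvector_def)
    \<comment> \<open>Only those \<open>e k\<close> contribute for which
      \<open>form (e (tau m k)) v0\<close> is nonzero, and skewness gives these the weight r of
      v0.\<close>
    have "x *v wproj m (2 * m) \<sigma> e v0 = r *\<^sub>R wproj m (2 * m) \<sigma> e v0"
      unfolding wproj_def mv_sum_right scaleR_sum_right
    proof (intro sum.cong refl)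
      fix k assume "k \<in> {..<2 * m}"
      then have k: "k < 2 * m" "tau m k < 2 * m"
        by auto
      obtain t where t: "x *v e k = t *\<^sub>R e k"
        using e[OF k(1)] x by (auto simp: real_eigenvector_def)
      obtain t' where t': "x *v e (tau m k) = t' *\<^sub>R e (tau m k)"
        using e[OF k(2)] x by (auto simp: real_eigenvector_def)
      have "t = - t'"
        by (rule opposite_weights[OF xs t' t]) (use wsysD[OF w] k in auto)
      moreover have "form (e (tau m k)) v0 \<noteq> 0 \<Longrightarrow> r = - t'"
        by (rule opposite_weights[OF xs t' r])
      ultimately show "x *v rsc (e k) (\<sigma> k *\<^sub>R form (e (tau m k)) v0)
          = r *\<^sub>R rsc (e k) (\<sigma> k *\<^sub>R form (e (tau m k)) v0)"
        by (cases "form (e (tau m k)) v0 = 0") (simp_all add: mv_rsc mv_scaleR_right t rsc_scaleR)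
    qed
    then have "x *v v1 = r *\<^sub>R v1"
      by (simp add: v1_def mv_diff_right r scaleR_diff_right)
    then have r2: "x *v v2 = r *\<^sub>R v2"
      by (simp add: v2_def mv_rsc rsc_scaleR)
    obtain r' where r': "x *v v = r' *\<^sub>R v"
      using v x by (auto simp: real_eigenvector_def)
    have "r = - r'"
      by (rule opposite_weights[OF xs r' r2]) (simp add: v2)
    \<comment> \<open>A nonzero \<rho> means that v2 pairs with itself, so r = 0; then v has weight
      0 too, and subtracting a multiple of it is harmless.\<close>
    moreover have "\<rho> \<noteq> 0 \<Longrightarrow> r = - r"
      by (rule opposite_weights[OF xs r2 r2]) (simp add: \<rho>)
    ultimately have "x *v v3 = r *\<^sub>R v3"
      by (cases "\<rho> = 0") (simp_all add: v3_def mv_diff_right mv_scaleR_right r2 r')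
    then show "\<exists>r. x *v v3 = r *\<^sub>R v3" ..
  qed
  moreover have "v3 \<in> wcompl (2 * m) e"
    using v2 v by (simp add: v3_def wcompl_def form_diff form_scaleR)
  moreover have "form v v3 = 1" "form v3 v3 = 0"
    using v v2 v2' \<rho> by (simp_all add: v3_def form_diff form_scaleR quat_eq_iff of_real_def)
  ultimately show ?thesis
    by blast
qed

lemma wsys_append_pair:
  assumes w: "wsys m (2 * m) (\<lambda>_. 1) e"
    and v: "v \<in> wcompl (2 * m) e" "v' \<in> wcompl (2 * m) e" "form v v = 0" "form v v' = 1" "form v' v' = 0"
  shows "wsys (Suc m) (2 * Suc m) (\<lambda>_. 1) (e(2 * m := v, Suc (2 * m) := v'))"
proof -
  have tau: "tau (Suc m) k = (if k = 2 * m then Suc (2 * m) else if k = Suc (2 * m) then 2 * m else tau m k)"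
    if "k < 2 * Suc m" for k
    using that by (auto simp: tau_def)
  have v'v: "form v' v = 1"
    using v(4) qcnj_form[of v v'] by simp
  have e: "form (e k) v = 0" "form (e k) v' = 0" "form v (e k) = 0" "form v' (e k) = 0" if "k < 2 * m" for k
    using v(1,2) that form_eq_0_commute by (auto simp: wcompl_def)
  have "form ((e(2 * m := v, Suc (2 * m) := v')) k) ((e(2 * m := v, Suc (2 * m) := v')) l)
      = (if l = tau (Suc m) k then of_real 1 else 0)" if kl: "k < 2 * Suc m" "l < 2 * Suc m" for k l
  proof -
    have tk: "2 * m \<noteq> tau m k" "Suc (2 * m) \<noteq> tau m k" if "k < 2 * m"
      using tau_less_iff[of m k] that by linarith+
    have K: "k < 2 * m \<or> k = 2 * m \<or> k = Suc (2 * m)" and L: "l < 2 * m \<or> l = 2 * m \<or> l = Suc (2 * m)"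
      using kl by presburger+
    from K L show ?thesis
      by (elim disjE) (use tk in \<open>simp_all add: tau e v v'v wsysD(4)[OF w]\<close>)
  qed
  then show ?thesis
    unfolding wsys_def by simp
qed

text \<open>As long as the complement contains an isotropic real eigenvector, it and its partner
  form a further pair; \<open>wsys_bound\<close> ends the process.\<close>

lemma extend_pairs:
  assumes C: "split_family C"
  shows "wsys m (2 * m) (\<lambda>_. 1) e \<Longrightarrow> (\<And>k. k < 2 * m \<Longrightarrow> real_eigenvector C (e k)) \<Longrightarrow>
    \<exists>M e'. m \<le> M \<and> (\<forall>k<2 * m. e' k = e k) \<and> wsys M (2 * M) (\<lambda>_. 1) e' \<and>
      (\<forall>k<2 * M. real_eigenvector C (e' k)) \<and>
      (\<forall>v\<in>wcompl (2 * M) e'. real_eigenvector C v \<longrightarrow> v \<noteq> 0 \<longrightarrow> form v v \<noteq> 0)"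
proof (induction "CARD('n) - 2 * m" arbitrary: m e rule: less_induct)
  case less
  show ?case
  proof (cases "\<forall>v\<in>wcompl (2 * m) e. real_eigenvector C v \<longrightarrow> v \<noteq> 0 \<longrightarrow> form v v \<noteq> 0")
    case True
    then show ?thesis
      using less.prems by (intro exI[of _ m] exI[of _ e]) auto
  next
    case False
    then obtain v where v: "v \<in> wcompl (2 * m) e" "real_eigenvector C v" "v \<noteq> 0" "form v v = 0"
      by blast
    obtain v' where v': "v' \<in> wcompl (2 * m) e" "real_eigenvector C v'" "form v v' = 1" "form v' v' = 0"
      using partner_in_wcompl[OF C less.prems v] by blast
    define f where "f = e(2 * m := v, Suc (2 * m) := v')"
    have f: "wsys (Suc m) (2 * Suc m) (\<lambda>_. 1) f"
      unfolding f_def by (rule wsys_append_pair) (use less.prems v v' in auto)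
    have feig: "real_eigenvector C (f k)" if "k < 2 * Suc m" for k
      using that v v' less.prems(2)[of k] by (auto simp: f_def)
    have "CARD('n) - 2 * Suc m < CARD('n) - 2 * m"
      using wsys_bound[OF f] by simp
    from less.hyps[OF this f feig] obtain M e' where
      M: "Suc m \<le> M" "\<forall>k<2 * Suc m. e' k = f k" "wsys M (2 * M) (\<lambda>_. 1) e'"
        "\<forall>k<2 * M. real_eigenvector C (e' k)"
        "\<forall>v\<in>wcompl (2 * M) e'. real_eigenvector C v \<longrightarrow> v \<noteq> 0 \<longrightarrow> form v v \<noteq> 0"
      by blast
    moreover have "\<forall>k<2 * m. e' k = e k"
      using M(2) by (simp add: f_def)
    ultimately show ?thesis
      by (intro exI[of _ M] exI[of _ e']) simp
  qed
qed

text \<open>The complement is invariant under C, so it contains a joint eigenvector unless it is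
  zero; being anisotropic, this vector can be scaled to norm 1 or -1 and appended.\<close>

lemma extend_anisotropic:
  assumes C: "C \<subseteq> skew" "\<And>x y. x \<in> C \<Longrightarrow> y \<in> C \<Longrightarrow> commutator x y = 0"
  shows "wsys m N \<sigma> e \<Longrightarrow> (\<And>k. k < N \<Longrightarrow> joint_eigenvector C (e k)) \<Longrightarrow>
    (\<And>v. v \<in> wcompl N e \<Longrightarrow> joint_eigenvector C v \<Longrightarrow> v \<noteq> 0 \<Longrightarrow> form v v \<noteq> 0) \<Longrightarrow>
    \<exists>N' \<sigma>' e'. N \<le> N' \<and> (\<forall>k<N. e' k = e k) \<and> wsys m N' \<sigma>' e' \<and>
      (\<forall>k<N'. joint_eigenvector C (e' k)) \<and> wcompl N' e' = {0}"
proof (induction "CARD('n) - N" arbitrary: N e \<sigma> rule: less_induct)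
  case less
  show ?case
  proof (cases "wcompl N e = {0}")
    case True
    then show ?thesis
      using less.prems by (intro exI[of _ N] exI[of _ \<sigma>] exI[of _ e]) auto
  next
    case False
    have "\<exists>v\<in>wcompl N e. v \<noteq> 0 \<and> joint_eigenvector C v"
      using C False less.prems
      by (intro joint_eigenvector_exists hsubspace_imp_csubspace hsubspace_wcompl wcompl_invariant[of C]) auto
    then obtain v where v: "v \<in> wcompl N e" "v \<noteq> 0" "joint_eigenvector C v"
      by blast
    define \<rho> where "\<rho> = qre (form v v)"
    have \<rho>: "form v v = of_real \<rho>"
      unfolding \<rho>_def by (rule form_self_real)
    have \<rho>0: "\<rho> \<noteq> 0"
      using less.prems(3)[OF v(1,3,2)] \<rho> by auto
    define v' where "v' = (1 / sqrt \<bar>\<rho>\<bar>) *\<^sub>R v"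
    have "form v' v' = of_real ((1 / sqrt \<bar>\<rho>\<bar>) * ((1 / sqrt \<bar>\<rho>\<bar>) * \<rho>))"
      by (simp only: v'_def form_scaleR \<rho> of_real_def scaleR_scaleR)
    also have "(1 / sqrt \<bar>\<rho>\<bar>) * ((1 / sqrt \<bar>\<rho>\<bar>) * \<rho>) = sgn \<rho>"
      using \<rho>0 by (simp add: sgn_if)
    finally have v'v': "form v' v' = of_real (sgn \<rho>)" .
    have v': "v' \<in> wcompl N e"
      using v by (simp add: v'_def wcompl_def form_scaleR)
    have jv': "joint_eigenvector C v'"
      using v(3) unfolding joint_eigenvector_def v'_def mv_scaleR_right rsc_scaleR by metis
    define f where "f = e(N := v')"
    define \<sigma>' where "\<sigma>' = \<sigma>(N := sgn \<rho>)"
    have N: "2 * m \<le> N"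
      by (rule wsysD(1)) fact
    have e: "form (e k) v' = 0" "form v' (e k) = 0" if "k < N" for k
      using v' that form_eq_0_commute by (auto simp: wcompl_def)
    have "form (f k) (f l) = (if l = tau m k then of_real (\<sigma>' k) else 0)"
      if kl: "k < Suc N" "l < Suc N" for k l
    proof (cases "k = N")
      case True
      then show ?thesis
        using kl N e v'v' by (auto simp: f_def \<sigma>'_def tau_outside)
    next
      case False
      then have "k < N" "tau m k < N"
        using kl N by (auto simp: tau_less_bound)
      then show ?thesis
        using kl e wsysD(4)[OF less.prems(1), of k l] by (auto simp: f_def \<sigma>'_def)
    qed
    then have f: "wsys m (Suc N) \<sigma>' f"
      using wsysD(2,3)[OF less.prems(1)] N \<rho>0 by (auto simp: wsys_def \<sigma>'_def sgn_if)
    have feig: "joint_eigenvector C (f k)" if "k < Suc N" for k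
      using that less.prems(2)[of k] jv' by (auto simp: f_def less_Suc_eq)
    have sub: "wcompl (Suc N) f \<subseteq> wcompl N e"
      unfolding wcompl_def f_def by (auto simp: less_Suc_eq)
    have "CARD('n) - Suc N < CARD('n) - N"
      using wsys_bound[OF f] by simp
    note hyp = less.hyps[OF this f feig]
    have "form v v \<noteq> 0" if "v \<in> wcompl (Suc N) f" "joint_eigenvector C v" "v \<noteq> 0" for v
      using that less.prems(3)[of v] sub by blast
    from hyp[OF _ this] obtain N' \<tau> e' where M: "Suc N \<le> N'" "\<forall>k<Suc N. e' k = f k" "wsys m N' \<tau> e'"
        "\<forall>k<N'. joint_eigenvector C (e' k)" "wcompl N' e' = {0}"
      by blast
    moreover have "\<forall>k<N. e' k = e k"
      using M(2) by (simp add: f_def)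
    ultimately show ?thesis
      by (intro exI[of _ N'] exI[of _ \<tau>] exI[of _ e']) simp
  qed
qed

lemma wproj_complete: "wproj m N \<sigma> e v = v" if "wsys m N \<sigma> e" "wcompl N e = {0}"
  using diff_wproj_in_wcompl[OF that(1), of v] that(2) by simp

text \<open>A complete system resolves the identity into N rank-one operators, each of real trace
  1.\<close>

lemma complete_wsys_card: "N = CARD('n)" if w: "wsys m N \<sigma> e" "wcompl N e = {0}"
proof -
  have "mat 1 = (\<Sum>k<N. outer (e k) (of_real (\<sigma> k)) (e (tau m k)))"
    by (rule matrix_eqI)
      (use wproj_complete[OF w] in \<open>simp add: mv_sum_left wproj_def of_real_def\<close>)
  then have "retr (mat 1 :: 'n qmat) = retr (\<Sum>k<N. outer (e k) (of_real (\<sigma> k)) (e (tau m k)))"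
    by simp
  also have "\<dots> = (\<Sum>k<N. retr (outer (e k) (of_real (\<sigma> k)) (e (tau m k))))"
    by (induction N) (simp_all add: retr_simps, simp add: retr_def)
  also have "\<dots> = (\<Sum>k<N. 1)"
    by (intro sum.cong refl) (use wsysD[OF w(1)] in \<open>simp add: retr_outer of_real_def\<close>)
  finally have "real CARD('n) = real N"
    by (simp add: retr_def mat_def)
  then show ?thesis
    by simp
qed

end

text \<open>The bound on p makes the number of positive signs the smaller index of inertia, hence
  the Witt index of the form.\<close>

locale witt_form = quat_form s
  for s :: "'n::finite \<Rightarrow> real" +
  fixes p :: nat
  assumes p_card: "p = card {i. s i = 1}" and two_p_le: "2 * p \<le> CARD('n)"
begin

definition fsign :: "nat \<Rightarrow> real" where
  "fsign k = (if k < 2 * p then 1 else - 1)"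

text \<open>A complete Witt system with the greatest possible number p of pairs; what is left over
  is negative, as \<open>fsign\<close> records.\<close>

definition frame :: "(nat \<Rightarrow> quat ^ 'n) \<Rightarrow> bool" where
  "frame e \<longleftrightarrow> wsys p CARD('n) fsign e \<and> wcompl CARD('n) e = {0}"

text \<open>Two leftover vectors of opposite sign would add up to an isotropic vector of the
  complement; so all leftover signs agree.\<close>

lemma anisotropic_complement_shape:
  assumes w: "wsys m N \<sigma> e" "wcompl N e = {0}"
    and an: "\<And>v. v \<in> wcompl (2 * m) e \<Longrightarrow> v \<noteq> 0 \<Longrightarrow> form v v \<noteq> 0"
  shows "m = p" "frame e"
proof -
  have N: "N = CARD('n)"
    by (rule complete_wsys_card) fact+
  have uniform: "\<sigma> k = \<sigma> l" if k: "2 * m \<le> k" "k < N" and l: "2 * m \<le> l" "l < N" for k l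
  proof (rule ccontr)
    assume ne: "\<sigma> k \<noteq> \<sigma> l"
    then have "k \<noteq> l"
      by auto
    have "e k + e l \<in> wcompl (2 * m) e"
      using wsysD(4)[OF w(1)] k l by (auto simp: wcompl_def form_add tau_less_iff) (metis not_le tau_less_iff)+
    moreover have "form (e k + e l) (e k + e l) = of_real (\<sigma> k + \<sigma> l)"
      using wsysD(4)[OF w(1)] k l \<open>k \<noteq> l\<close> by (auto simp: form_add tau_outside)
    moreover have "\<sigma> k + \<sigma> l = 0"
      using ne wsysD(3)[OF w(1), of k] wsysD(3)[OF w(1), of l] by auto
    moreover have "e k + e l \<noteq> 0"
    proof
      assume "e k + e l = 0"
      then have "form (e k) (e k + e l) = 0"
        by simp
      then show False
        using wsysD(4)[OF w(1)] wsysD(6)[OF w(1), of k] k l \<open>k \<noteq> l\<close> by (auto simp: form_add tau_outside)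
    qed
    ultimately show False
      using an by auto
  qed
  have mN: "2 * m \<le> N"
    by (rule wsysD(1)) fact
  have card: "card {k. 2 * m \<le> k \<and> k < N \<and> \<sigma> k = t} = (if N = 2 * m then 0 else if \<sigma> (2 * m) = t then N - 2 * m else 0)" for t
  proof (cases "N = 2 * m")
    case False
    then have "2 * m < N"
      using mN by linarith
    then have eq: "\<sigma> k = \<sigma> (2 * m)" if "2 * m \<le> k" "k < N" for k
      by (rule uniform[OF that order.refl])
    have "{k. 2 * m \<le> k \<and> k < N \<and> \<sigma> k = t} = {k. 2 * m \<le> k \<and> k < N \<and> \<sigma> (2 * m) = t}"
      by (rule Collect_cong) (metis eq)
    also have "\<dots> = (if \<sigma> (2 * m) = t then {2 * m..<N} else {})"
      by auto
    finally show ?thesis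
      using False by simp
  qed auto
  note pn = wsys_positive_negative[OF w(1), unfolded card, folded p_card]
  have m1: "p + card {i. s i = - 1} = CARD('n)"
    using card_signs by (simp add: p_card)
  \<comment> \<open>Completeness turns both inertia bounds into equalities. With a common leftover
    sign and p at most half of \<open>CARD('n)\<close>, no positive vector can be left over.\<close>
  have mp: "m = p \<and> (N = 2 * m \<or> \<sigma> (2 * m) = - 1)"
    using pn m1 two_p_le N mN wsysD(3)[OF w(1), of "2 * m"] by (auto split: if_splits)
  then show "m = p"
    by simp
  have "wsys p N fsign e"
    unfolding wsys_def
  proof (intro conjI allI impI)
    fix k l assume k: "k < N" "l < N"
    have "\<sigma> k = fsign k"
      using mp wsysD(2)[OF w(1)] uniform[of k "2 * m"] k by (auto simp: fsign_def)
    then show "form (e k) (e l) = (if l = tau p k then of_real (fsign k) else 0)"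
      using wsysD(4)[OF w(1) k] mp by simp
  qed (use mN mp in \<open>auto simp: fsign_def\<close>)
  then show "frame e"
    using w(2) N by (simp add: frame_def)
qed

lemma frame_wsys: "frame e \<Longrightarrow> wsys p CARD('n) fsign e"
  by (simp add: frame_def)

lemma frame_form:
  "frame e \<Longrightarrow> k < CARD('n) \<Longrightarrow> l < CARD('n) \<Longrightarrow>
    form (e k) (e l) = (if l = tau p k then of_real (fsign k) else 0)"
  by (rule wsysD(4)[OF frame_wsys])

lemma fsign_simps [simp]: "fsign k * fsign k = 1" "fsign k * (fsign k * r) = r"
    "fsign (tau p k) = fsign k" "fsign k \<noteq> 0"
  by (simp_all add: fsign_def)

lemma tau_less_card [simp]: "tau p k < CARD('n) \<longleftrightarrow> k < CARD('n)"
  by (rule tau_less_bound[OF two_p_le])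

lemma frame_expansion:
  "frame e \<Longrightarrow> v = (\<Sum>k<CARD('n). rsc (e k) (fsign k *\<^sub>R form (e (tau p k)) v))"
  using wproj_complete[of p "CARD('n)" fsign e v] by (simp add: frame_def wproj_def)

lemma frame_anisotropic:
  assumes e: "frame e" and v: "v \<in> wcompl (2 * p) e" "v \<noteq> 0"
  shows "form v v \<noteq> 0"
proof
  assume "form v v = 0"
  have "form v v = form (\<Sum>k<CARD('n). rsc (e k) (fsign k *\<^sub>R form (e (tau p k)) v)) v"
    by (subst frame_expansion[OF e, of v]) (rule refl)
  also have "\<dots> = (\<Sum>k<CARD('n). fsign k *\<^sub>R (qcnj (form (e (tau p k)) v) * form (e k) v))"
    by (simp add: form_sum del: qcnj_form)
  also have "\<dots> = (\<Sum>k<CARD('n). - of_real ((norm (form (e k) v))\<^sup>2))"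
  proof (intro sum.cong refl)
    fix k
    show "fsign k *\<^sub>R (qcnj (form (e (tau p k)) v) * form (e k) v) = - of_real ((norm (form (e k) v))\<^sup>2)"
    proof (cases "k < 2 * p")
      case True
      then show ?thesis
        using v by (simp add: wcompl_def)
    next
      case False
      then have "tau p k = k" "fsign k = - 1"
        by (simp_all add: tau_outside fsign_def)
      then show ?thesis
        by (simp only: qcnj_mult_self) simp
    qed
  qed
  finally have "qre (form v v) = - (\<Sum>k<CARD('n). (norm (form (e k) v))\<^sup>2)"
    by (simp add: qre_sum of_real_def sum_negf)
  then have "(\<Sum>k<CARD('n). (norm (form (e k) v))\<^sup>2) = 0"
    using \<open>form v v = 0\<close> by simp
  then have "v \<in> wcompl CARD('n) e"
    by (simp add: sum_nonneg_eq_0_iff wcompl_def)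
  then show False
    using e v by (simp add: frame_def)
qed

text \<open>Once no isotropic eigenvector is left, the remaining eigenvectors pair with themselves
  and so have weight 0. Hence C annihilates the complement of the pairs, every vector there is an
  eigenvector, and none is isotropic. For C = {} this is Witt's extension theorem.\<close>

theorem split_family_frame:
  assumes C: "split_family C" and w: "wsys m (2 * m) (\<lambda>_. 1) e"
    and eig: "\<And>k. k < 2 * m \<Longrightarrow> real_eigenvector C (e k)"
  shows "m \<le> p \<and> (\<exists>e'. frame e' \<and> (\<forall>k<2 * m. e' k = e k) \<and>
      (\<forall>k<CARD('n). real_eigenvector C (e' k)))"
proof -
  have Cs: "C \<subseteq> skew" and Cc: "\<And>x y. x \<in> C \<Longrightarrow> y \<in> C \<Longrightarrow> commutator x y = 0"
    and Cr: "\<And>v. joint_eigenvector C v \<Longrightarrow> real_eigenvector C v"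
    using C by (auto simp: split_family_def)
  obtain M e1 where e1: "m \<le> M" "\<forall>k<2 * m. e1 k = e k" "wsys M (2 * M) (\<lambda>_. 1) e1"
      "\<forall>k<2 * M. real_eigenvector C (e1 k)"
      "\<forall>v\<in>wcompl (2 * M) e1. real_eigenvector C v \<longrightarrow> v \<noteq> 0 \<longrightarrow> form v v \<noteq> 0"
    using extend_pairs[OF C w eig] by blast
  have j1: "joint_eigenvector C (e1 k)" if "k < 2 * M" for k
    using e1(4) that real_imp_joint_eigenvector by blast
  have an1: "form v v \<noteq> 0" if "v \<in> wcompl (2 * M) e1" "joint_eigenvector C v" "v \<noteq> 0" for v
    using e1(5) that Cr by blast
  from extend_anisotropic[OF Cs Cc e1(3) j1 an1]
  obtain N \<sigma> e2 where e2: "2 * M \<le> N" "\<forall>k<2 * M. e2 k = e1 k" "wsys M N \<sigma> e2"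
      "\<forall>k<N. joint_eigenvector C (e2 k)" "wcompl N e2 = {0}"
    by blast
  have zero: "x *v e2 k = 0" if x: "x \<in> C" and k: "2 * M \<le> k" "k < N" for x k
  proof -
    obtain r where r: "x *v e2 k = r *\<^sub>R e2 k"
      using e2(4) Cr k x unfolding real_eigenvector_def by blast
    have "r = - r"
      by (rule opposite_weights[OF _ r r]) (use x Cs wsysD(4,6)[OF e2(3)] k in \<open>auto simp: tau_outside\<close>, metis mult_zero_left zero_neq_one)
    then show ?thesis
      by (simp add: r)
  qed
  have an: "form v v \<noteq> 0" if v: "v \<in> wcompl (2 * M) e2" "v \<noteq> 0" for v
  proof -
    have "x *v v = 0" if x: "x \<in> C" for x
    proof -
      have "x *v v = x *v wproj M N \<sigma> e2 v"
        by (simp add: wproj_complete[OF e2(3,5)])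
      also have "\<dots> = 0"
        unfolding wproj_def mv_sum_right
      proof (intro sum.neutral ballI)
        fix k assume "k \<in> {..<N}"
        then show "x *v rsc (e2 k) (\<sigma> k *\<^sub>R form (e2 (tau M k)) v) = 0"
          using zero[OF x, of k] v by (cases "k < 2 * M") (auto simp: mv_rsc wcompl_def)
      qed
      finally show ?thesis .
    qed
    then have "real_eigenvector C v"
      unfolding real_eigenvector_def by (metis scaleR_zero_left)
    moreover have "v \<in> wcompl (2 * M) e1"
      using v e2(2) by (auto simp: wcompl_def)
    ultimately show ?thesis
      using e1(5) v by blast
  qed
  have "M = p" "frame e2"
    using anisotropic_complement_shape[OF e2(3,5) an] by auto
  moreover have "N = CARD('n)"
    by (rule complete_wsys_card) fact+
  moreover have "\<forall>k<2 * m. e2 k = e k"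
    using e1(1,2) e2(2) by simp
  moreover have "\<forall>k<N. real_eigenvector C (e2 k)"
    using e2(4) Cr by blast
  ultimately show ?thesis
    using e1(1) by auto
qed

lemma frame_exists: "\<exists>e. frame e"
proof -
  have "wsys 0 (2 * 0) (\<lambda>_. 1) (\<lambda>_. 0)"
    by (simp add: wsys_def)
  then show ?thesis
    using split_family_frame[OF split_family_empty, of 0] by auto
qed

text \<open>The hyperbolic pairs are kept and only the anisotropic part is chosen anew; no isotropic
  vector can occur there, so complex weights cause no difficulty.\<close>

lemma joint_frame:
  assumes e: "frame e" and C: "C \<subseteq> skew" "\<And>x y. x \<in> C \<Longrightarrow> y \<in> C \<Longrightarrow> commutator x y = 0"
    and eig: "\<And>k. k < 2 * p \<Longrightarrow> joint_eigenvector C (e k)"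
  shows "\<exists>e'. frame e' \<and> (\<forall>k<2 * p. e' k = e k) \<and> (\<forall>k<CARD('n). joint_eigenvector C (e' k))"
proof -
  have w: "wsys p (2 * p) fsign e"
    using frame_wsys[OF e] two_p_le by (auto simp: wsys_def)
  obtain N \<sigma> e' where e': "2 * p \<le> N" "\<forall>k<2 * p. e' k = e k" "wsys p N \<sigma> e'"
      "\<forall>k<N. joint_eigenvector C (e' k)" "wcompl N e' = {0}"
    using extend_anisotropic[OF C w eig] frame_anisotropic[OF e] by blast
  have "form v v \<noteq> 0" if "v \<in> wcompl (2 * p) e'" "v \<noteq> 0" for v
    using frame_anisotropic[OF e, of v] that e'(2) by (simp add: wcompl_def)
  then have "frame e'"
    by (rule anisotropic_complement_shape(2)[OF e'(3,5)])
  moreover have "N = CARD('n)"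
    by (rule complete_wsys_card) fact+
  ultimately show ?thesis
    using e' by auto
qed

end

section \<open>Conjugacy as an equivalence relation\<close>

context real_lie_algebra
begin

lemma zero_in_g: "0 \<in> g"
  by (rule subspace_0[OF subspace_g])

lemma conjugate_refl: "conjugate B B"
  by (auto simp: conjugate_def automorphism_def intro!: exI[of _ "\<lambda>x. x"] bij_betw_byWitness)

text \<open>The inclusion in g lets the inverse automorphism recover B; outside of g an automorphism
  is an arbitrary function.\<close>

lemma conjugate_sym:
  assumes B: "B \<subseteq> g" and BB': "conjugate B B'"
  shows "conjugate B' B"
proof -
  obtain \<phi> where \<phi>: "automorphism \<phi>" "\<phi> ` B = B'"
    using BB' by (auto simp: conjugate_def)
  note aut = \<phi>(1)[unfolded automorphism_def]
  define \<psi> where "\<psi> = inv_into g \<phi>"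
  have \<psi>: "\<psi> x \<in> g" "\<phi> (\<psi> x) = x" if "x \<in> g" for x
    using that aut by (auto simp: \<psi>_def bij_betw_def inv_into_into f_inv_into_f)
  have \<psi>\<phi>: "\<psi> (\<phi> x) = x" if "x \<in> g" for x
    using that aut by (auto simp: \<psi>_def bij_betw_def)
  have "automorphism \<psi>"
    unfolding automorphism_def
  proof (intro conjI ballI allI)
    show "bij_betw \<psi> g g"
      unfolding \<psi>_def using aut by (intro bij_betw_inv_into) auto
    fix x y r assume x: "x \<in> g" and y: "y \<in> g"
    have "\<psi> (\<phi> (\<psi> x + \<psi> y)) = \<psi> x + \<psi> y"
      using \<psi> x y by (intro \<psi>\<phi> subspace_add[OF subspace_g]) auto
    then show "\<psi> (x + y) = \<psi> x + \<psi> y"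
      using aut \<psi> x y by simp
    have "\<psi> (\<phi> (br (\<psi> x) (\<psi> y))) = br (\<psi> x) (\<psi> y)"
      using \<psi> x y by (intro \<psi>\<phi> br_closed) auto
    then show "\<psi> (br x y) = br (\<psi> x) (\<psi> y)"
      using aut \<psi> x y by simp
  next
    fix x r assume x: "x \<in> g"
    have "\<psi> (\<phi> (r *\<^sub>R \<psi> x)) = r *\<^sub>R \<psi> x"
      using \<psi> x by (intro \<psi>\<phi> subspace_scale[OF subspace_g]) auto
    then show "\<psi> (r *\<^sub>R x) = r *\<^sub>R \<psi> x"
      using aut \<psi> x by simp
  qed
  moreover have "\<psi> ` B' = B"
    using B \<psi>\<phi> by (auto simp: \<phi>(2)[symmetric] image_image subset_iff)
  ultimately show ?thesis
    by (auto simp: conjugate_def)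
qed

lemma conjugate_trans:
  assumes "conjugate B B'" "conjugate B' B''"
  shows "conjugate B B''"
proof -
  obtain \<phi> \<psi> where 1: "automorphism \<phi>" "\<phi> ` B = B'" "automorphism \<psi>" "\<psi> ` B' = B''"
    using assms by (auto simp: conjugate_def)
  then have "\<And>x. x \<in> g \<Longrightarrow> \<phi> x \<in> g"
    by (auto simp: automorphism_def bij_betw_def)
  with 1 have "automorphism (\<psi> \<circ> \<phi>)"
    unfolding automorphism_def by (auto intro: bij_betw_trans)
  moreover have "(\<psi> \<circ> \<phi>) ` B = B''"
    using 1 by auto
  ultimately show ?thesis
    by (auto simp: conjugate_def)
qed

end

section \<open>Dimension, isometries and isotropic subspaces\<close>

context quat_form
begin

text \<open>An automorphism is linear only on \<open>skew\<close>. That the image of a basis spans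
  the image is therefore shown through the subspace of those x in S whose image lies in the
  span.\<close>

lemma conjugate_dim_le:
  assumes S: "subspace S" "S \<subseteq> skew" and "conjugate S S'"
  shows "dim S' \<le> dim S"
proof -
  obtain \<phi> where aut: "automorphism \<phi>" and S': "\<phi> ` S = S'"
    using assms(3) by (auto simp: conjugate_def)
  obtain b where b: "b \<subseteq> S" "independent b" "S \<subseteq> span b" "card b = dim S"
    using basis_exists by blast
  have \<phi>0: "\<phi> 0 = 0"
    using aut zero_in_g unfolding automorphism_def by (metis add_cancel_right_right)
  have spb: "span b \<subseteq> S"
    using b(1) S(1) by (rule span_minimal)
  have sub: "subspace {x \<in> S. \<phi> x \<in> span (\<phi> ` b)}"
  proof (rule subspaceI)
    show "0 \<in> {x \<in> S. \<phi> x \<in> span (\<phi> ` b)}"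
      using S by (simp add: \<phi>0 span_zero subspace_0)
    fix x y r assume x: "x \<in> {x \<in> S. \<phi> x \<in> span (\<phi> ` b)}"
    then have "\<phi> (r *\<^sub>R x) = r *\<^sub>R \<phi> x"
      using aut S(2) by (auto simp: automorphism_def)
    then show "r *\<^sub>R x \<in> {x \<in> S. \<phi> x \<in> span (\<phi> ` b)}"
      using x S(1) by (simp add: subspace_scale span_scale)
    assume y: "y \<in> {x \<in> S. \<phi> x \<in> span (\<phi> ` b)}"
    have "x \<in> skew" "y \<in> skew"
      using x y S(2) by auto
    then have "\<phi> (x + y) = \<phi> x + \<phi> y"
      using aut by (auto simp: automorphism_def)
    then show "x + y \<in> {x \<in> S. \<phi> x \<in> span (\<phi> ` b)}"
      using x y S(1) by (simp add: subspace_add span_add)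
  qed
  have "b \<subseteq> {x \<in> S. \<phi> x \<in> span (\<phi> ` b)}"
    using b(1) by (auto intro: span_base)
  then have "span b \<subseteq> {x \<in> S. \<phi> x \<in> span (\<phi> ` b)}"
    using sub by (rule span_minimal)
  then have "S' \<subseteq> span (\<phi> ` b)"
    using b(3) S' by blast
  moreover have "finite b"
    using b(2) by (rule independent_imp_finite)
  ultimately have "dim S' \<le> card (\<phi> ` b)"
    by (intro dim_le_card) auto
  also have "\<dots> \<le> dim S"
    using \<open>finite b\<close> b(4) card_image_le by metis
  finally show ?thesis .
qed

lemma conjugate_dim_eq:
  assumes "subspace S" "S \<subseteq> skew" "subspace S'" "S' \<subseteq> skew" "conjugate S S'"
  shows "dim S = dim S'"
  using conjugate_dim_le[of S S'] conjugate_dim_le[of S' S] conjugate_sym[of S S'] assms by auto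

lemma isometry_automorphism:
  assumes inv: "\<And>v. T *v (T' *v v) = v" "\<And>v. T' *v (T *v v) = v"
    and iso: "\<And>u v. form (T *v u) (T *v v) = form u v"
  shows "automorphism (\<lambda>x. T ** x ** T')"
    and "(\<lambda>x. T ** x ** T') ` ideal_of U = ideal_of ((*v) T ` U)"
proof -
  have TT: "T' ** (T ** x ** T') ** T = x" "T ** (T' ** x ** T) ** T' = x" for x
    by (rule matrix_eqI, simp add: mv_assoc inv)+
  have iso': "form (T' *v u) (T' *v v) = form u v" for u v
    using iso[of "T' *v u" "T' *v v"] by (simp add: inv)
  have adj: "form (T *v u) v = form u (T' *v v)" "form (T' *v u) v = form u (T *v v)" for u v
    using iso[of u "T' *v v"] iso'[of u "T *v v"] by (simp_all add: inv)
  have skew: "x \<in> skew \<Longrightarrow> T ** x ** T' \<in> skew" "x \<in> skew \<Longrightarrow> T' ** x ** T \<in> skew" for x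
    by (simp_all add: skew_def mv_assoc adj)
  have "bij_betw (\<lambda>x. T ** x ** T') skew skew"
    by (rule bij_betw_byWitness[where f' = "\<lambda>x. T' ** x ** T"])
      (auto simp only: skew TT)
  then show "automorphism (\<lambda>x. T ** x ** T')"
    unfolding automorphism_def
    by (auto intro!: matrix_eqI simp: mv_simps commutator_mv inv)
  show "(\<lambda>x. T ** x ** T') ` ideal_of U = ideal_of ((*v) T ` U)"
  proof (intro equalityI subsetI)
    fix y assume "y \<in> (\<lambda>x. T ** x ** T') ` ideal_of U"
    then show "y \<in> ideal_of ((*v) T ` U)"
      by (auto simp: ideal_of_def skew mv_assoc)
  next
    fix y assume y: "y \<in> ideal_of ((*v) T ` U)"
    have "(T' ** y ** T) *v v \<in> U" for v
    proof -
      have "y *v (T *v v) \<in> (*v) T ` U"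
        using y by (auto simp: ideal_of_def)
      then obtain u where "y *v (T *v v) = T *v u" "u \<in> U"
        by blast
      then show ?thesis
        by (simp add: mv_assoc inv)
    qed
    then have "T' ** y ** T \<in> ideal_of U"
      using y by (simp add: ideal_of_def skew)
    moreover have "y = T ** (T' ** y ** T) ** T'"
      by (rule matrix_eqI) (simp add: mv_assoc inv)
    ultimately show "y \<in> (\<lambda>x. T ** x ** T') ` ideal_of U"
      by blast
  qed
qed

text \<open>One vector from each of the first k hyperbolic pairs; for a Witt system with at least k
  pairs this is isotropic of dimension k.\<close>

definition even_span :: "(nat \<Rightarrow> quat ^ 'n) \<Rightarrow> nat \<Rightarrow> (quat ^ 'n) set" where
  "even_span e k = {v. \<exists>q. v = (\<Sum>i<k. rsc (e (2 * i)) (q i))}"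

lemma hsubspace_even_span: "hsubspace (even_span e k)"
  unfolding hsubspace_def even_span_def
proof (intro conjI ballI allI)
  show "0 \<in> {v. \<exists>q. v = (\<Sum>i<k. rsc (e (2 * i)) (q i))}"
    by (auto intro!: exI[of _ "\<lambda>_. 0"])
  fix u v q assume "u \<in> {v. \<exists>q. v = (\<Sum>i<k. rsc (e (2 * i)) (q i))}"
  then obtain a where u: "u = (\<Sum>i<k. rsc (e (2 * i)) (a i))"
    by auto
  show "rsc u q \<in> {v. \<exists>q. v = (\<Sum>i<k. rsc (e (2 * i)) (q i))}"
    by (auto simp: u rsc_sum intro!: exI[of _ "\<lambda>i. a i * q"])
  assume "v \<in> {v. \<exists>q. v = (\<Sum>i<k. rsc (e (2 * i)) (q i))}"
  then obtain b where v: "v = (\<Sum>i<k. rsc (e (2 * i)) (b i))"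
    by auto
  show "u + v \<in> {v. \<exists>q. v = (\<Sum>i<k. rsc (e (2 * i)) (q i))}"
    by (auto simp: u v rsc_add sum.distrib intro!: exI[of _ "\<lambda>i. a i + b i"])
qed

lemma even_span_base: "i < k \<Longrightarrow> e (2 * i) \<in> even_span e k"
  by (auto simp: even_span_def if_distrib cong: if_cong intro!: exI[of _ "\<lambda>j. if j = i then 1 else 0"])

lemma even_span_cong: "(\<And>i. i < k \<Longrightarrow> e (2 * i) = e' (2 * i)) \<Longrightarrow> even_span e k = even_span e' k"
  unfolding even_span_def by (intro Collect_cong arg_cong[where f = Ex] ext arg_cong[where f = "(=) _"] sum.cong) auto

lemma wsys_even_odd:
  assumes w: "wsys m N \<sigma> e" and ij: "i < m" "j < m"
  shows "form (e (2 * i)) (e (2 * j)) = 0"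
    and "form (e (Suc (2 * i))) (e (2 * j)) = (if i = j then 1 else 0)"
proof -
  have *: "2 * i < 2 * m" "Suc (2 * i) < 2 * m" "2 * j < 2 * m"
    using ij by auto
  then have "2 * i < N" "Suc (2 * i) < N" "2 * j < N"
    using wsysD(1)[OF w] by auto
  then show "form (e (2 * i)) (e (2 * j)) = 0"
    "form (e (Suc (2 * i))) (e (2 * j)) = (if i = j then 1 else 0)"
    using * ij wsysD(2)[OF w *(2)] by (auto simp: wsysD(4)[OF w] tau_def) presburger
qed

lemma even_span_expansion:
  assumes w: "wsys m N \<sigma> e" and k: "k \<le> m" and v: "v \<in> even_span e k"
  shows "v = (\<Sum>i<k. rsc (e (2 * i)) (form (e (Suc (2 * i))) v))"
proof -
  obtain q where q: "v = (\<Sum>i<k. rsc (e (2 * i)) (q i))"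
    using v by (auto simp: even_span_def)
  have "form (e (Suc (2 * i))) v = q i" if "i < k" for i
  proof -
    have "form (e (Suc (2 * i))) v = (\<Sum>j<k. if i = j then q j else 0)"
      unfolding q form_sum form_rsc
      by (intro sum.cong refl) (use that k in \<open>simp add: wsys_even_odd(2)[OF w]\<close>)
    then show ?thesis
      using that by simp
  qed
  then show ?thesis
    by (subst q) (intro sum.cong refl, simp)
qed

lemma isotropic_even_span:
  assumes w: "wsys m N \<sigma> e" and k: "k \<le> m"
  shows "isotropic (even_span e k)"
  using k by (auto simp: isotropic_def even_span_def form_sum wsys_even_odd(1)[OF w] intro!: sum.neutral)

text \<open>Take a longest system of pairs with even vectors in U. A vector of U outside their span
  can be corrected to lie in the complement of all pairs; being isotropic, it has a partner, which
  contradicts maximality.\<close>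

lemma isotropic_eq_even_span:
  assumes U: "hsubspace U" "isotropic U"
  shows "\<exists>k e. wsys k (2 * k) (\<lambda>_. 1) e \<and> U = even_span e k"
proof -
  define P where "P k \<longleftrightarrow> (\<exists>e. wsys k (2 * k) (\<lambda>_. 1) e \<and> (\<forall>i<k. e (2 * i) \<in> U))" for k
  have "P 0"
    by (simp add: P_def wsys_def)
  moreover have bound: "k \<le> CARD('n)" if "P k" for k
    using that wsys_bound by (fastforce simp: P_def)
  ultimately obtain k where k: "P k" "\<And>k'. P k' \<Longrightarrow> k' \<le> k"
    using ex_has_greatest_nat[of P 0 "\<lambda>k. k" "Suc CARD('n)"] by (auto simp: less_Suc_eq_le)
  then obtain e where e: "wsys k (2 * k) (\<lambda>_. 1) e" "\<And>i. i < k \<Longrightarrow> e (2 * i) \<in> U"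
    by (auto simp: P_def)
  have "even_span e k \<subseteq> U"
    using e(2) U(1) by (auto simp: even_span_def hsubspace_def intro!: hsubspace_sum[OF U(1)])
  moreover have "v \<in> even_span e k" if v: "v \<in> U" for v
  proof (rule ccontr)
    assume nv: "v \<notin> even_span e k"
    define u where "u = (\<Sum>i<k. rsc (e (2 * i)) (form (e (Suc (2 * i))) v))"
    have "u \<in> even_span e k"
      by (auto simp: u_def even_span_def)
    then have "v - u \<noteq> 0" "u \<in> U"
      using nv \<open>even_span e k \<subseteq> U\<close> by auto
    then have vu: "v - u \<in> U" "v - u \<noteq> 0"
      using hsubspace_diff[OF U(1) v] by auto
    have "v - u \<in> wcompl (2 * k) e"
      unfolding wcompl_def
    proof (intro CollectI allI impI)
      fix l assume l: "l < 2 * k"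
      show "form (e l) (v - u) = 0"
      proof (cases "even l")
        case True
        then have "e l \<in> U"
          using e(2)[of "l div 2"] l by auto
        then show ?thesis
          using U(2) vu by (auto simp: isotropic_def)
      next
        case False
        then obtain j where j: "l = Suc (2 * j)" "j < k"
          using l by (auto elim!: oddE)
        have "form (e l) u = (\<Sum>i<k. if j = i then form (e (Suc (2 * i))) v else 0)"
          unfolding u_def form_sum form_rsc j(1)
          by (intro sum.cong refl) (use j in \<open>simp add: wsys_even_odd(2)[OF e(1)]\<close>)
        then show ?thesis
          using j by (simp add: form_diff)
      qed
    qed
    moreover have "form (v - u) (v - u) = 0"
      using U(2) vu(1) by (auto simp: isotropic_def)
    ultimately obtain v' where v': "v' \<in> wcompl (2 * k) e" "form (v - u) v' = 1" "form v' v' = 0"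
      using partner_in_wcompl[OF split_family_empty e(1), of "v - u"] vu(2)
      by (auto simp: real_eigenvector_def)
    have "wsys (Suc k) (2 * Suc k) (\<lambda>_. 1) (e(2 * k := v - u, Suc (2 * k) := v'))"
      by (rule wsys_append_pair) fact+
    moreover have "(e(2 * k := v - u, Suc (2 * k) := v')) (2 * i) \<in> U" if "i < Suc k" for i
      using e(2)[of i] that vu(1) by (auto simp: less_Suc_eq)
    ultimately have "P (Suc k)"
      unfolding P_def by blast
    then show False
      using k(2) by fastforce
  qed
  ultimately have "U = even_span e k"
    by blast
  with e(1) show ?thesis
    by blast
qed

end

section \<open>Classification of the abelian inner ideals\<close>

context witt_form
begin

lemma isotropic_frame:
  assumes w: "wsys k (2 * k) (\<lambda>_. 1) e"
  shows "k \<le> p" "\<exists>e'. frame e' \<and> even_span e' k = even_span e k"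
proof -
  have "k \<le> p \<and> (\<exists>e'. frame e' \<and> (\<forall>i<2 * k. e' i = e i) \<and> (\<forall>i<CARD('n). real_eigenvector {} (e' i)))"
    by (rule split_family_frame[OF split_family_empty w]) (simp add: real_eigenvector_def)
  then obtain e' where e': "k \<le> p" "frame e'" "\<forall>i<2 * k. e' i = e i"
    by blast
  have "even_span e' k = even_span e k"
    by (rule even_span_cong) (use e'(3) in simp)
  with e' show "k \<le> p" "\<exists>e'. frame e' \<and> even_span e' k = even_span e k"
    by blast+
qed

text \<open>The sum over the vectors dual to e, so that it takes \<open>e k\<close> to
  \<open>e' k\<close>. Any two frames have the same Gram matrix, which makes it an isometry.\<close>

definition frame_map :: "(nat \<Rightarrow> quat ^ 'n) \<Rightarrow> (nat \<Rightarrow> quat ^ 'n) \<Rightarrow> 'n qmat" where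
  "frame_map e e' = (\<Sum>k<CARD('n). outer (e' k) (of_real (fsign k)) (e (tau p k)))"

lemma frame_map_mv: "frame_map e e' *v v = (\<Sum>k<CARD('n). rsc (e' k) (fsign k *\<^sub>R form (e (tau p k)) v))"
  by (simp add: frame_map_def mv_sum_left of_real_def)

lemma frame_map_frame:
  assumes e: "frame e" and l: "l < CARD('n)"
  shows "frame_map e e' *v e l = e' l"
proof -
  have "frame_map e e' *v e l = (\<Sum>k<CARD('n). if k = l then e' k else 0)"
    unfolding frame_map_mv
    by (intro sum.cong refl) (use frame_form[OF e _ l] in \<open>auto simp: of_real_def\<close>)
  then show ?thesis
    using l by simp
qed

lemma frame_map_inverse:
  assumes e: "frame e" and e': "frame e'"
  shows "frame_map e' e *v (frame_map e e' *v v) = v"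
proof -
  have "frame_map e' e *v (frame_map e e' *v v)
      = (\<Sum>k<CARD('n). rsc (frame_map e' e *v e' k) (fsign k *\<^sub>R form (e (tau p k)) v))"
    by (simp add: frame_map_mv[of e e'] mv_sum_right mv_rsc)
  also have "\<dots> = (\<Sum>k<CARD('n). rsc (e k) (fsign k *\<^sub>R form (e (tau p k)) v))"
    by (intro sum.cong refl) (simp add: frame_map_frame[OF e'])
  also have "\<dots> = v"
    by (rule frame_expansion[OF e, symmetric])
  finally show ?thesis .
qed

lemma frame_map_isometry:
  assumes e: "frame e" and e': "frame e'"
  shows "form (frame_map e e' *v u) (frame_map e e' *v v) = form u v"
proof -
  define a where "a u k = fsign k *\<^sub>R form (e (tau p k)) u" for u k
  have *: "form (\<Sum>k<CARD('n). rsc (f k) (a u k)) (\<Sum>k<CARD('n). rsc (f k) (a v k))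
      = (\<Sum>l<CARD('n). \<Sum>k<CARD('n). qcnj (a u k) * (if l = tau p k then of_real (fsign k) else 0) * a v l)"
    if "frame f" for f
    unfolding form_sum form_rsc sum_distrib_right
    by (intro sum.cong refl) (use frame_form[OF that] in auto)
  have "form (frame_map e e' *v u) (frame_map e e' *v v)
      = form (\<Sum>k<CARD('n). rsc (e' k) (a u k)) (\<Sum>k<CARD('n). rsc (e' k) (a v k))"
    by (simp add: frame_map_mv a_def)
  also have "\<dots> = form (\<Sum>k<CARD('n). rsc (e k) (a u k)) (\<Sum>k<CARD('n). rsc (e k) (a v k))"
    by (simp only: *[OF e] *[OF e'])
  also have "\<dots> = form u v"
    by (simp only: a_def flip: frame_expansion[OF e])
  finally show ?thesis .
qed

lemma even_span_image:
  assumes e: "frame e" and k: "k \<le> p"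
  shows "(*v) (frame_map e e') ` even_span e k = even_span e' k"
proof -
  have *: "frame_map e e' *v (\<Sum>i<k. rsc (e (2 * i)) (q i)) = (\<Sum>i<k. rsc (e' (2 * i)) (q i))" for q
    unfolding mv_sum_right mv_rsc
    by (intro sum.cong refl) (use k two_p_le in \<open>simp add: frame_map_frame[OF e]\<close>)
  show ?thesis
    by (auto simp: even_span_def * image_iff) (metis *)
qed

lemma ideal_even_span_conjugate:
  assumes e: "frame e" "frame e'" and k: "k \<le> p"
  shows "conjugate (ideal_of (even_span e k)) (ideal_of (even_span e' k))"
proof -
  let ?T = "frame_map e e'" and ?T' = "frame_map e' e"
  have inv: "?T *v (?T' *v v) = v" "?T' *v (?T *v v) = v" for v
    using e by (simp_all add: frame_map_inverse)
  show ?thesis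
    using isometry_automorphism[OF inv frame_map_isometry[OF e]] even_span_image[OF e(1) k]
    unfolding conjugate_def by metis
qed

text \<open>The expansion of an element of \<open>ideal_of (core B)\<close> only uses
  \<open>skew_outer\<close> of core vectors, and these lie in B; the other inclusion is
  \<open>inner_ideal_image\<close>.\<close>

theorem abelian_inner_ideal_classification:
  assumes "inner_ideal B" "abelian B"
  shows "\<exists>e k. frame e \<and> k \<le> p \<and> B = ideal_of (even_span e k)"
proof -
  obtain k e where e: "wsys k (2 * k) (\<lambda>_. 1) e" "core B = even_span e k"
    using isotropic_eq_even_span[OF hsubspace_core[OF assms] isotropic_core[OF assms]] by blast
  have sub: "subspace B"
    using assms by (simp add: inner_ideal_def)
  have "ideal_of (core B) \<subseteq> B"
  proof
    fix x assume x: "x \<in> ideal_of (core B)"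
    have "x = (1 / 2) *\<^sub>R (\<Sum>i<k. \<Sum>j<k. skew_outer (e (2 * i))
        (form (e (Suc (2 * i))) (x *v e (Suc (2 * j)))) (e (2 * j)))"
      by (rule ideal_of_expansion[OF x]) (use even_span_expansion[OF e(1)] e(2) in auto)
    also have "\<dots> \<in> B"
      by (intro subspace_scale[OF sub] subspace_sum[OF sub] skew_outer_in_inner_ideal assms)
        (simp_all add: e(2) even_span_base)
    finally show "x \<in> B" .
  qed
  then have "B = ideal_of (even_span e k)"
    using inner_ideal_subset_ideal_of[OF assms] e(2) by auto
  then show ?thesis
    using isotropic_frame[OF e(1)] by metis
qed

lemma isotropic_frame_span: "frame e \<Longrightarrow> k \<le> p \<Longrightarrow> isotropic (even_span e k)"
  by (rule isotropic_even_span[OF frame_wsys])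

lemma ideal_even_span_psubset:
  assumes e: "frame e" and k: "k < l" "l \<le> p"
  shows "ideal_of (even_span e k) \<subset> ideal_of (even_span e l)"
proof
  have "even_span e k \<subseteq> even_span e l"
    using k even_span_base[of _ l e] hsubspace_even_span[of e l]
    by (auto simp: even_span_def[of e k] hsubspace_def intro!: hsubspace_sum[OF hsubspace_even_span])
  then show "ideal_of (even_span e k) \<subseteq> ideal_of (even_span e l)"
    by (auto simp: ideal_of_def)
  define r where "r = Quat 0 1 0 0"
  have r: "qre r = 0" "r \<noteq> 0"
    by (simp_all add: r_def quat_eq_iff)
  let ?x = "outer (e (2 * k)) r (e (2 * k))"
  have "?x \<in> ideal_of (even_span e l)"
    using k even_span_base[of k l e] hsubspace_even_span[of e l]
    by (auto simp: ideal_of_def outer_self_in_skew r hsubspace_def)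
  moreover have "?x \<notin> ideal_of (even_span e k)"
  proof
    assume x: "?x \<in> ideal_of (even_span e k)"
    have kp: "k < p"
      using k by simp
    have "form (e (Suc (2 * k))) (e (2 * k)) = 1"
      using wsys_even_odd(2)[OF frame_wsys[OF e] kp kp] by simp
    then have "form (e (2 * k)) (e (Suc (2 * k))) = 1"
      using qcnj_form[of "e (Suc (2 * k))" "e (2 * k)"] by simp
    then have "?x *v e (Suc (2 * k)) = rsc (e (2 * k)) r"
      by simp
    then have v: "rsc (e (2 * k)) r \<in> even_span e k"
      using x unfolding ideal_of_def by (metis (mono_tags, lifting) mem_Collect_eq)
    then obtain q where q: "rsc (e (2 * k)) r = (\<Sum>i<k. rsc (e (2 * i)) (q i))"
      by (auto simp: even_span_def)
    have "form (e (Suc (2 * k))) (rsc (e (2 * k)) r) = 0"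
      unfolding q form_sum
      by (intro sum.neutral) (use kp in \<open>simp add: wsys_even_odd(2)[OF frame_wsys[OF e]]\<close>)
    then show False
      using r wsys_even_odd(2)[OF frame_wsys[OF e] kp kp] by simp
  qed
  ultimately show "ideal_of (even_span e k) \<noteq> ideal_of (even_span e l)"
    by blast
qed

lemma subspace_ideal_even_span: "subspace (ideal_of (even_span e k))"
  by (rule subspace_ideal_of[OF hsubspace_even_span])

lemma ideal_of_subset_skew: "ideal_of U \<subseteq> skew"
  by (auto simp: ideal_of_def)

lemma dim_ideal_even_span_less:
  assumes e: "frame e" and k: "k < l" "l \<le> p"
  shows "dim (ideal_of (even_span e k)) < dim (ideal_of (even_span e l))"
proof (rule ccontr)
  note sub = ideal_even_span_psubset[OF assms]
  assume "\<not> ?thesis"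
  then have "ideal_of (even_span e k) = ideal_of (even_span e l)"
    using sub by (intro subspace_dim_equal subspace_ideal_even_span) auto
  with sub show False
    by blast
qed

text \<open>The real dimension is invariant under conjugation and strictly increasing in k; for
  equal k the isometry between the frames conjugates the ideals.\<close>

lemma ideal_even_span_conjugate_iff:
  assumes e: "frame e" "frame e'" and k: "k \<le> p" "l \<le> p"
  shows "conjugate (ideal_of (even_span e k)) (ideal_of (even_span e' l)) \<longleftrightarrow> k = l"
proof
  assume "conjugate (ideal_of (even_span e k)) (ideal_of (even_span e' l))"
  then have "dim (ideal_of (even_span e k)) = dim (ideal_of (even_span e' l))"
    by (intro conjugate_dim_eq subspace_ideal_even_span ideal_of_subset_skew)
  also have "\<dots> = dim (ideal_of (even_span e l))"
    using e k by (intro conjugate_dim_eq subspace_ideal_even_span ideal_of_subset_skew ideal_even_span_conjugate)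
  finally show "k = l"
    using dim_ideal_even_span_less[OF e(1), of k l] dim_ideal_even_span_less[OF e(1), of l k] k
    by (cases k l rule: linorder_cases) auto
next
  assume "k = l"
  then show "conjugate (ideal_of (even_span e k)) (ideal_of (even_span e' l))"
    using ideal_even_span_conjugate[OF e] k by simp
qed

lemma ideal_even_span_0: "ideal_of (even_span e 0) = {0}"
  by (auto simp: ideal_of_def even_span_def skew_def intro: matrix_eqI)

lemma ideal_even_span_nonzero:
  assumes e: "frame e" and k: "k \<in> {1..p}"
  shows "ideal_of (even_span e k) \<in> nonzero_abelian_inner_ideals"
  using ideal_of_inner_ideal[OF hsubspace_even_span isotropic_frame_span[OF e, of k]] k
    ideal_even_span_psubset[OF e, of 0 k] ideal_even_span_0[of e]
  by (auto simp: nonzero_abelian_inner_ideals_def)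

lemma nonzero_abelian_inner_idealE:
  assumes "B \<in> nonzero_abelian_inner_ideals"
  obtains e k where "frame e" "k \<in> {1..p}" "B = ideal_of (even_span e k)"
proof -
  obtain e k where *: "frame e" "k \<le> p" "B = ideal_of (even_span e k)"
    using abelian_inner_ideal_classification[of B] assms by (auto simp: nonzero_abelian_inner_ideals_def)
  then have "k \<noteq> 0"
    using assms ideal_even_span_0 by (auto simp: nonzero_abelian_inner_ideals_def)
  then show ?thesis
    using * by (intro that[of e k]) auto
qed

theorem conjugacy_classes:
  "finite (nonzero_abelian_inner_ideals // conjugacy) \<and> card (nonzero_abelian_inner_ideals // conjugacy) = p"
proof -
  obtain e where e: "frame e"
    using frame_exists by blast
  define I where "I k = ideal_of (even_span e k)" for k
  have cls: "conjugacy `` {B} = conjugacy `` {I k}"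
    if f: "frame f" "k \<in> {1..p}" "B = ideal_of (even_span f k)" for B f k
  proof -
    have "conjugate B (I k)" "conjugate (I k) B"
      using f e by (auto simp: I_def ideal_even_span_conjugate_iff)
    then have "conjugate B X \<longleftrightarrow> conjugate (I k) X" for X
      using conjugate_trans[of B "I k" X] conjugate_trans[of "I k" B X] by blast
    then show ?thesis
      by (simp add: conjugacy_def Image_def)
  qed
  have "nonzero_abelian_inner_ideals // conjugacy = (\<lambda>k. conjugacy `` {I k}) ` {1..p}"
  proof (intro equalityI subsetI)
    fix X assume "X \<in> nonzero_abelian_inner_ideals // conjugacy"
    then obtain B where B: "B \<in> nonzero_abelian_inner_ideals" "X = conjugacy `` {B}"
      by (rule quotientE)
    obtain f k where f: "frame f" "k \<in> {1..p}" "B = ideal_of (even_span f k)"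
      by (rule nonzero_abelian_inner_idealE[OF B(1)])
    show "X \<in> (\<lambda>k. conjugacy `` {I k}) ` {1..p}"
      unfolding B(2) cls[OF f] using f(2) by (rule imageI)
  next
    fix X assume "X \<in> (\<lambda>k. conjugacy `` {I k}) ` {1..p}"
    then obtain k where k: "k \<in> {1..p}" "X = conjugacy `` {I k}"
      by blast
    have "I k \<in> nonzero_abelian_inner_ideals"
      unfolding I_def by (rule ideal_even_span_nonzero[OF e k(1)])
    then show "X \<in> nonzero_abelian_inner_ideals // conjugacy"
      unfolding k(2) by (rule quotientI)
  qed
  moreover have "inj_on (\<lambda>k. conjugacy `` {I k}) {1..p}"
  proof (rule inj_onI)
    fix k l assume kl: "k \<in> {1..p}" "l \<in> {1..p}" "conjugacy `` {I k} = conjugacy `` {I l}"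
    have "I k \<in> conjugacy `` {I k}"
      by (simp add: conjugacy_def conjugate_refl)
    then have "I k \<in> conjugacy `` {I l}"
      unfolding kl(3) .
    then have "conjugate (I l) (I k)"
      by (simp add: conjugacy_def)
    then show "k = l"
      using kl by (simp add: I_def ideal_even_span_conjugate_iff[OF e e])
  qed
  ultimately show ?thesis
    by (simp add: card_image)
qed

text \<open>On a chain of subspaces \<open>dim\<close> is injective, and by conjugacy with the
  ideals of one fixed frame it takes at most p values.\<close>

theorem chain_length:
  assumes "subset.chain nonzero_abelian_inner_ideals C"
  shows "finite C \<and> card C \<le> p"
proof -
  have C: "C \<subseteq> nonzero_abelian_inner_ideals" and chain: "\<And>X Y. X \<in> C \<Longrightarrow> Y \<in> C \<Longrightarrow> X \<subseteq> Y \<or> Y \<subseteq> X"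
    using assms by (auto simp: subset_chain_def)
  obtain e where e: "frame e"
    using frame_exists by blast
  have "dim B \<in> (\<lambda>k. dim (ideal_of (even_span e k))) ` {1..p}" if "B \<in> C" for B
  proof -
    have "B \<in> nonzero_abelian_inner_ideals"
      using C that by blast
    then obtain f k where f: "frame f" "k \<in> {1..p}" "B = ideal_of (even_span f k)"
      by (rule nonzero_abelian_inner_idealE)
    then have "dim B = dim (ideal_of (even_span e k))"
      using e unfolding f(3)
      by (intro conjugate_dim_eq subspace_ideal_even_span ideal_of_subset_skew ideal_even_span_conjugate) auto
    then show ?thesis
      using f by blast
  qed
  then have im: "dim ` C \<subseteq> (\<lambda>k. dim (ideal_of (even_span e k))) ` {1..p}"
    by blast
  have inj: "inj_on dim C"
  proof (rule inj_onI)
    fix X Y assume XY: "X \<in> C" "Y \<in> C" "dim X = dim Y"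
    then have "subspace X" "subspace Y"
      using C by (auto simp: nonzero_abelian_inner_ideals_def inner_ideal_def)
    then show "X = Y"
      using chain[OF XY(1,2)] XY(3) subspace_dim_equal[of X Y] subspace_dim_equal[of Y X] by auto
  qed
  have "finite (dim ` C)"
    using im by (rule finite_subset) simp
  then have "finite C"
    using inj by (rule finite_imageD)
  moreover have "card (dim ` C) \<le> card {1..p}"
    using im by (meson card_image_le card_mono finite_atLeastAtMost finite_imageI le_trans)
  ultimately show ?thesis
    using inj by (simp add: card_image)
qed

end

section \<open>The Killing form\<close>

text \<open>Extending a basis of V to the whole space adds vectors whose coordinates in
  \<open>T' v\<close> vanish because T' maps into V. So the trace on V is the trace of T', which is
  then computed in the orthonormal basis.\<close>

lemma trace_on_eq:
  fixes V :: "'a::euclidean_space set"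
  assumes V: "subspace V" and T': "linear T'" "\<And>x. T' x \<in> V" "\<And>v. v \<in> V \<Longrightarrow> T' v = T v"
  shows "trace_on V T = (\<Sum>i\<in>Basis. inner (T' i) i)"
proof -
  define b where "b = (SOME b. b \<subseteq> V \<and> independent b \<and> span b = V)"
  have "\<exists>b. b \<subseteq> V \<and> independent b \<and> span b = V"
    using basis_exists[of V] span_minimal[OF _ V] by (metis subset_antisym)
  then have b: "b \<subseteq> V" "independent b" "span b = V"
    unfolding b_def by (metis (mono_tags, lifting) someI_ex)+
  define c where "c = extend_basis b"
  have c: "b \<subseteq> c" "independent c" "span c = UNIV"
    unfolding c_def using b(2) by (simp_all add: extend_basis_superset independent_extend_basis)
  have fin: "finite c"
    using c(2) by (rule independent_imp_finite)
  have rep: "representation c (T' v) = representation b (T' v)" for v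
    using c b T'(2) by (intro representation_extend) auto
  have "trace_on V T = (\<Sum>v\<in>b. representation b (T v) v)"
    by (simp add: trace_on_def b_def Let_def)
  also have "\<dots> = (\<Sum>v\<in>b. representation c (T' v) v)"
  proof (intro sum.cong refl)
    fix v assume "v \<in> b"
    then have "T v = T' v"
      using b T'(3)[of v] by auto
    then show "representation b (T v) v = representation c (T' v) v"
      by (simp add: rep)
  qed
  also have "\<dots> = (\<Sum>v\<in>c. representation c (T' v) v)"
    using c(1) fin by (intro sum.mono_neutral_left) (auto simp: rep dest: representation_ne_zero)
  also have "\<dots> = (\<Sum>v\<in>c. \<Sum>i\<in>Basis. inner (T' v) i * representation c i v)"
  proof (intro sum.cong refl)
    fix v
    have "representation c (T' v) = representation c (\<Sum>i\<in>Basis. inner (T' v) i *\<^sub>R i)"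
      by (simp only: euclidean_representation)
    also have "\<dots> = (\<lambda>w. \<Sum>i\<in>Basis. inner (T' v) i * representation c i w)"
      using c by (subst representation_sum) (auto simp: representation_scale)
    finally show "representation c (T' v) v = (\<Sum>i\<in>Basis. inner (T' v) i * representation c i v)"
      by simp
  qed
  also have "\<dots> = (\<Sum>i\<in>Basis. \<Sum>v\<in>c. inner (T' v) i * representation c i v)"
    by (rule sum.swap)
  also have "\<dots> = (\<Sum>i\<in>Basis. inner (T' i) i)"
  proof (intro sum.cong refl)
    fix i :: 'a
    have "T' i = T' (\<Sum>v\<in>c. representation c i v *\<^sub>R v)"
      using c fin by (subst sum_representation_eq) auto
    also have "\<dots> = (\<Sum>v\<in>c. representation c i v *\<^sub>R T' v)"
      by (simp add: linear_sum[OF T'(1)] linear_scale[OF T'(1)])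
    finally have "inner (T' i) i = inner (\<Sum>v\<in>c. representation c i v *\<^sub>R T' v) i"
      by simp
    then show "(\<Sum>v\<in>c. inner (T' v) i * representation c i v) = inner (T' i) i"
      by (simp add: inner_sum_left mult.commute)
  qed
  finally show ?thesis .
qed

lemma matrix_mult_elementary:
  "(a ** axis i (axis j u) ** c) $ k $ l = a $ k $ i * u * c $ j $ l" for a c :: "quat ^ 'n ^ 'n"
proof -
  have "(a ** axis i (axis j u)) $ k $ m = (if m = j then a $ k $ i * u else 0)" for m
    by (auto simp: matrix_matrix_mult_def axis_def if_distrib[of "\<lambda>t. t $ _"] if_distrib[of "\<lambda>t. _ * t"] cong: if_cong)
  then have "(a ** axis i (axis j u) ** c) $ k $ l = (\<Sum>m\<in>UNIV. (if m = j then a $ k $ i * u else 0) * c $ m $ l)"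
    by (simp only: matrix_matrix_mult_def vec_lambda_beta)
  also have "\<dots> = a $ k $ i * u * c $ j $ l"
    by (simp add: if_distrib[of "\<lambda>t. t * _"] cong: if_cong)
  finally show ?thesis .
qed

text \<open>On the quaternions themselves the map taking u to a u c has real trace 4 Re a Re
  c.\<close>

lemma trace_left_right_mult:
  "(\<Sum>b\<in>Basis. inner (a ** b ** c) b) = 4 * retr a * retr c" for a c :: "quat ^ 'n ^ 'n"
proof -
  have "(\<Sum>b\<in>Basis. inner (a ** b ** c) b)
      = (\<Sum>i\<in>UNIV. \<Sum>j\<in>UNIV. 4 * qre (a $ i $ i) * qre (c $ j $ j))"
    unfolding sum_Basis_matrix inner_axis matrix_mult_elementary
    by (intro sum.cong refl) (simp add: sum_Basis_quat inner_quat_def algebra_simps)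
  also have "\<dots> = 4 * (\<Sum>i\<in>UNIV. \<Sum>j\<in>UNIV. qre (a $ i $ i) * qre (c $ j $ j))"
    by (simp add: sum_distrib_left mult.assoc)
  also have "\<dots> = 4 * retr a * retr c"
    by (simp only: retr_def sum_product mult.assoc)
  finally show ?thesis .
qed

text \<open>Gram-Schmidt for a form that is anisotropic but not assumed symmetric, so orthogonality
  is kept on one side throughout. It is applied to \<open>kform\<close>.\<close>

lemma orthogonal_vector_exists:
  fixes B :: "'a::euclidean_space \<Rightarrow> 'a \<Rightarrow> real"
  assumes G: "subspace G"
    and B: "\<And>x y z. x \<in> G \<Longrightarrow> y \<in> G \<Longrightarrow> z \<in> G \<Longrightarrow> B (x + y) z = B x z + B y z"
      "\<And>x y z. x \<in> G \<Longrightarrow> y \<in> G \<Longrightarrow> z \<in> G \<Longrightarrow> B x (y + z) = B x y + B x z"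
      "\<And>r x y. x \<in> G \<Longrightarrow> y \<in> G \<Longrightarrow> B (r *\<^sub>R x) y = r * B x y"
      "\<And>r x y. x \<in> G \<Longrightarrow> y \<in> G \<Longrightarrow> B x (r *\<^sub>R y) = r * B x y"
      "\<And>x. x \<in> G \<Longrightarrow> x \<noteq> 0 \<Longrightarrow> B x x \<noteq> 0"
    and K: "subspace K" "K \<subset> G"
  shows "\<exists>b\<in>G. b \<notin> K \<and> (\<forall>k\<in>K. B k b = 0)"
proof -
  have proj: "\<exists>k\<in>span S. \<forall>y\<in>span S. B y (e - k) = 0" if "finite S" "S \<subseteq> G" "e \<in> G" for S e
    using that
  proof (induction S arbitrary: e rule: finite_induct)
    case empty
    have "B (0 *\<^sub>R e) e = 0 * B e e"
      using empty by (intro B)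
    then show ?case
      by simp
  next
    case (insert a S)
    have span_G: "x \<in> span S \<Longrightarrow> x \<in> G" for x
      using insert.prems span_minimal[OF _ G, of S] by auto
    note cl = subspace_add[OF G] subspace_diff[OF G] subspace_scale[OF G]
    obtain ke where ke: "ke \<in> span S" "\<And>y. y \<in> span S \<Longrightarrow> B y (e - ke) = 0"
      using insert.IH[of e] insert.prems by blast
    obtain ka where ka: "ka \<in> span S" "\<And>y. y \<in> span S \<Longrightarrow> B y (a - ka) = 0"
      using insert.IH[of a] insert.prems by blast
    have G1: "a - ka \<in> G" "e - ke \<in> G" "ka \<in> G" "ke \<in> G" "a \<in> G"
      using insert.prems span_G ke ka by (auto intro: cl)
    have sub: "span S \<subseteq> span (insert a S)" "a \<in> span (insert a S)"
      by (auto intro: span_mono[THEN subsetD] span_base)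
    \<comment> \<open>If \<open>a - ka\<close> is zero the quotient is 0 by convention, which is
      still correct since both sides of the next equation vanish.\<close>
    define t where "t = B (a - ka) (e - ke) / B (a - ka) (a - ka)"
    have t: "B (a - ka) (e - ke) = t * B (a - ka) (a - ka)"
    proof (cases "a - ka = 0")
      case True
      have "B (0 *\<^sub>R (e - ke)) (e - ke) = 0 * B (e - ke) (e - ke)"
        by (rule B) fact+
      moreover have "B (0 *\<^sub>R a) 0 = 0 * B a 0"
        using subspace_0[OF G] by (intro B G1)
      ultimately show ?thesis
        using True by simp
    next
      case False
      then show ?thesis
        using B(5)[OF G1(1)] by (simp add: t_def)
    qed
    have "B y (e - (ke + t *\<^sub>R (a - ka))) = 0" if yin: "y \<in> span (insert a S)" for y
    proof -
      obtain c where "y - c *\<^sub>R a \<in> span S"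
        using yin span_breakdown_eq by blast
      then have z: "y - c *\<^sub>R a + c *\<^sub>R ka \<in> span S"
        using ka by (intro span_add span_scale)
      define z where "z = y - c *\<^sub>R a + c *\<^sub>R ka"
      have y: "y = c *\<^sub>R (a - ka) + z"
        by (simp add: z_def algebra_simps)
      have zG: "z \<in> G" "z \<in> span S"
        using z span_G by (auto simp: z_def)
      have eq: "e - (ke + t *\<^sub>R (a - ka)) = (e - ke) + (- t) *\<^sub>R (a - ka)"
        by simp
      have "B x ((e - ke) + (- t) *\<^sub>R (a - ka)) = B x (e - ke) - t * B x (a - ka)" if "x \<in> G" for x
      proof -
        have "B x ((e - ke) + (- t) *\<^sub>R (a - ka)) = B x (e - ke) + B x ((- t) *\<^sub>R (a - ka))"
          by (rule B(2)[OF that G1(2) subspace_scale[OF G G1(1)]])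
        also have "B x ((- t) *\<^sub>R (a - ka)) = (- t) * B x (a - ka)"
          using that G1 by (intro B)
        finally show ?thesis
          by simp
      qed
      note 1 = this
      have tG: "(e - ke) + (- t) *\<^sub>R (a - ka) \<in> G"
        by (rule subspace_add[OF G G1(2) subspace_scale[OF G G1(1)]])
      have cG: "c *\<^sub>R (a - ka) \<in> G"
        by (rule subspace_scale[OF G G1(1)])
      have "B y ((e - ke) + (- t) *\<^sub>R (a - ka))
          = B (c *\<^sub>R (a - ka)) ((e - ke) + (- t) *\<^sub>R (a - ka)) + B z ((e - ke) + (- t) *\<^sub>R (a - ka))"
        unfolding y by (rule B(1)[OF cG zG(1) tG])
      also have "B (c *\<^sub>R (a - ka)) ((e - ke) + (- t) *\<^sub>R (a - ka)) = c * B (a - ka) ((e - ke) + (- t) *\<^sub>R (a - ka))"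
        by (rule B(3)[OF G1(1) tG])
      finally show ?thesis
        using 1[OF G1(1)] 1[OF zG(1)] ke(2)[OF zG(2)] ka(2)[OF zG(2)] t unfolding eq by simp
    qed
    moreover have "ke + t *\<^sub>R (a - ka) \<in> span (insert a S)"
      using ke ka sub by (intro span_add span_scale span_diff) auto
    ultimately show ?case
      by blast
  qed
  obtain e where e: "e \<in> G" "e \<notin> K"
    using K(2) by blast
  obtain S where S: "S \<subseteq> K" "independent S" "K \<subseteq> span S" "card S = dim K"
    by (rule basis_exists)
  have "span S = K"
    using S K(1) span_minimal[of S K] by auto
  moreover have "finite S"
    using S(2) by (rule independent_imp_finite)
  ultimately obtain k where k: "k \<in> K" "\<And>y. y \<in> K \<Longrightarrow> B y (e - k) = 0"
    using proj[of S e] e S(1) K by blast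
  have "e - k \<in> G"
    using e k K by (intro subspace_diff[OF G]) auto
  moreover have "e - k \<notin> K"
  proof
    assume "e - k \<in> K"
    then have "(e - k) + k \<in> K"
      using k(1) by (rule subspace_add[OF K(1)])
    then show False
      using e by simp
  qed
  ultimately show ?thesis
    using k by blast
qed

context quat_form
begin

definition dag :: "'n qmat \<Rightarrow> 'n qmat" where
  "dag x = (\<chi> i j. (s i * s j) *\<^sub>R qcnj (x $ j $ i))"

lemma form_dag: "form (x *v u) v = form u (dag x *v v)"
proof -
  have "form (x *v u) v = (\<Sum>i\<in>UNIV. \<Sum>j\<in>UNIV. s i *\<^sub>R (qcnj (u $ j) * qcnj (x $ i $ j) * v $ i))"
    by (simp add: form_def matrix_vector_mult_def qcnj_sum sum_distrib_right scaleR_sum_right)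
  also have "\<dots> = (\<Sum>j\<in>UNIV. \<Sum>i\<in>UNIV. (s j * (s j * s i)) *\<^sub>R (qcnj (u $ j) * qcnj (x $ i $ j) * v $ i))"
    by (subst sum.swap) (simp flip: mult.assoc)
  also have "\<dots> = form u (dag x *v v)"
    by (simp add: form_def dag_def matrix_vector_mult_def sum_distrib_left scaleR_sum_right mult.assoc)
  finally show ?thesis .
qed

lemma vec_eq_formI: "v = w" if "\<And>u. form u v = form u w"
  using form_nondegenerate[of "v - w"] that by (simp add: form_diff)

lemma dag_eqI: "dag x = y" if "\<And>u v. form (x *v u) v = form u (y *v v)"
  by (rule matrix_eqI, rule vec_eq_formI) (simp add: that flip: form_dag)

lemma dag_simps:
  "dag (x + y) = dag x + dag y" "dag (x - y) = dag x - dag y" "dag (r *\<^sub>R x) = r *\<^sub>R dag x"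
  "dag (x ** y) = dag y ** dag x" "dag (mat 1) = mat 1" "dag (- x) = - dag x"
  by (rule dag_eqI, simp add: mv_simps form_add form_diff form_scaleR form_dag)+

lemma dag_dag: "dag (dag x) = x"
  by (simp add: dag_def vec_eq_iff ac_simps)

lemma skew_iff_dag: "x \<in> skew \<longleftrightarrow> dag x = - x"
proof
  assume "x \<in> skew"
  then show "dag x = - x"
    by (intro dag_eqI) (simp add: skewD mv_simps)
qed (simp add: skew_def form_dag mv_simps)

lemma retr_dag: "retr (dag x) = retr x"
  by (simp add: retr_def dag_def)

lemma retr_skew: "x \<in> skew \<Longrightarrow> retr x = 0"
  using retr_dag[of x] by (simp add: skew_iff_dag retr_simps)

text \<open>On the quaternions the map taking u to a times the conjugate of u times c has trace -2
  Re of the conjugate of a times c (for conjugation itself: 1 - 3). As \<open>dag\<close> exchanges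
  the indices, the trace of a product appears instead of a product of traces.\<close>

lemma trace_dag_mult: "(\<Sum>b\<in>Basis. inner (a ** dag b ** c) b) = - 2 * retr (dag a ** c)"
proof -
  have dag: "dag (axis i (axis j u)) = axis j (axis i ((s i * s j) *\<^sub>R qcnj u))" for i j u
    by (auto simp: vec_eq_iff dag_def axis_def mult.commute)
  have "(\<Sum>b\<in>Basis. inner (a ** dag b ** c) b)
      = (\<Sum>i\<in>UNIV. \<Sum>j\<in>UNIV. - 2 * qre (((s j * s i) *\<^sub>R qcnj (a $ i $ j)) * c $ i $ j))"
    unfolding sum_Basis_matrix dag inner_axis matrix_mult_elementary
    by (intro sum.cong refl) (simp add: sum_Basis_quat inner_quat_def algebra_simps)
  also have "\<dots> = (\<Sum>j\<in>UNIV. \<Sum>i\<in>UNIV. - 2 * qre (((s j * s i) *\<^sub>R qcnj (a $ i $ j)) * c $ i $ j))"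
    by (rule sum.swap)
  also have "\<dots> = - 2 * retr (dag a ** c)"
    by (simp only: retr_def dag_def matrix_matrix_mult_def vec_lambda_beta qre_sum sum_distrib_left)
  finally show ?thesis .
qed

text \<open>Half of z minus \<open>dag z\<close> projects onto \<open>skew\<close>, so the trace is
  computed on all matrices after this projection. In the constant, \<open>CARD('n)\<close> comes
  from the terms with z and the 1 from those with \<open>dag z\<close>; products of single traces
  vanish because skew elements have real trace 0.\<close>

lemma killing_eq:
  assumes x: "x \<in> skew" and y: "y \<in> skew"
  shows "killing x y = 4 * (real CARD('n) + 1) * retr (x ** y)"
proof -
  define P where "P z = (1 / 2) *\<^sub>R (z - dag z)" for z
  define T' where "T' z = commutator x (commutator y (P z))" for z
  have P: "P z \<in> skew" for z
    by (simp add: P_def skew_iff_dag dag_simps dag_dag algebra_simps)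
  have P_id: "P z = z" if "z \<in> skew" for z
    using that by (simp add: P_def skew_iff_dag flip: scaleR_2)
  have "killing x y = (\<Sum>b\<in>Basis. inner (T' b) b)"
    unfolding killing_def
  proof (rule trace_on_eq)
    show "linear T'"
      by (rule linearI) (simp_all add: T'_def P_def dag_simps commutator_simps algebra_simps)
    show "T' z \<in> skew" for z
      by (simp add: T'_def commutator_in_skew P x y)
  qed (simp_all add: subspace_skew T'_def P_id)
  also have "\<dots> = (\<Sum>b\<in>Basis. (1 / 2) * (
        (inner ((x ** y) ** b ** mat 1) b - inner (x ** b ** y) b - inner (y ** b ** x) b + inner (mat 1 ** b ** (y ** x)) b)
      - (inner ((x ** y) ** dag b ** mat 1) b - inner (x ** dag b ** y) b - inner (y ** dag b ** x) b + inner (mat 1 ** dag b ** (y ** x)) b)))"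
  proof (intro sum.cong refl)
    fix b
    have "T' b = (1 / 2) *\<^sub>R (
        ((x ** y) ** b ** mat 1 - x ** b ** y - y ** b ** x + mat 1 ** b ** (y ** x))
      - ((x ** y) ** dag b ** mat 1 - x ** dag b ** y - y ** dag b ** x + mat 1 ** dag b ** (y ** x)))"
      by (rule matrix_eqI) (simp add: T'_def P_def commutator_mv mv_simps algebra_simps)
    then show "inner (T' b) b = (1 / 2) * (
        (inner ((x ** y) ** b ** mat 1) b - inner (x ** b ** y) b - inner (y ** b ** x) b + inner (mat 1 ** b ** (y ** x)) b)
      - (inner ((x ** y) ** dag b ** mat 1) b - inner (x ** dag b ** y) b - inner (y ** dag b ** x) b + inner (mat 1 ** dag b ** (y ** x)) b))"
      by (simp only: inner_scaleR_left inner_diff_left inner_add_left)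
  qed
  also have "\<dots> = (1 / 2) * (
        (4 * retr (x ** y) * retr (mat 1 :: 'n qmat) - 4 * retr x * retr y - 4 * retr y * retr x
          + 4 * retr (mat 1 :: 'n qmat) * retr (y ** x))
      - (- 2 * retr (dag (x ** y) ** mat 1) - (- 2 * retr (dag x ** y)) - (- 2 * retr (dag y ** x))
          + (- 2 * retr (dag (mat 1) ** (y ** x)))))"
    by (simp only: sum_distrib_left[symmetric] sum_subtractf sum.distrib trace_left_right_mult trace_dag_mult)
  also have "\<dots> = 4 * (real CARD('n) + 1) * retr (x ** y)"
  proof -
    have d: "dag x = - x" "dag y = - y"
      using x y by (simp_all add: skew_iff_dag)
    have m: "- x ** y = - (x ** y)" "- y ** x = - (y ** x)" "- y ** - x = y ** x"
      by (rule matrix_eqI, simp add: mv_simps)+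
    have "retr (mat 1 :: 'n qmat) = CARD('n)"
      by (simp add: retr_def mat_def)
    moreover have "retr (y ** x) = retr (x ** y)"
      by (rule retr_mult_commute)
    ultimately show ?thesis
      by (simp add: retr_skew[OF x] retr_skew[OF y] d dag_simps m retr_simps algebra_simps)
  qed
  finally show ?thesis .
qed

lemma killing_add:
  assumes "x \<in> skew" "y \<in> skew" "z \<in> skew"
  shows "killing (x + y) z = killing x z + killing y z" "killing z (x + y) = killing z x + killing z y"
proof -
  have m: "(x + y) ** z = x ** z + y ** z" "z ** (x + y) = z ** x + z ** y"
    by (rule matrix_eqI, simp add: mv_simps)+
  show "killing (x + y) z = killing x z + killing y z" "killing z (x + y) = killing z x + killing z y"
    using assms by (simp_all add: killing_eq subspace_add subspace_skew m retr_simps algebra_simps)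
qed

lemma killing_scale:
  assumes "x \<in> skew" "y \<in> skew"
  shows "killing (r *\<^sub>R x) y = r * killing x y" "killing x (r *\<^sub>R y) = r * killing x y"
proof -
  have m: "(r *\<^sub>R x) ** y = r *\<^sub>R (x ** y)" "x ** (r *\<^sub>R y) = r *\<^sub>R (x ** y)"
    by (rule matrix_eqI, simp add: mv_simps)+
  show "killing (r *\<^sub>R x) y = r * killing x y" "killing x (r *\<^sub>R y) = r * killing x y"
    using assms by (simp_all add: killing_eq subspace_scale subspace_skew m retr_simps)
qed

lemma killing_invariant:
  assumes "x \<in> skew" "y \<in> skew" "z \<in> skew"
  shows "killing (commutator x y) z = - killing y (commutator x z)"
proof -
  have m: "commutator x y ** z = x ** (y ** z) - (y ** x) ** z"
    "y ** commutator x z = (y ** x) ** z - (y ** z) ** x"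
    by (rule matrix_eqI, simp add: mv_simps commutator_mv)+
  have "retr (x ** (y ** z)) = retr ((y ** z) ** x)"
    by (rule retr_mult_commute)
  then show ?thesis
    using assms by (simp add: killing_eq commutator_in_skew m retr_simps algebra_simps)
qed

section \<open>Maximal split abelian subspaces\<close>

context
  fixes A \<theta>
  assumes A: "A \<subseteq> skew" "\<And>x y. x \<in> A \<Longrightarrow> y \<in> A \<Longrightarrow> commutator x y = 0"
    and \<theta>: "cartan_involution \<theta>" "\<And>x. x \<in> A \<Longrightarrow> \<theta> x = - x"
begin

definition kform :: "'n qmat \<Rightarrow> 'n qmat \<Rightarrow> real" where
  "kform x y = - killing x (\<theta> y)"

lemma \<theta>_skew: "x \<in> skew \<Longrightarrow> \<theta> x \<in> skew"
  using \<theta> by (auto simp: cartan_involution_def automorphism_def bij_betw_def)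

lemma kform_simps:
  "x \<in> skew \<Longrightarrow> y \<in> skew \<Longrightarrow> z \<in> skew \<Longrightarrow> kform (x + y) z = kform x z + kform y z"
  "x \<in> skew \<Longrightarrow> y \<in> skew \<Longrightarrow> z \<in> skew \<Longrightarrow> kform z (x + y) = kform z x + kform z y"
  "x \<in> skew \<Longrightarrow> y \<in> skew \<Longrightarrow> kform (r *\<^sub>R x) y = r * kform x y"
  "x \<in> skew \<Longrightarrow> y \<in> skew \<Longrightarrow> kform x (r *\<^sub>R y) = r * kform x y"
  using \<theta>
  by (simp_all add: kform_def killing_add killing_scale \<theta>_skew cartan_involution_def automorphism_def)

lemma kform_pos: "x \<in> skew \<Longrightarrow> x \<noteq> 0 \<Longrightarrow> kform x x > 0"
  using \<theta> by (simp add: kform_def cartan_involution_def)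

text \<open>Invariance of the Killing form gives one sign and \<theta> negating x gives another;
  they cancel.\<close>

lemma kform_selfadjoint:
  assumes x: "x \<in> A" and y: "y \<in> skew" and z: "z \<in> skew"
  shows "kform (commutator x y) z = kform y (commutator x z)"
proof -
  have xs: "x \<in> skew"
    using A x by auto
  have "\<theta> (commutator x z) = commutator (\<theta> x) (\<theta> z)"
    using \<theta> xs z by (simp add: cartan_involution_def automorphism_def)
  also have "\<dots> = - commutator x (\<theta> z)"
    by (simp add: \<theta>(2)[OF x] commutator_simps)
  finally have t: "commutator x (\<theta> z) = (- 1) *\<^sub>R \<theta> (commutator x z)"
    by simp
  have "kform (commutator x y) z = killing y (commutator x (\<theta> z))"
    using xs y z by (simp add: kform_def killing_invariant \<theta>_skew)
  also have "\<dots> = kform y (commutator x z)"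
    unfolding t kform_def using xs y z by (subst killing_scale) (simp_all add: \<theta>_skew commutator_in_skew)
  finally show ?thesis .
qed

text \<open>
  The two elements \<open>v q v\<^sup>*\<close> with \<open>q = j, k\<close> span a plane on which the self-adjoint \<open>ad x\<close> acts as
  multiplication by the complex number \<open>2 z\<close>.
\<close>

lemma split_eigenvalue_real:
  assumes x: "x \<in> A" and v: "x *v v = rsc v (cq z)" "v \<noteq> 0"
  shows "Im z = 0"
proof -
  define b where "b w = outer v (cq w * jq) v" for w
  have b: "b w \<in> skew" for w
    unfolding b_def by (rule outer_self_in_skew) simp
  have b0: "b w \<noteq> 0" if "w \<noteq> 0" for w
  proof
    assume "b w = 0"
    moreover obtain y where "form y v = 1"
      using ex_form_eq[OF v(2)] by blast
    then have "form v y = 1"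
      using qcnj_form[of y v] by simp
    ultimately have "rsc v (cq w * jq) = 0"
      unfolding b_def by (metis mult.right_neutral mv_zero(2) outer_mv)
    then show False
      using that v(2) by simp
  qed
  \<comment> \<open>Both vectors contribute a factor z on the left, since the conjugate from the
    second becomes z on passing \<open>jq\<close>. With a complex coefficient instead, only twice
    the real part of z would appear.\<close>
  have eq: "commutator x (b w) = b (2 * z * w)" for w
  proof -
    have "commutator x (b w) = outer (rsc v (cq z)) (cq w * jq) v + outer v (cq w * jq) (rsc v (cq z))"
      using A x by (simp add: b_def skew_mult_outer subset_iff v)
    also have "\<dots> = b (2 * z * w)"
      by (rule matrix_eqI, simp add: b_def mv_add_left flip: rsc_add(2), rule arg_cong[where f = "rsc v"],
          simp add: quat_eq_iff algebra_simps)
    finally show ?thesis .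
  qed
  have "b w = Re w *\<^sub>R b 1 + Im w *\<^sub>R b \<i>" for w
    by (rule matrix_eqI) (simp add: b_def mv_add_left mv_scaleR_left, simp add: vec_eq_iff quat_eq_iff algebra_simps)
  from this[of "2 * z"] this[of "2 * z * \<i>"]
  have lin: "b (2 * z) = (2 * Re z) *\<^sub>R b 1 + (2 * Im z) *\<^sub>R b \<i>"
    "b (2 * z * \<i>) = (2 * Re z) *\<^sub>R b \<i> + (- 2 * Im z) *\<^sub>R b 1"
    by simp_all
  have "kform (commutator x (b 1)) (b \<i>) = kform (b 1) (commutator x (b \<i>))"
    by (rule kform_selfadjoint) (use x b in auto)
  then have "kform (b (2 * z)) (b \<i>) = kform (b 1) (b (2 * z * \<i>))"
    by (simp only: eq mult_1_right)
  then have "(2 * Re z) * kform (b 1) (b \<i>) + (2 * Im z) * kform (b \<i>) (b \<i>)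
      = (2 * Re z) * kform (b 1) (b \<i>) + (- 2 * Im z) * kform (b 1) (b 1)"
    unfolding lin by (simp only: kform_simps b subspace_scale[OF subspace_skew b])
  then have "2 * Im z * (kform (b \<i>) (b \<i>) + kform (b 1) (b 1)) = 0"
    by (simp add: algebra_simps)
  moreover have "kform (b \<i>) (b \<i>) + kform (b 1) (b 1) > 0"
    by (intro add_pos_pos kform_pos b b0) simp_all
  ultimately show ?thesis
    by simp
qed

text \<open>
  On the orthogonal complement of \<open>{b. form v (b v) = 0}\<close>, which is invariant under \<open>ad A\<close>, the element
  \<open>x\<close> acts by minus twice its weight on \<open>v\<close>; any such \<open>b\<close> sends \<open>v\<close> to a partner.
\<close>

lemma split_partner:
  assumes v: "real_eigenvector A v" "v \<noteq> 0" "form v v = 0"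
  shows "\<exists>v'. real_eigenvector A v' \<and> form v v' \<noteq> 0"
proof -
  define K where "K = {b \<in> skew. form v (b *v v) = 0}"
  have K: "subspace K"
    using subspace_skew by (auto simp: K_def subspace_def mv_simps form_add form_scaleR)
  obtain u where u: "form u v = 1"
    using ex_form_eq[OF v(2)] by blast
  then have vu: "form v u = 1"
    using qcnj_form[of u v] by simp
  define r where "r = Quat 0 1 0 0"
  have r: "qre r = 0" "r \<noteq> 0"
    by (simp_all add: r_def quat_eq_iff)
  have "outer u r u \<in> skew" "outer u r u \<notin> K"
    using r u vu by (simp_all add: K_def outer_self_in_skew)
  moreover have "K \<subseteq> skew"
    by (auto simp: K_def)
  ultimately have "K \<subset> skew"
    by blast
  have "\<exists>b\<in>skew. b \<notin> K \<and> (\<forall>k\<in>K. kform k b = 0)"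
    by (rule orthogonal_vector_exists[OF subspace_skew _ _ _ _ _ K \<open>K \<subset> skew\<close>])
      (simp_all add: kform_simps kform_pos less_imp_neq[symmetric] del: less_irrefl)
  then obtain b where b: "b \<in> skew" "b \<notin> K" "\<And>k. k \<in> K \<Longrightarrow> kform k b = 0"
    by blast
  have "real_eigenvector A (b *v v)"
    unfolding real_eigenvector_def
  proof
    fix x assume x: "x \<in> A"
    then have xs: "x \<in> skew"
      using A by auto
    obtain \<mu> where \<mu>: "x *v v = \<mu> *\<^sub>R v"
      using v x by (auto simp: real_eigenvector_def)
    have weight: "form v (commutator x k *v v) = - (2 * \<mu>) *\<^sub>R form v (k *v v)" for k
    proof -
      have "form v (x *v (k *v v)) = - form (x *v v) (k *v v)"
        by (simp add: skewD[OF xs])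
      then show ?thesis
        by (simp add: commutator_mv form_diff \<mu> mv_scaleR_right form_scaleR) (simp add: quat_eq_iff)
    qed
    \<comment> \<open>The weight identity puts c into K, while self-adjointness and invariance of K
      under ad x make it orthogonal to K. Positivity then forces c = 0.\<close>
    define c where "c = commutator x b + (2 * \<mu>) *\<^sub>R b"
    have cs: "c \<in> skew"
      using xs b by (simp add: c_def commutator_in_skew subspace_add subspace_scale subspace_skew)
    have cK: "c \<in> K"
      using cs by (simp add: K_def c_def mv_simps form_add form_scaleR weight)
    have kc: "kform k c = 0" if k: "k \<in> K" for k
    proof -
      have ks: "k \<in> skew"
        using k by (simp add: K_def)
      have "commutator x k \<in> K"
        using k by (simp add: K_def weight commutator_in_skew xs)
      then have "kform k (commutator x b) = 0"
        using kform_selfadjoint[OF x ks b(1)] b(3) by simp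
      then show ?thesis
        using b k ks xs by (simp add: c_def kform_simps commutator_in_skew subspace_scale subspace_skew)
    qed
    have "c = 0"
      using kc[OF cK] kform_pos[OF cs] by (metis less_irrefl)
    then have "c *v v = 0"
      by simp
    then have "x *v (b *v v) + (2 * \<mu> - \<mu>) *\<^sub>R (b *v v) = 0"
      unfolding scaleR_left_diff_distrib by (simp add: c_def commutator_mv mv_simps \<mu> algebra_simps)
    then have "x *v (b *v v) = (- \<mu>) *\<^sub>R (b *v v)"
      by (simp add: eq_neg_iff_add_eq_0)
    then show "\<exists>r. x *v (b *v v) = r *\<^sub>R (b *v v)" ..
  qed
  moreover have "form v (b *v v) \<noteq> 0"
    using b by (simp add: K_def)
  ultimately show ?thesis
    by blast
qed

lemma split_family_split: "split_family A"
  unfolding split_family_def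
proof (intro conjI allI impI)
  fix v assume "joint_eigenvector A v"
  show "real_eigenvector A v"
    unfolding real_eigenvector_def
  proof
    fix x assume x: "x \<in> A"
    show "\<exists>r. x *v v = r *\<^sub>R v"
    proof (cases "v = 0")
      case False
      obtain z where z: "x *v v = rsc v (cq z)"
        using x \<open>joint_eigenvector A v\<close> by (auto simp: joint_eigenvector_def)
      then have "z = of_real (Re z)"
        using split_eigenvalue_real[OF x z False] by (simp add: complex_eq_iff)
      then have "x *v v = Re z *\<^sub>R v"
        using z by (metis cq_simps(8) rsc_of_real)
      then show ?thesis ..
    qed simp
  qed
qed (use A split_partner in auto)

end

end


section \<open>Real diagonal matrices of a frame\<close>

context witt_form
begin

lemma frame_eqI:
  assumes e: "frame e" and eq: "\<And>k. k < CARD('n) \<Longrightarrow> x *v e k = y *v e k"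
  shows "x = y"
proof (rule matrix_eqI)
  fix v
  have exp: "z *v v = (\<Sum>k<CARD('n). rsc (z *v e k) (fsign k *\<^sub>R form (e (tau p k)) v))" for z
    by (subst frame_expansion[OF e, of v]) (simp add: mv_sum_right mv_rsc)
  show "x *v v = y *v v"
    unfolding exp[of x] exp[of y] by (intro sum.cong refl) (simp add: eq)
qed

lemma frame_form_eqI:
  assumes e: "frame e" and eq: "\<And>k. k < CARD('n) \<Longrightarrow> form (e k) v = form (e k) w"
  shows "v = w"
proof -
  have "v - w \<in> wcompl CARD('n) e"
    using eq by (simp add: wcompl_def form_diff)
  then show ?thesis
    using e by (simp add: frame_def)
qed

lemma retr_frame:
  assumes e: "frame e"
  shows "retr x = (\<Sum>k<CARD('n). fsign k * qre (form (e (tau p k)) (x *v e k)))"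
proof -
  have "x = (\<Sum>k<CARD('n). outer (x *v e k) (of_real (fsign k)) (e (tau p k)))"
  proof (rule matrix_eqI)
    fix v
    show "x *v v = (\<Sum>k<CARD('n). outer (x *v e k) (of_real (fsign k)) (e (tau p k))) *v v"
      by (subst frame_expansion[OF e, of v]) (simp add: mv_sum_right mv_sum_left mv_rsc of_real_def)
  qed
  then have "retr x = retr (\<Sum>k<CARD('n). outer (x *v e k) (of_real (fsign k)) (e (tau p k)))"
    by simp
  also have "\<dots> = (\<Sum>k<CARD('n). retr (outer (x *v e k) (of_real (fsign k)) (e (tau p k))))"
  proof -
    have "retr (\<Sum>k\<in>S. f k) = (\<Sum>k\<in>S. retr (f k))" for S :: "nat set" and f
      by (induction S rule: infinite_finite_induct) (simp_all add: retr_simps, simp_all add: retr_def)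
    then show ?thesis .
  qed
  also have "\<dots> = (\<Sum>k<CARD('n). fsign k * qre (form (e (tau p k)) (x *v e k)))"
    by (simp add: retr_outer of_real_def)
  finally show ?thesis .
qed

definition real_diagonal :: "(nat \<Rightarrow> quat ^ 'n) \<Rightarrow> 'n qmat set" where
  "real_diagonal e = {x \<in> skew. \<forall>k<CARD('n). \<exists>t. x *v e k = t *\<^sub>R e k}"

lemma real_diagonalD:
  "x \<in> real_diagonal e \<Longrightarrow> x \<in> skew"
  "x \<in> real_diagonal e \<Longrightarrow> k < CARD('n) \<Longrightarrow> \<exists>t. x *v e k = t *\<^sub>R e k"
  by (simp_all add: real_diagonal_def)

lemma frame_nonzero: "frame e \<Longrightarrow> k < CARD('n) \<Longrightarrow> e k \<noteq> 0"
  using frame_form[of e k "tau p k"] by auto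

lemma diagonal_weights:
  assumes e: "frame e" and x: "x \<in> skew" and k: "k < CARD('n)"
    and z: "x *v e k = rsc (e k) z" "x *v e (tau p k) = rsc (e (tau p k)) z'"
  shows "z' = - qcnj z"
proof -
  have "form (x *v e k) (e (tau p k)) = - form (e k) (x *v e (tau p k))"
    by (rule skewD) fact
  then have "fsign k *\<^sub>R qcnj z = - (fsign k *\<^sub>R z')"
    using frame_form[OF e k, of "tau p k"] k by (simp add: z of_real_def)
  then have "fsign k *\<^sub>R (qcnj z + z') = 0"
    by (simp add: scaleR_add_right del: scaleR_eq_0_iff)
  then show ?thesis
    by (simp add: add_eq_0_iff)
qed

text \<open>J exchanges hyperbolic partners and is -1 on the other frame vectors. It is an isometric
  involution and \<open>form w (J *v w)\<close> is positive definite, so conjugation by J is a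
  Cartan involution; it negates real diagonal matrices because partners have opposite
  weights.\<close>

lemma split_abelian_real_diagonal:
  assumes e: "frame e"
  shows "split_abelian (real_diagonal e)"
proof -
  let ?n = "CARD('n)"
  define f where "f k = fsign k *\<^sub>R e (tau p k)" for k
  have f: "frame f"
  proof -
    have "form (f k) (f l) = (if l = tau p k then of_real (fsign k) else 0)" if "k < ?n" "l < ?n" for k l
      using that frame_form[OF e, of "tau p k" "tau p l"]
      by (auto simp: f_def form_scaleR of_real_def)
    moreover have "w = 0" if "w \<in> wcompl ?n f" for w
    proof (rule frame_form_eqI[OF e])
      fix k assume "k < ?n"
      then have "form (f (tau p k)) w = 0"
        using that by (simp add: wcompl_def)
      then show "form (e k) w = form (e k) 0"
        by (simp add: f_def form_scaleR)
    qed
    ultimately show ?thesis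
      using frame_wsys[OF e] by (auto simp: frame_def wsys_def wcompl_def)
  qed
  define J where "J = frame_map e f"
  have J: "J *v e k = fsign k *\<^sub>R e (tau p k)" if "k < ?n" for k
    using frame_map_frame[OF e that] by (simp add: J_def f_def)
  have "J ** J = mat 1"
    by (rule frame_eqI[OF e]) (simp add: mv_assoc J mv_scaleR_right)
  then have "J *v (J *v v) = v" for v
    by (metis matrix_vector_mul_assoc matrix_vector_mul_lid)
  note JJ = this
  have iso: "form (J *v u) (J *v v) = form u v" for u v
    unfolding J_def by (rule frame_map_isometry[OF e f])
  define \<theta> where "\<theta> x = J ** x ** J" for x
  have aut: "automorphism \<theta>"
    unfolding \<theta>_def by (rule isometry_automorphism) (use JJ iso in auto)
  have pos: "qre (form w (J *v w)) = (\<Sum>k<?n. (norm (form (e (tau p k)) w))\<^sup>2)" for w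
  proof -
    have "J *v w = (\<Sum>k<?n. rsc (e (tau p k)) (form (e (tau p k)) w))"
      by (subst frame_expansion[OF e, of w], unfold mv_sum_right, intro sum.cong refl)
        (simp add: mv_rsc mv_scaleR_right J rsc_scaleR)
    then have "form w (J *v w) = (\<Sum>k<?n. qcnj (form (e (tau p k)) w) * form (e (tau p k)) w)"
      by (simp add: form_sum)
    also have "\<dots> = (\<Sum>k<?n. of_real ((norm (form (e (tau p k)) w))\<^sup>2))"
      by (simp only: qcnj_mult_self)
    finally show ?thesis
      by (simp add: qre_sum of_real_def)
  qed
  have "cartan_involution \<theta>"
    unfolding cartan_involution_def
  proof (intro conjI ballI impI aut)
    fix x assume x: "x \<in> skew"
    show "\<theta> (\<theta> x) = x"
      by (rule matrix_eqI) (simp add: \<theta>_def mv_assoc JJ)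
    assume x0: "x \<noteq> 0"
    have \<theta>x: "\<theta> x \<in> skew"
      using aut x by (auto simp: automorphism_def bij_betw_def)
    define w where "w k = x *v (J *v e k)" for k
    have "retr (x ** \<theta> x) = (\<Sum>k<?n. fsign k * qre (form (e (tau p k)) ((x ** \<theta> x) *v e k)))"
      by (rule retr_frame[OF e])
    also have "\<dots> = (\<Sum>k<?n. qre (form (J *v e k) (x *v (J *v w k))))"
      by (intro sum.cong refl) (simp add: J form_scaleR \<theta>_def mv_assoc w_def)
    \<comment> \<open>Moving the skew-adjoint x across the form leaves minus a value of the positive
      definite form.\<close>
    also have "\<dots> = (\<Sum>k<?n. - qre (form (w k) (J *v w k)))"
    proof (intro sum.cong refl)
      fix k
      have "form (x *v (J *v e k)) (J *v w k) = - form (J *v e k) (x *v (J *v w k))"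
        by (rule skewD[OF x])
      then show "qre (form (J *v e k) (x *v (J *v w k))) = - qre (form (w k) (J *v w k))"
        unfolding w_def by simp
    qed
    finally have r: "retr (x ** \<theta> x) = - (\<Sum>k<?n. qre (form (w k) (J *v w k)))"
      by (simp add: sum_negf)
    have "\<exists>k<?n. w k \<noteq> 0"
    proof (rule ccontr)
      assume *: "\<not> (\<exists>k<?n. w k \<noteq> 0)"
      have "x ** J = 0"
        by (rule frame_eqI[OF e]) (use * in \<open>simp add: mv_assoc w_def\<close>)
      then have "x *v (J *v (J *v v)) = 0" for v
        by (metis mv_assoc mv_zero(2))
      then have "x = 0"
        by (intro matrix_eqI) (simp add: JJ)
      with x0 show False ..
    qed
    then obtain k where k: "k < ?n" "w k \<noteq> 0"
      by blast
    have "qre (form (w k) (J *v w k)) > 0"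
    proof (rule ccontr)
      assume "\<not> ?thesis"
      then have "(\<Sum>l<?n. (norm (form (e (tau p l)) (w k)))\<^sup>2) \<le> 0"
        unfolding pos by simp
      moreover have "(\<Sum>l<?n. (norm (form (e (tau p l)) (w k)))\<^sup>2) \<ge> 0"
        by (intro sum_nonneg) simp
      ultimately have "(\<Sum>l<?n. (norm (form (e (tau p l)) (w k)))\<^sup>2) = 0"
        by linarith
      then have 0: "form (e (tau p l)) (w k) = 0" if "l < ?n" for l
        using that by (simp add: sum_nonneg_eq_0_iff)
      have "w k = 0"
        by (rule frame_form_eqI[OF e]) (use 0[of "tau p _"] in simp)
      with k show False
        by simp
    qed
    moreover have "qre (form (w l) (J *v w l)) \<ge> 0" for l
      unfolding pos by (intro sum_nonneg) simp
    ultimately have "(\<Sum>k<?n. qre (form (w k) (J *v w k))) > 0"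
      using k by (intro sum_pos2[of _ k]) auto
    then show "- killing x (\<theta> x) > 0"
      using x \<theta>x by (simp add: killing_eq r)
  qed
  moreover have "\<theta> x = - x" if x: "x \<in> real_diagonal e" for x
  proof (rule frame_eqI[OF e])
    fix k assume k: "k < ?n"
    obtain t where t: "x *v e k = t *\<^sub>R e k"
      using real_diagonalD(2)[OF x k] by blast
    obtain t' where t': "x *v e (tau p k) = t' *\<^sub>R e (tau p k)"
      using real_diagonalD(2)[OF x, of "tau p k"] k by auto
    have "of_real t' = - qcnj (of_real t)"
      by (rule diagonal_weights[OF e _ k]) (use x t t' in \<open>auto simp: real_diagonal_def rsc_of_real\<close>)
    then have "t' = - t"
      by (simp add: quat_eq_iff of_real_def)
    then show "\<theta> x *v e k = (- x) *v e k"
      using k by (simp add: \<theta>_def mv_assoc J mv_scaleR_right mv_minus_right t t' mv_minus_left)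
  qed
  moreover have "subspace (real_diagonal e)"
  proof (rule subspaceI)
    show "0 \<in> real_diagonal e"
      using subspace_0[OF subspace_skew] by (auto simp: real_diagonal_def intro: exI[of _ 0])
    fix x r assume x: "x \<in> real_diagonal e"
    have "\<exists>t. (r *\<^sub>R x) *v e k = t *\<^sub>R e k" if "k < ?n" for k
      using real_diagonalD(2)[OF x that] by (metis mv_scaleR_left scaleR_scaleR)
    then show "r *\<^sub>R x \<in> real_diagonal e"
      using x subspace_scale[OF subspace_skew] by (simp add: real_diagonal_def)
    fix y assume y: "y \<in> real_diagonal e"
    have "\<exists>t. (x + y) *v e k = t *\<^sub>R e k" if "k < ?n" for k
      using real_diagonalD(2)[OF x that] real_diagonalD(2)[OF y that]
      by (metis mv_add_left scaleR_left_distrib)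
    then show "x + y \<in> real_diagonal e"
      using x y subspace_add[OF subspace_skew] by (simp add: real_diagonal_def)
  qed
  moreover have "abelian (real_diagonal e)"
    unfolding abelian_def
  proof (intro ballI frame_eqI[OF e])
    fix x y k assume *: "x \<in> real_diagonal e" "y \<in> real_diagonal e" and k: "k < ?n"
    obtain t t' where "x *v e k = t *\<^sub>R e k" "y *v e k = t' *\<^sub>R e k"
      using real_diagonalD(2)[OF *(1) k] real_diagonalD(2)[OF *(2) k] by blast
    then show "commutator x y *v e k = 0 *v e k"
      by (simp add: commutator_mv mv_scaleR_right mult.commute)
  qed
  moreover have "killing x x > 0" if x: "x \<in> real_diagonal e" "x \<noteq> 0" for x
  proof -
    have "x \<in> skew"
      using x by (simp add: real_diagonal_def)
    then have "- killing x (\<theta> x) > 0"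
      using \<open>cartan_involution \<theta>\<close> x by (simp add: cartan_involution_def)
    also have "\<theta> x = (- 1) *\<^sub>R x"
      using \<open>\<And>x. x \<in> real_diagonal e \<Longrightarrow> \<theta> x = - x\<close> x by simp
    finally show ?thesis
      using \<open>x \<in> skew\<close> killing_scale(2)[of x x "- 1"] by simp
  qed
  ultimately show ?thesis
    unfolding split_abelian_def by (auto simp: real_diagonal_def)
qed

text \<open>A frame of real eigenvectors embeds a into a real diagonal space, which is itself split
  abelian; maximality gives equality.\<close>

theorem maximal_split_abelian_frame:
  assumes "maximal_split_abelian a"
  shows "\<exists>e. frame e \<and> a = real_diagonal e"
proof -
  have a: "split_abelian a" and max: "\<And>a'. split_abelian a' \<Longrightarrow> a \<subseteq> a' \<Longrightarrow> a' = a"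
    using assms by (auto simp: maximal_split_abelian_def)
  have "split_family a"
    using a unfolding split_abelian_def abelian_def by (blast intro: split_family_split)
  moreover have "wsys 0 (2 * 0) (\<lambda>_. 1) (\<lambda>_. 0)"
    by (simp add: wsys_def)
  ultimately obtain e where e: "frame e" "\<And>k. k < CARD('n) \<Longrightarrow> real_eigenvector a (e k)"
    using split_family_frame[of a 0] by auto
  have "a \<subseteq> real_diagonal e"
    using a e(2) by (auto simp: real_diagonal_def real_eigenvector_def split_abelian_def)
  then have "real_diagonal e = a"
    by (intro max split_abelian_real_diagonal e)
  then show ?thesis
    using e(1) by blast
qed

end

section \<open>The maximal abelian subalgebra\<close>

lemma qcnj_inverse: "qcnj (inverse q) = inverse (qcnj q)"
  by (simp add: inverse_quat_def)

context witt_form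
begin

lemma skew_frameI:
  assumes e: "frame e"
    and x: "\<And>k l. k < CARD('n) \<Longrightarrow> l < CARD('n) \<Longrightarrow> form (x *v e k) (e l) = - form (e k) (x *v e l)"
  shows "x \<in> skew"
proof -
  have 1: "form (x *v e k) v = - form (e k) (x *v v)" if k: "k < CARD('n)" for k v
  proof -
    have "form (x *v e k) v = (\<Sum>l<CARD('n). form (x *v e k) (e l) * (fsign l *\<^sub>R form (e (tau p l)) v))"
      by (subst frame_expansion[OF e, of v]) (simp only: form_sum form_rsc)
    also have "\<dots> = (\<Sum>l<CARD('n). - form (e k) (x *v e l) * (fsign l *\<^sub>R form (e (tau p l)) v))"
      by (intro sum.cong refl) (simp only: x[OF k] lessThan_iff)
    also have "\<dots> = - form (e k) (x *v v)"
      by (subst (2) frame_expansion[OF e, of v]) (simp add: mv_sum_right mv_rsc form_sum sum_negf)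
    finally show ?thesis .
  qed
  show ?thesis
    unfolding skew_def
  proof (intro CollectI allI)
    fix u v
    have "form (x *v u) v = (\<Sum>k<CARD('n). qcnj (fsign k *\<^sub>R form (e (tau p k)) u) * form (x *v e k) v)"
      by (subst frame_expansion[OF e, of u]) (simp only: mv_sum_right mv_rsc form_sum form_rsc)
    also have "\<dots> = (\<Sum>k<CARD('n). - (qcnj (fsign k *\<^sub>R form (e (tau p k)) u) * form (e k) (x *v v)))"
      by (intro sum.cong refl) (simp only: 1 lessThan_iff mult_minus_right)
    also have "\<dots> = - form u (x *v v)"
      by (subst (2) frame_expansion[OF e, of u]) (simp only: form_sum form_rsc sum_negf)
    finally show "form (x *v u) v = - form u (x *v v)" .
  qed
qed

definition diag_matrix :: "(nat \<Rightarrow> quat ^ 'n) \<Rightarrow> (nat \<Rightarrow> complex) \<Rightarrow> 'n qmat" where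
  "diag_matrix e z = (\<Sum>k<CARD('n). outer (e k) (fsign k *\<^sub>R cq (z k)) (e (tau p k)))"

lemma diag_matrix_frame:
  assumes e: "frame e" and l: "l < CARD('n)"
  shows "diag_matrix e z *v e l = rsc (e l) (cq (z l))"
proof -
  have "diag_matrix e z *v e l = (\<Sum>k<CARD('n). if k = l then rsc (e k) (cq (z k)) else 0)"
    unfolding diag_matrix_def mv_sum_left outer_mv
    by (intro sum.cong refl) (use frame_form[OF e _ l] in \<open>auto simp: of_real_def\<close>)
  then show ?thesis
    using l by simp
qed

definition diagonal :: "(nat \<Rightarrow> quat ^ 'n) \<Rightarrow> 'n qmat set" where
  "diagonal e = {x \<in> skew. \<forall>k<CARD('n). \<exists>z. x *v e k = rsc (e k) (cq z)}"

lemma diagonalD: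
  "x \<in> diagonal e \<Longrightarrow> x \<in> skew"
  "x \<in> diagonal e \<Longrightarrow> k < CARD('n) \<Longrightarrow> \<exists>z. x *v e k = rsc (e k) (cq z)"
  by (simp_all add: diagonal_def)

lemma diag_matrix_in_diagonal:
  assumes e: "frame e" and z: "\<And>k. k < CARD('n) \<Longrightarrow> z (tau p k) = - cnj (z k)"
  shows "diag_matrix e z \<in> diagonal e"
proof -
  have "diag_matrix e z \<in> skew"
    by (rule skew_frameI[OF e])
      (use frame_form[OF e] z in \<open>auto simp: diag_matrix_frame[OF e] of_real_def\<close>)
  then show ?thesis
    using diag_matrix_frame[OF e] by (auto simp: diagonal_def)
qed

lemma diag_matrix_in_real_diagonal:
  assumes e: "frame e" and t: "\<And>k. k < CARD('n) \<Longrightarrow> t (tau p k) = - t k"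
  shows "diag_matrix e (\<lambda>k. of_real (t k)) \<in> real_diagonal e"
proof -
  have "diag_matrix e (\<lambda>k. of_real (t k)) \<in> skew"
    using diag_matrix_in_diagonal[OF e, of "\<lambda>k. of_real (t k)"] t diagonalD(1) by auto
  then show ?thesis
    using diag_matrix_frame[OF e, of _ "\<lambda>k. of_real (t k)"] by (auto simp: real_diagonal_def rsc_of_real)
qed

lemma subspace_diagonal: "subspace (diagonal e)"
proof (rule subspaceI)
  show "0 \<in> diagonal e"
    using subspace_0[OF subspace_skew] by (auto simp: diagonal_def intro: exI[of _ 0])
  fix x r assume x: "x \<in> diagonal e"
  have "\<exists>z. (r *\<^sub>R x) *v e k = rsc (e k) (cq z)" if "k < CARD('n)" for k
    using diagonalD(2)[OF x that] by (metis mv_scaleR_left rsc_scaleR(2) cq_simps(10))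
  then show "r *\<^sub>R x \<in> diagonal e"
    using x subspace_scale[OF subspace_skew] by (simp add: diagonal_def)
  fix y assume y: "y \<in> diagonal e"
  have "\<exists>z. (x + y) *v e k = rsc (e k) (cq z)" if "k < CARD('n)" for k
    using diagonalD(2)[OF x that] diagonalD(2)[OF y that]
    by (metis mv_add_left rsc_add(2) cq_simps(3))
  then show "x + y \<in> diagonal e"
    using x y subspace_add[OF subspace_skew] by (simp add: diagonal_def)
qed

lemma abelian_diagonal: "frame e \<Longrightarrow> abelian (diagonal e)"
  unfolding abelian_def
proof (intro ballI)
  fix x y assume e: "frame e" and *: "x \<in> diagonal e" "y \<in> diagonal e"
  show "commutator x y = 0"
  proof (rule frame_eqI[OF e])
    fix k assume k: "k < CARD('n)"
    obtain z z' where "x *v e k = rsc (e k) (cq z)" "y *v e k = rsc (e k) (cq z')"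
      using diagonalD(2)[OF *(1) k] diagonalD(2)[OF *(2) k] by blast
    moreover have "cq z * cq z' = cq z' * cq z"
      by (metis cq_simps(6) mult.commute)
    ultimately show "commutator x y *v e k = 0 *v e k"
      by (simp add: commutator_mv mv_rsc)
  qed
qed

lemma frame_rescale:
  assumes e: "frame e" and q: "\<And>k. k < 2 * p \<Longrightarrow> qcnj (q k) * q (tau p k) = 1"
    "\<And>k. \<not> k < 2 * p \<Longrightarrow> q k = 1"
  shows "frame (\<lambda>k. rsc (e k) (q k))"
proof -
  have "form (rsc (e k) (q k)) (rsc (e l) (q l)) = (if l = tau p k then of_real (fsign k) else 0)"
    if "k < CARD('n)" "l < CARD('n)" for k l
    using frame_form[OF e that] q by (auto simp: fsign_def tau_outside)
  moreover have "q k \<noteq> 0" for k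
    using q[of k] by (cases "k < 2 * p") auto
  then have "w \<in> wcompl CARD('n) e" if "w \<in> wcompl CARD('n) (\<lambda>k. rsc (e k) (q k))" for w
    using that by (simp add: wcompl_def)
  ultimately show ?thesis
    using e by (auto simp: frame_def wsys_def) (simp add: wcompl_def)
qed

text \<open>Commuting with a, the algebra h preserves every hyperbolic line of the frame. Within
  each even line a complex joint eigenvector is chosen, its partner is rescaled dually, and the
  anisotropic part is diagonalised separately. Both maximality assumptions then turn inclusions into
  equalities.\<close>

theorem maximal_abelian_frame:
  assumes a: "maximal_split_abelian a" and h: "maximal_abelian_subalgebra h" and ah: "a \<subseteq> h"
  shows "\<exists>e. frame e \<and> a = real_diagonal e \<and> h = diagonal e"
proof -
  have split: "split_abelian a" and amax: "\<And>a'. split_abelian a' \<Longrightarrow> a \<subseteq> a' \<Longrightarrow> a' = a"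
    using a by (auto simp: maximal_split_abelian_def)
  have hs: "h \<subseteq> skew" and hc: "\<And>x y. x \<in> h \<Longrightarrow> y \<in> h \<Longrightarrow> commutator x y = 0"
    and hmax: "\<And>h'. subspace h' \<Longrightarrow> h' \<subseteq> skew \<Longrightarrow> abelian h' \<Longrightarrow> h \<subseteq> h' \<Longrightarrow> h' = h"
    using h by (auto simp: maximal_abelian_subalgebra_def abelian_def)
  obtain e where e: "frame e" "a = real_diagonal e"
    using maximal_split_abelian_frame[OF a] by blast
  have line: "\<exists>q. x *v e k = rsc (e k) q" if x: "x \<in> h" and k: "k < 2 * p" for x k
  proof -
    have kn: "k < CARD('n)"
      using k two_p_le by simp
    \<comment> \<open>The element of a with weight 1 on \<open>e k\<close>, -1 on its partner and 0
      elsewhere; its eigenspace for 1 is the line of \<open>e k\<close>, which x therefore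
      preserves.\<close>
    define t where "t l = (if l = k then 1 else if l = tau p k then - 1 else 0 :: real)" for l
    define u where "u = diag_matrix e (\<lambda>l. of_real (t l))"
    have t: "t (tau p l) = - t l" for l
      using tau_neq[OF k] tau_tau[of p l] by (auto simp: t_def)
    have ua: "u \<in> a"
      unfolding e(2) u_def by (rule diag_matrix_in_real_diagonal[OF e(1), of t]) (rule t)
    then have us: "u \<in> skew"
      using ah hs by blast
    have ue: "u *v e l = t l *\<^sub>R e l" if "l < CARD('n)" for l
      using diag_matrix_frame[OF e(1) that] by (simp add: u_def rsc_of_real)
    have "commutator u x = 0"
      using ua ah x by (intro hc) auto
    then have "commutator u x *v e k = 0"
      by simp
    then have uw: "u *v (x *v e k) = x *v e k"
      using ue[OF kn] by (simp add: commutator_mv mv_scaleR_right t_def)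
    have zero: "form (e (tau p l)) (x *v e k) = 0" if l: "l < CARD('n)" "l \<noteq> k" for l
    proof -
      have "form (e (tau p l)) (u *v (x *v e k)) = - form (u *v e (tau p l)) (x *v e k)"
        by (simp add: skewD[OF us])
      also have "\<dots> = t l *\<^sub>R form (e (tau p l)) (x *v e k)"
        using l by (simp add: ue form_scaleR t)
      finally have "form (e (tau p l)) (x *v e k) = t l *\<^sub>R form (e (tau p l)) (x *v e k)"
        by (simp add: uw)
      then have "(1 - t l) *\<^sub>R form (e (tau p l)) (x *v e k) = 0"
        by (simp add: scaleR_left_diff_distrib del: scaleR_eq_0_iff)
      moreover have "1 - t l \<noteq> 0"
        using l by (simp add: t_def)
      ultimately show ?thesis
        by simp
    qed
    have "x *v e k = (\<Sum>l<CARD('n). rsc (e l) (fsign l *\<^sub>R form (e (tau p l)) (x *v e k)))"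
      by (rule frame_expansion[OF e(1)])
    also have "\<dots> = (\<Sum>l<CARD('n). if l = k then rsc (e l) (fsign l *\<^sub>R form (e (tau p l)) (x *v e k)) else 0)"
      by (intro sum.cong refl) (use zero in auto)
    also have "\<dots> = rsc (e k) (fsign k *\<^sub>R form (e (tau p k)) (x *v e k))"
      using kn by simp
    finally show ?thesis ..
  qed
  have "\<exists>q. q \<noteq> 0 \<and> joint_eigenvector h (rsc (e k) q)" if k: "k < 2 * p" for k
  proof -
    define W where "W = {rsc (e k) q | q. True}"
    have "\<exists>v\<in>W. v \<noteq> 0 \<and> joint_eigenvector h v"
    proof (rule joint_eigenvector_exists)
      show "csubspace W"
        unfolding csubspace_def W_def by (auto simp flip: rsc_add(2))
      show "x *v w \<in> W" if "x \<in> h" "w \<in> W" for x w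
        using line[OF that(1) k] that(2) by (auto simp: W_def mv_rsc)
      have "e k \<in> W"
        unfolding W_def by (auto intro: exI[of _ 1])
      then show "W \<noteq> {0}"
        using frame_nonzero[OF e(1), of k] k two_p_le by auto
    qed (rule hc)
    then show ?thesis
      by (auto simp: W_def)
  qed
  then obtain r where r: "\<And>k. k < 2 * p \<Longrightarrow> r k \<noteq> 0 \<and> joint_eigenvector h (rsc (e k) (r k))"
    by metis
  \<comment> \<open>The odd vector gets the inverse conjugate of the factor of its predecessor,
    which keeps the form on the pair equal to 1.\<close>
  define q where "q k = (if k < 2 * p then if even k then r k else inverse (qcnj (r (k - 1))) else 1)" for k
  define f where "f k = rsc (e k) (q k)" for k
  have f: "frame f"
    unfolding f_def
  proof (rule frame_rescale[OF e(1)])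
    fix k assume k: "k < 2 * p"
    show "qcnj (q k) * q (tau p k) = 1"
    proof (cases "even k")
      case True
      then have "Suc k < 2 * p"
        using k by presburger
      then show ?thesis
        using True k r[of k] by (simp add: q_def tau_def)
    next
      case False
      then have "k - 1 < 2 * p" "even (k - 1)" "Suc (k - 1) = k"
        using k by (auto elim: oddE)
      then show ?thesis
        using False k r[of "k - 1"] by (simp add: q_def tau_def qcnj_inverse)
    qed
  qed (simp add: q_def)
  have jf: "joint_eigenvector h (f k)" if k: "k < 2 * p" for k
  proof (cases "even k")
    case True
    then show ?thesis
      using r k by (simp add: f_def q_def)
  next
    case False
    then have k': "k - 1 < 2 * p" "even (k - 1)" "tau p (k - 1) = k" "k - 1 < CARD('n)"
      using k two_p_le by (auto simp: tau_def elim: oddE)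
    have qk: "q k \<noteq> 0"
      using False k k' r[of "k - 1"] by (simp add: q_def)
    show ?thesis
      unfolding joint_eigenvector_def
    proof
      fix x assume x: "x \<in> h"
      obtain z where "x *v rsc (e (k - 1)) (r (k - 1)) = rsc (rsc (e (k - 1)) (r (k - 1))) (cq z)"
        using r[OF k'(1)] x unfolding joint_eigenvector_def by blast
      then have z: "x *v f (k - 1) = rsc (f (k - 1)) (cq z)"
        using k' by (simp only: f_def q_def if_True)
      obtain c where "x *v e k = rsc (e k) c"
        using line[OF x k] by blast
      then have c: "x *v f k = rsc (f k) (inverse (q k) * c * q k)"
        using qk by (simp add: f_def mv_rsc flip: mult.assoc)
      \<comment> \<open>So far x acts on the partner line by some quaternion; duality with the even
        vector forces it to be complex.\<close>
      have "inverse (q k) * c * q k = - qcnj (cq z)"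
        by (rule diagonal_weights[OF f _ k'(4) z]) (use c k' hs x in auto)
      then have "x *v f k = rsc (f k) (cq (- cnj z))"
        using c by simp
      then show "\<exists>z. x *v f k = rsc (f k) (cq z)" ..
    qed
  qed
  obtain g where g: "frame g" "\<And>k. k < CARD('n) \<Longrightarrow> joint_eigenvector h (g k)"
    using joint_frame[OF f hs hc jf] by blast
  have "h \<subseteq> diagonal g"
    using hs g(2) by (auto simp: diagonal_def joint_eigenvector_def)
  then have "diagonal g = h"
    by (intro hmax subspace_diagonal abelian_diagonal g) (auto simp: diagonal_def)
  have "split_family a"
    using split unfolding split_abelian_def abelian_def by (blast intro: split_family_split)
  moreover have "joint_eigenvector a (g k)" if "k < CARD('n)" for k
    using g(2)[OF that] ah by (auto simp: joint_eigenvector_def)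
  ultimately have "real_eigenvector a (g k)" if "k < CARD('n)" for k
    using that by (auto simp: split_family_def)
  then have "a \<subseteq> real_diagonal g"
    using ah hs by (auto simp: real_diagonal_def real_eigenvector_def)
  then have "real_diagonal g = a"
    by (intro amax split_abelian_real_diagonal g)
  then show ?thesis
    using g(1) \<open>diagonal g = h\<close> by blast
qed

section \<open>Roots\<close>

text \<open>The eigenvalue on \<open>e k\<close>, read off with the dual vector as the components
  along 1 and i. Defined for all matrices, it is linear without side conditions.\<close>

definition wt :: "(nat \<Rightarrow> quat ^ 'n) \<Rightarrow> 'n qmat \<Rightarrow> nat \<Rightarrow> complex" where
  "wt e x k = fsign k *\<^sub>R Complex (qre (form (e (tau p k)) (x *v e k))) (qi (form (e (tau p k)) (x *v e k)))"

definition eps :: "(nat \<Rightarrow> quat ^ 'n) \<Rightarrow> nat \<Rightarrow> 'n qmat \<times> 'n qmat \<Rightarrow> complex" where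
  "eps e k X = (if X \<in> diagonal e \<times> diagonal e then wt e (fst X) k + \<i> * wt e (snd X) k else 0)"

lemma wt_simps: "wt e (x + y) k = wt e x k + wt e y k" "wt e (x - y) k = wt e x k - wt e y k"
  "wt e (r *\<^sub>R x) k = r *\<^sub>R wt e x k" "wt e 0 k = 0"
  by (simp_all add: wt_def mv_simps form_add form_diff form_scaleR complex_eq_iff algebra_simps)

context
  fixes e assumes e: "frame e"
begin

lemma wt_eq: "x *v e k = rsc (e k) (cq z) \<Longrightarrow> k < CARD('n) \<Longrightarrow> wt e x k = z"
  using frame_form[OF e, of "tau p k" k] by (simp add: wt_def of_real_def complex_eq_iff)

lemma diagonal_mv: "x \<in> diagonal e \<Longrightarrow> k < CARD('n) \<Longrightarrow> x *v e k = rsc (e k) (cq (wt e x k))"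
  using diagonalD(2) wt_eq by blast

lemma wt_tau:
  assumes x: "x \<in> diagonal e" and k: "k < CARD('n)"
  shows "wt e x (tau p k) = - cnj (wt e x k)"
proof -
  have "cq (wt e x (tau p k)) = - qcnj (cq (wt e x k))"
    by (rule diagonal_weights[OF e _ k]) (use diagonal_mv[OF x] diagonalD(1)[OF x] k in auto)
  then have "cq (wt e x (tau p k)) = cq (- cnj (wt e x k))"
    by simp
  then show ?thesis
    by (simp only: cq_eq_iff)
qed

lemma wt_diag_matrix: "k < CARD('n) \<Longrightarrow> wt e (diag_matrix e z) k = z k"
  by (rule wt_eq) (simp_all add: diag_matrix_frame[OF e])

lemma diagonal_eqI:
  assumes "x \<in> diagonal e" "y \<in> diagonal e" "\<And>k. k < CARD('n) \<Longrightarrow> wt e x k = wt e y k"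
  shows "x = y"
  by (rule frame_eqI[OF e]) (simp add: diagonal_mv assms)

lemma eps_cdual: "eps e k \<in> cdual (diagonal e)"
  unfolding cdual_def
proof (intro CollectI conjI ballI allI impI)
  fix X Y c assume X: "X \<in> diagonal e \<times> diagonal e"
  show "eps e k (cscale c X) = c * eps e k X"
    using X subspace_diagonal[of e]
    by (auto simp: eps_def cscale_def wt_simps subspace_add subspace_diff subspace_scale complex_eq_iff algebra_simps)
  assume Y: "Y \<in> diagonal e \<times> diagonal e"
  show "eps e k (X + Y) = eps e k X + eps e k Y"
    using X Y subspace_diagonal[of e] by (auto simp: eps_def wt_simps subspace_add algebra_simps)
next
  fix X assume "X \<notin> diagonal e \<times> diagonal e"
  then show "eps e k X = 0"
    by (simp only: eps_def if_False)
qed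

text \<open>
  The two real coordinates are recovered because conjugation of weights is the index map \<open>tau\<close>
  up to sign.
\<close>

lemma eps_surj: "\<exists>X\<in>diagonal e \<times> diagonal e. \<forall>k<CARD('n). eps e k X = \<zeta> k"
proof -
  define z where "z k = (\<zeta> k - cnj (\<zeta> (tau p k))) / 2" for k
  define w where "w k = (\<zeta> k + cnj (\<zeta> (tau p k))) / (2 * \<i>)" for k
  have x: "diag_matrix e z \<in> diagonal e" "diag_matrix e w \<in> diagonal e"
    by (rule diag_matrix_in_diagonal[OF e], simp add: z_def w_def field_simps)+
  have "z k + \<i> * w k = \<zeta> k" for k
    by (simp add: z_def w_def field_simps)
  then show ?thesis
    using x by (intro bexI[of _ "(diag_matrix e z, diag_matrix e w)"]) (auto simp: eps_def wt_diag_matrix)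
qed

text \<open>Conjugating the values at \<open>tau p k\<close> yields the combination with -i in place
  of i, and the two together determine both components.\<close>

lemma eps_inj:
  assumes X: "X \<in> diagonal e \<times> diagonal e" and Y: "Y \<in> diagonal e \<times> diagonal e"
    and eq: "\<And>k. k < CARD('n) \<Longrightarrow> eps e k X = eps e k Y"
  shows "X = Y"
proof -
  have "wt e (fst X) k = wt e (fst Y) k \<and> wt e (snd X) k = wt e (snd Y) k" if k: "k < CARD('n)" for k
  proof -
    have 1: "wt e (fst X) k + \<i> * wt e (snd X) k = wt e (fst Y) k + \<i> * wt e (snd Y) k"
      using eq[OF k] X Y by (simp add: eps_def)
    have "cnj (wt e (fst X) (tau p k) + \<i> * wt e (snd X) (tau p k))
        = cnj (wt e (fst Y) (tau p k) + \<i> * wt e (snd Y) (tau p k))"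
      using eq[of "tau p k"] k X Y by (simp add: eps_def)
    moreover have "wt e (fst Z) (tau p k) = - cnj (wt e (fst Z) k)" "wt e (snd Z) (tau p k) = - cnj (wt e (snd Z) k)"
      if "Z \<in> diagonal e \<times> diagonal e" for Z
      using that k by (auto simp: wt_tau)
    ultimately have 2: "wt e (fst X) k - \<i> * wt e (snd X) k = wt e (fst Y) k - \<i> * wt e (snd Y) k"
      using X Y by (simp add: algebra_simps)
    show ?thesis
      using 1 2 by (auto simp: complex_eq_iff)
  qed
  then show ?thesis
    using X Y by (intro prod_eqI diagonal_eqI) auto
qed

text \<open>The real trace gives only the real part of the sum; reindexing by \<open>tau\<close>
  carries the sum to its conjugate, so it is real.\<close>

lemma killing_wt:
  assumes x: "x \<in> diagonal e" and y: "y \<in> diagonal e"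
  shows "of_real (killing x y) = of_real (4 * (real CARD('n) + 1)) * (\<Sum>k<CARD('n). wt e x k * wt e y k)"
proof -
  have "retr (x ** y) = (\<Sum>k<CARD('n). Re (wt e x k * wt e y k))"
    unfolding retr_frame[OF e]
  proof (intro sum.cong refl)
    fix k assume "k \<in> {..<CARD('n)}"
    then have k: "k < CARD('n)"
      by simp
    have "(x ** y) *v e k = rsc (e k) (cq (wt e x k * wt e y k))"
      by (simp add: mv_assoc diagonal_mv[OF x k] diagonal_mv[OF y k] mv_rsc)
    then show "fsign k * qre (form (e (tau p k)) ((x ** y) *v e k)) = Re (wt e x k * wt e y k)"
      using frame_form[OF e, of "tau p k" k] k by (simp add: of_real_def)
  qed
  then have Re: "retr (x ** y) = Re (\<Sum>k<CARD('n). wt e x k * wt e y k)"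
    by simp
  define S where "S = (\<Sum>k<CARD('n). wt e x k * wt e y k)"
  have "S = (\<Sum>k<CARD('n). wt e x (tau p k) * wt e y (tau p k))"
    unfolding S_def by (rule sum.reindex_bij_witness[of _ "tau p" "tau p"]) auto
  also have "\<dots> = cnj S"
    by (simp add: S_def wt_tau[OF x] wt_tau[OF y])
  finally have "Im S = Im (cnj S)"
    by (rule arg_cong)
  then have "S = of_real (Re S)"
    by (simp add: complex_eq_iff)
  then have "of_real (retr (x ** y)) = (\<Sum>k<CARD('n). wt e x k * wt e y k)"
    unfolding Re S_def by simp
  then show ?thesis
    using x y by (simp add: killing_eq diagonalD(1))
qed

lemma ckilling_eps:
  assumes "X \<in> diagonal e \<times> diagonal e" "Y \<in> diagonal e \<times> diagonal e"
  shows "ckilling X Y = of_real (4 * (real CARD('n) + 1)) * (\<Sum>k<CARD('n). eps e k X * eps e k Y)"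
proof -
  define c :: complex where "c = of_real (4 * (real CARD('n) + 1))"
  have k: "of_real (killing x y) = c * (\<Sum>k<CARD('n). wt e x k * wt e y k)"
    if "x \<in> diagonal e" "y \<in> diagonal e" for x y
    unfolding c_def by (rule killing_wt[OF that])
  have "ckilling X Y = (of_real (killing (fst X) (fst Y)) - of_real (killing (snd X) (snd Y)))
      + \<i> * (of_real (killing (fst X) (snd Y)) + of_real (killing (snd X) (fst Y)))"
    by (simp add: ckilling_def complex_eq_iff)
  also have "\<dots> = c * (\<Sum>k<CARD('n). eps e k X * eps e k Y)"
    using assms
    by (auto simp: k eps_def sum_distrib_left simp flip: sum.distrib sum_subtractf
        intro!: sum.cong)
      (simp add: algebra_simps)
  finally show ?thesis
    by (simp add: c_def)
qed

definition entry :: "'n qmat \<Rightarrow> nat \<Rightarrow> nat \<Rightarrow> quat" where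
  "entry x k l = form (e (tau p k)) (x *v e l)"

lemma entry_commutator:
  assumes u: "u \<in> diagonal e" and kl: "k < CARD('n)" "l < CARD('n)"
  shows "entry (commutator u x) k l = cq (wt e u k) * entry x k l - entry x k l * cq (wt e u l)"
proof -
  have "form (e (tau p k)) (u *v (x *v e l)) = - form (u *v e (tau p k)) (x *v e l)"
    using u by (simp add: skewD diagonalD(1))
  also have "\<dots> = cq (wt e u k) * form (e (tau p k)) (x *v e l)"
    using kl u by (simp add: diagonal_mv wt_tau)
  finally show ?thesis
    using kl u by (simp add: entry_def commutator_mv form_diff diagonal_mv mv_rsc)
qed

text \<open>Together with \<open>proj2\<close> the coordinates for the decomposition of the
  quaternions as C + C j. Passing j conjugates, so the second coordinate sees the conjugate of the
  weight on the right.\<close>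

definition proj1 :: "quat \<Rightarrow> complex" where
  "proj1 q = Complex (qre q) (qi q)"

definition proj2 :: "quat \<Rightarrow> complex" where
  "proj2 q = Complex (qj q) (qk q)"

lemma proj_commutator:
  "proj1 (cq a * q - q * cq b) = (a - b) * proj1 q"
  "proj2 (cq a * q - q * cq b) = (a - cnj b) * proj2 q"
  by (simp_all add: proj1_def proj2_def complex_eq_iff algebra_simps)

lemma proj_linear:
  "proj1 (q + r) = proj1 q + proj1 r" "proj1 (q - r) = proj1 q - proj1 r" "proj1 (t *\<^sub>R q) = t *\<^sub>R proj1 q"
  "proj2 (q + r) = proj2 q + proj2 r" "proj2 (q - r) = proj2 q - proj2 r" "proj2 (t *\<^sub>R q) = t *\<^sub>R proj2 q"
  by (simp_all add: proj1_def proj2_def complex_eq_iff)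

text \<open>
  A real-linear map \<open>P\<close> to the complex numbers that diagonalises \<open>ad u\<close> extends to the
  complexification and detects the corresponding root.
\<close>

lemma root_detection:
  assumes Z: "Z \<in> root_space (diagonal e) f" and H: "H \<in> diagonal e \<times> diagonal e"
    and P: "\<And>x y. P (x + y) = P x + P y" "\<And>x y. P (x - y) = P x - P y" "\<And>r x. P (r *\<^sub>R x) = r *\<^sub>R P x"
      "\<And>u x. u \<in> diagonal e \<Longrightarrow> P (commutator u x) = A u * P x"
    and nz: "P (fst Z) + \<i> * P (snd Z) \<noteq> 0"
  shows "f H = A (fst H) + \<i> * A (snd H)"
proof -
  define Q where "Q W = P (fst W) + \<i> * P (snd W)" for W
  have "cbr H Z = cscale (f H) Z"
    using Z H unfolding root_space_def by blast
  moreover have "Q (cscale c W) = c * Q W" for c W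
    by (simp add: Q_def cscale_def P complex_eq_iff algebra_simps)
  moreover have "Q (cbr H Z) = (A (fst H) + \<i> * A (snd H)) * Q Z"
    using H by (auto simp: Q_def cbr_def P algebra_simps)
  ultimately have "(A (fst H) + \<i> * A (snd H)) * Q Z = f H * Q Z"
    by metis
  then show ?thesis
    using nz by (simp add: Q_def)
qed

text \<open>
  As a complex space under right multiplication, each quaternionic line splits into two weight
  lines; \<open>e (tau p k) j\<close> has weight \<open>- eps k\<close>.
\<close>

definition weight_vector :: "real \<Rightarrow> nat \<Rightarrow> quat ^ 'n" where
  "weight_vector t k = (if t = 1 then e k else rsc (e (tau p k)) jq)"

lemma weight_vector_mv:
  assumes x: "x \<in> diagonal e" and k: "k < CARD('n)" and t: "t = 1 \<or> t = - 1"
  shows "x *v weight_vector t k = rsc (weight_vector t k) (cq (of_real t * wt e x k))"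
proof (cases "t = 1")
  case True
  then show ?thesis
    using x k by (simp add: weight_vector_def diagonal_mv)
next
  case False
  then have "x *v weight_vector t k = rsc (e (tau p k)) (cq (- cnj (wt e x k)) * jq)"
    using x k by (simp add: weight_vector_def mv_rsc diagonal_mv wt_tau)
  also have "cq (- cnj (wt e x k)) * jq = jq * cq (of_real t * wt e x k)"
    using False t by (simp add: cq_jq)
  finally show ?thesis
    using False by (simp add: weight_vector_def)
qed

text \<open>The weight of the second vector enters conjugated, and passing \<open>jq\<close> undoes
  the conjugation; so both weights add on the left. This is why coefficients have the form
  \<open>cq w * jq\<close>.\<close>

lemma commutator_skew_outer:
  assumes x: "x \<in> skew" and v: "x *v v = rsc v (cq c)" "x *v v' = rsc v' (cq c')"
  shows "commutator x (skew_outer v (cq w * jq) v') = skew_outer v (cq ((c + c') * w) * jq) v'"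
proof -
  have q: "cq ((c + c') * w) * jq = cq c * (cq w * jq) + (cq w * jq) * qcnj (cq c')"
    by (simp add: quat_eq_iff algebra_simps)
  have q': "qcnj (cq ((c + c') * w) * jq) = qcnj (cq w * jq) * qcnj (cq c) + cq c' * qcnj (cq w * jq)"
    unfolding q by (simp add: quat_eq_iff algebra_simps)
  show ?thesis
    unfolding skew_outer_def q' unfolding q
    by (rule matrix_eqI)
      (simp add: commutator_simps skew_mult_outer[OF x] v mv_simps algebra_simps rsc_add del: cq_simps qcnj_simps)
qed

text \<open>If both elements vanished, multiplying j and k by fixed units on both sides would give
  real quaternions, or zero for different lines; this contradicts their linear independence.\<close>

lemma skew_outer_weight_nonzero:
  assumes kl: "k < CARD('n)" "l < CARD('n)"
  shows "skew_outer (weight_vector t k) jq (weight_vector t' l) \<noteq> 0 \<or> skew_outer (weight_vector t k) (cq \<i> * jq) (weight_vector t' l) \<noteq> 0"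
proof (rule ccontr)
  assume *: "\<not> ?thesis"
  obtain a \<alpha> where a: "weight_vector t k = rsc (e a) \<alpha>" "a < CARD('n)" "\<alpha> = 1 \<or> \<alpha> = jq"
    using kl(1) by (cases "t = 1") (auto simp: weight_vector_def intro: that[of k 1] that[of "tau p k" jq])
  obtain b \<beta> where b: "weight_vector t' l = rsc (e b) \<beta>" "b < CARD('n)" "\<beta> = 1 \<or> \<beta> = jq"
    using kl(2) by (cases "t' = 1") (auto simp: weight_vector_def intro: that[of l 1] that[of "tau p l" jq])
  have key: "\<alpha> * q * qcnj \<beta> = (if a = b then qcnj (\<alpha> * q * qcnj \<beta>) else 0)"
    if "skew_outer (weight_vector t k) q (weight_vector t' l) = 0" for q
  proof -
    define Q where "Q = \<alpha> * q * qcnj \<beta>"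
    have "0 = form (e (tau p a)) (skew_outer (weight_vector t k) q (weight_vector t' l) *v e (tau p b))"
      using that by simp
    also have "\<dots> = fsign a *\<^sub>R fsign b *\<^sub>R (Q - (if a = b then qcnj Q else 0))"
      using a b frame_form[OF e, of "tau p a"] frame_form[OF e, of a "tau p b"] frame_form[OF e, of b "tau p b"]
      by (auto simp: skew_outer_mv form_diff Q_def of_real_def mult.assoc algebra_simps)
    finally have "Q - (if a = b then qcnj Q else 0) = 0"
      by (metis fsign_simps(4) scaleR_eq_0_iff)
    then have "Q = (if a = b then qcnj Q else 0)"
      by (rule iffD2[OF eq_iff_diff_eq_0])
    then show ?thesis
      unfolding Q_def .
  qed
  from key[of jq] key[of "cq \<i> * jq"] * a(3) b(3) show False
    by (auto simp: quat_eq_iff split: if_splits)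
qed

text \<open>Equal indices are allowed: equal signs then give the long roots, opposite signs the zero
  function.\<close>

definition root_fun :: "real \<Rightarrow> nat \<Rightarrow> real \<Rightarrow> nat \<Rightarrow> 'n qmat \<times> 'n qmat \<Rightarrow> complex" where
  "root_fun t k t' l = (\<lambda>X. of_real t * eps e k X + of_real t' * eps e l X)"

lemma root_fun_cdual: "root_fun t k t' l \<in> cdual (diagonal e)"
  using eps_cdual[of k] eps_cdual[of l]
  unfolding cdual_def root_fun_def by (simp add: algebra_simps)

lemma root_fun_is_root:
  assumes t: "t = 1 \<or> t = - 1" "t' = 1 \<or> t' = - 1" and kl: "k < CARD('n)" "l < CARD('n)"
    and nz: "root_fun t k t' l \<noteq> (\<lambda>_. 0)"
  shows "root_fun t k t' l \<in> roots (diagonal e)"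
proof -
  define b where "b w = skew_outer (weight_vector t k) (cq w * jq) (weight_vector t' l)" for w
  have bs: "b w \<in> skew" for w
    by (simp add: b_def skew_outer_in_skew)
  have blin: "b (w + w') = b w + b w'" "b (r *\<^sub>R w) = r *\<^sub>R b w" for w w' r
    by (rule matrix_eqI, simp add: b_def skew_outer_mv mv_simps algebra_simps rsc_add rsc_diff rsc_scaleR)+
  \<comment> \<open>As an element of the complexification this is b 1 + i b(-i), on which
    \<open>cscale c\<close> agrees with multiplying the coefficient by c.\<close>
  define Z where "Z = (b 1, b (- \<i>))"
  have "Z \<in> root_space (diagonal e) (root_fun t k t' l)"
    unfolding root_space_def
  proof (intro CollectI conjI ballI)
    show "Z \<in> skew \<times> skew"
      by (simp add: Z_def bs)
    fix H assume H: "H \<in> diagonal e \<times> diagonal e"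
    have br: "commutator u (b w) = b ((of_real t * wt e u k + of_real t' * wt e u l) * w)" if "u \<in> diagonal e" for u w
      unfolding b_def using that t kl by (intro commutator_skew_outer weight_vector_mv diagonalD(1)[of _ e])
    define c where "c = root_fun t k t' l H"
    define cu where "cu = of_real t * wt e (fst H) k + of_real t' * wt e (fst H) l"
    define cv where "cv = of_real t * wt e (snd H) k + of_real t' * wt e (snd H) l"
    have c: "c = cu + \<i> * cv"
      using H by (auto simp: c_def cu_def cv_def root_fun_def eps_def algebra_simps)
    have bneg: "b w - b w' = b (w + (- 1) *\<^sub>R w')" for w w'
      unfolding blin by simp
    have "cbr H Z = (b (cu * 1) - b (cv * (- \<i>)), b (cu * (- \<i>)) + b (cv * 1))"
      using H by (auto simp: cbr_def Z_def br cu_def cv_def)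
    also have "\<dots> = (b c, b (c * (- \<i>)))"
      unfolding bneg by (simp only: c flip: blin) (simp add: algebra_simps)
    also have "\<dots> = cscale c Z"
    proof -
      have c1: "Re c *\<^sub>R 1 + (- Im c) *\<^sub>R (- \<i>) = c" and c2: "Re c *\<^sub>R (- \<i>) + Im c *\<^sub>R 1 = c * (- \<i>)"
        by (simp_all add: complex_eq_iff)
      have "cscale c Z = (b (Re c *\<^sub>R 1 + (- Im c) *\<^sub>R (- \<i>)), b (Re c *\<^sub>R (- \<i>) + Im c *\<^sub>R 1))"
        unfolding blin by (simp add: cscale_def Z_def)
      then show ?thesis
        by (simp only: c1 c2)
    qed
    finally show "cbr H Z = cscale (root_fun t k t' l H) Z"
      by (simp add: c_def)
  qed
  moreover have "Z \<noteq> 0"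
  proof
    assume "Z = 0"
    then have "b 1 = 0" "b (- \<i>) = 0"
      by (simp_all add: Z_def zero_prod_def)
    moreover have "b \<i> = (- 1) *\<^sub>R b (- \<i>)"
      by (simp flip: blin)
    ultimately show False
      using skew_outer_weight_nonzero[OF kl, of t t'] by (simp add: b_def)
  qed
  ultimately show ?thesis
    using nz root_fun_cdual by (auto simp: roots_def)
qed

lemma root_is_root_fun:
  assumes f: "f \<in> roots (diagonal e)"
  shows "\<exists>t k t' l. (t = 1 \<or> t = - 1) \<and> (t' = 1 \<or> t' = - 1) \<and> k < CARD('n) \<and> l < CARD('n) \<and> f = root_fun t k t' l"
proof -
  have "0 \<in> root_space (diagonal e) f"
    by (simp add: root_space_def cbr_def cscale_def commutator_simps zero_prod_def subspace_0 subspace_skew)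
  then obtain Z where Z: "Z \<in> root_space (diagonal e) f" "Z \<noteq> 0"
    using f unfolding roots_def by blast
  have ex: "\<exists>k<CARD('n). \<exists>l<CARD('n). entry x k l \<noteq> 0" if "x \<noteq> 0" for x
  proof (rule ccontr)
    assume *: "\<not> ?thesis"
    have "x = 0"
    proof (rule frame_eqI[OF e], rule frame_form_eqI[OF e])
      fix k l assume "k < CARD('n)" "l < CARD('n)"
      then have "entry x (tau p l) k = 0"
        using * by simp
      then show "form (e l) (x *v e k) = form (e l) (0 *v e k)"
        by (simp add: entry_def)
    qed
    with that show False ..
  qed
  have "fst Z \<noteq> 0 \<or> snd Z \<noteq> 0"
    using Z(2) by (auto simp: prod_eq_iff)
  then obtain k l where kl: "k < CARD('n)" "l < CARD('n)" "entry (fst Z) k l \<noteq> 0 \<or> entry (snd Z) k l \<noteq> 0"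
    using ex by blast
  have lin: "entry (x + y) k l = entry x k l + entry y k l" "entry (x - y) k l = entry x k l - entry y k l"
    "entry (r *\<^sub>R x) k l = r *\<^sub>R entry x k l" for x y r
    by (simp_all add: entry_def mv_simps form_add form_diff form_scaleR)
  define P1 where "P1 x = proj1 (entry x k l)" for x
  define P2 where "P2 x = proj2 (entry x k l)" for x
  have P1: "P1 (commutator u x) = (wt e u k - wt e u l) * P1 x" if "u \<in> diagonal e" for u x
    using kl that by (simp add: P1_def entry_commutator proj_commutator)
  have P2: "P2 (commutator u x) = (wt e u k + wt e u (tau p l)) * P2 x" if "u \<in> diagonal e" for u x
    using kl that by (simp add: P2_def entry_commutator proj_commutator wt_tau)
  note lins = P1_def P2_def lin proj_linear
  have found: ?thesis
    if "\<And>H. H \<in> diagonal e \<times> diagonal e \<Longrightarrow> f H = (of_real t * wt e (fst H) k' + of_real t' * wt e (fst H) l')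
        + \<i> * (of_real t * wt e (snd H) k' + of_real t' * wt e (snd H) l')"
      "t = 1 \<or> t = - 1" "t' = 1 \<or> t' = - 1" "k' < CARD('n)" "l' < CARD('n)" for t t' k' l'
  proof -
    have "f = root_fun t k' t' l'"
    proof
      fix X
      show "f X = root_fun t k' t' l' X"
      proof (cases "X \<in> diagonal e \<times> diagonal e")
        case True
        then show ?thesis
          using that(1) by (auto simp: root_fun_def eps_def algebra_simps)
      next
        case False
        moreover have "f \<in> cdual (diagonal e)"
          using f by (simp add: roots_def)
        ultimately have "f X = 0"
          unfolding cdual_def by blast
        then show ?thesis
          using False unfolding root_fun_def eps_def by (simp only: if_False) simp
      qed
    qed
    then show ?thesis
      using that by blast
  qed
  \<comment> \<open>The complex extension of a real-linear map can vanish at Z by cancellation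
    between the components; then that of its conjugate does not. Weights of conjugates are rewritten
    with \<open>tau\<close>.\<close>
  consider "P1 (fst Z) + \<i> * P1 (snd Z) \<noteq> 0" | "cnj (P1 (fst Z)) + \<i> * cnj (P1 (snd Z)) \<noteq> 0"
    | "P2 (fst Z) + \<i> * P2 (snd Z) \<noteq> 0" | "cnj (P2 (fst Z)) + \<i> * cnj (P2 (snd Z)) \<noteq> 0"
  proof -
    have zero: "u = 0 \<and> v = 0" if "u + \<i> * v = 0" "cnj u + \<i> * cnj v = 0" for u v :: complex
      using that by (simp add: complex_eq_iff)
    have "\<not> (P1 (fst Z) = 0 \<and> P1 (snd Z) = 0 \<and> P2 (fst Z) = 0 \<and> P2 (snd Z) = 0)"
      using kl(3) by (auto simp: P1_def P2_def proj1_def proj2_def complex_eq_iff quat_eq_iff)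
    then show ?thesis
      using that zero by metis
  qed
  then show ?thesis
  proof cases
    case 1
    show ?thesis
    proof (rule found)
      fix H assume "H \<in> diagonal e \<times> diagonal e"
      from root_detection[OF Z(1) this _ _ _ P1 1]
      show "f H = (of_real 1 * wt e (fst H) k + of_real (- 1) * wt e (fst H) l)
        + \<i> * (of_real 1 * wt e (snd H) k + of_real (- 1) * wt e (snd H) l)"
        by (simp add: lins)
    qed (use kl in auto)
  next
    case 2
    have P: "cnj (P1 (commutator u x)) = (wt e u (tau p l) - wt e u (tau p k)) * cnj (P1 x)" if "u \<in> diagonal e" for u x
      using P1[OF that] kl that by (simp add: wt_tau)
    show ?thesis
    proof (rule found)
      fix H assume "H \<in> diagonal e \<times> diagonal e"
      from root_detection[OF Z(1) this _ _ _ P 2]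
      show "f H = (of_real 1 * wt e (fst H) (tau p l) + of_real (- 1) * wt e (fst H) (tau p k))
        + \<i> * (of_real 1 * wt e (snd H) (tau p l) + of_real (- 1) * wt e (snd H) (tau p k))"
        by (simp add: lins)
    qed (use kl in auto)
  next
    case 3
    show ?thesis
    proof (rule found)
      fix H assume "H \<in> diagonal e \<times> diagonal e"
      from root_detection[OF Z(1) this _ _ _ P2 3]
      show "f H = (of_real 1 * wt e (fst H) k + of_real 1 * wt e (fst H) (tau p l))
        + \<i> * (of_real 1 * wt e (snd H) k + of_real 1 * wt e (snd H) (tau p l))"
        by (simp add: lins)
    qed (use kl in auto)
  next
    case 4
    have P: "cnj (P2 (commutator u x)) = (- wt e u (tau p k) - wt e u l) * cnj (P2 x)" if "u \<in> diagonal e" for u x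
      using P2[OF that] kl that by (simp add: wt_tau)
    show ?thesis
    proof (rule found)
      fix H assume "H \<in> diagonal e \<times> diagonal e"
      from root_detection[OF Z(1) this _ _ _ P 4]
      show "f H = (of_real (- 1) * wt e (fst H) (tau p k) + of_real (- 1) * wt e (fst H) l)
        + \<i> * (of_real (- 1) * wt e (snd H) (tau p k) + of_real (- 1) * wt e (snd H) l)"
        by (simp add: lins)
    qed (use kl in auto)
  qed
qed

end

end

section \<open>Bases of type C\<close>

definition uvec :: "nat \<Rightarrow> real \<Rightarrow> nat \<Rightarrow> real" where
  "uvec k t = (\<lambda>m. if m = k then t else 0)"

definition vip :: "nat \<Rightarrow> (nat \<Rightarrow> real) \<Rightarrow> (nat \<Rightarrow> real) \<Rightarrow> real" where
  "vip N r r' = (\<Sum>k<N. r k * r' k)"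

text \<open>Inverts the type C relations \<open>A j = d j - d (j + 1)\<close> for j < N and
  \<open>A N = 2 d N\<close>, where d are orthonormal coordinates.\<close>

definition dvec :: "nat \<Rightarrow> (nat \<Rightarrow> nat \<Rightarrow> real) \<Rightarrow> nat \<Rightarrow> nat \<Rightarrow> real" where
  "dvec N A j = (\<lambda>m. (\<Sum>i=j..<N. A i m) + A N m / 2)"

lemma vip_add: "vip N (\<lambda>m. r m + r' m) v = vip N r v + vip N r' v" "vip N v (\<lambda>m. r m + r' m) = vip N v r + vip N v r'"
  by (simp_all add: vip_def sum.distrib algebra_simps)

lemma vip_commute: "vip N r r' = vip N r' r"
  by (simp add: vip_def mult.commute)

lemma vip_uvec: "a < N \<Longrightarrow> vip N (uvec a t) r = t * r a"
  by (simp add: vip_def uvec_def if_distrib[of "\<lambda>t. t * _"] cong: if_cong)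

lemma vip_uvec_uvec: "a < N \<Longrightarrow> vip N (uvec a t) (uvec b u) = (if a = b then t * u else 0)"
  by (simp add: vip_uvec) (simp add: uvec_def)

lemma dvec_rec: "j < N \<Longrightarrow> dvec N A j = (\<lambda>m. A j m + dvec N A (Suc j) m)"
  by (simp add: dvec_def sum.atLeast_Suc_lessThan fun_eq_iff)

lemma dvec_last: "dvec N A N = (\<lambda>m. A N m / 2)"
  by (simp add: dvec_def)

text \<open>The double bond makes \<open>A N\<close> long and its neighbour short, and single bonds
  pass the norm 2 down the chain. Descending from N, \<open>A i\<close> has inner product -1 with
  the signed unit vector \<open>dvec N A (Suc i)\<close>, so one of its two terms cancels and the
  sum is a signed unit vector again. Orthogonality makes \<pi> injective.\<close>

lemma type_C_basis:
  assumes N: "N \<ge> 3"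
    and A: "\<And>i. i \<in> {1..N} \<Longrightarrow> \<exists>a b u t. a < N \<and> b < N \<and> (u = 1 \<or> u = - 1) \<and> (t = 1 \<or> t = - 1) \<and>
      A i = (\<lambda>m. uvec a u m + uvec b t m)"
    and nz: "\<And>i. i \<in> {1..N} \<Longrightarrow> A i \<noteq> (\<lambda>_. 0)"
    and cartan: "\<And>i j. i \<in> {1..N} \<Longrightarrow> j \<in> {1..N} \<Longrightarrow> 2 * vip N (A i) (A j) =
      (if i = j then 2 else if i = N \<and> j + 1 = N then - 2 else if i + 1 = j \<or> j + 1 = i then - 1 else 0) * vip N (A j) (A j)"
  shows "\<exists>\<pi> \<sigma>. (\<forall>i\<in>{1..N}. \<pi> i < N \<and> (\<sigma> i = 1 \<or> \<sigma> i = - 1) \<and> dvec N A i = uvec (\<pi> i) (\<sigma> i)) \<and> inj_on \<pi> {1..N}"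
proof -
  have shape: "(vip N (A i) (A i) = 2 \<and> (\<exists>a b u t. a \<noteq> b \<and> a < N \<and> b < N \<and> (u = 1 \<or> u = - 1) \<and> (t = 1 \<or> t = - 1) \<and>
        A i = (\<lambda>m. uvec a u m + uvec b t m)))
      \<or> (vip N (A i) (A i) = 4 \<and> (\<exists>a u. a < N \<and> (u = 1 \<or> u = - 1) \<and> A i = uvec a (2 * u)))"
    if i: "i \<in> {1..N}" for i
  proof -
    obtain a b u t where *: "a < N" "b < N" "u = 1 \<or> u = - 1" "t = 1 \<or> t = - 1"
      "A i = (\<lambda>m. uvec a u m + uvec b t m)"
      using A[OF i] by blast
    have v: "vip N (A i) (A i) = u * u + t * t + (if a = b then 2 * u * t else 0)"
      unfolding * using *(1,2) by (simp add: vip_add vip_uvec, simp add: uvec_def)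
    show ?thesis
    proof (cases "a = b")
      case True
      have "u = t"
      proof (rule ccontr)
        assume "u \<noteq> t"
        then have "A i = (\<lambda>_. 0)"
          using * True by (auto simp: uvec_def fun_eq_iff)
        with nz[OF i] show False ..
      qed
      then have "A i = uvec a (2 * u)" "vip N (A i) (A i) = 4"
        using * True v by (auto simp: uvec_def fun_eq_iff)
      with * show ?thesis
        by blast
    next
      case False
      then have "vip N (A i) (A i) = 2"
        using * v by auto
      with * False show ?thesis
        by blast
    qed
  qed
  have norm: "vip N (A i) (A i) = 2 \<or> vip N (A i) (A i) = 4" if "i \<in> {1..N}" for i
    using shape[OF that] by blast
  have mem: "N \<in> {1..N}" "N - 1 \<in> {1..N}"
    using N by auto
  have sym: "vip N (A i) (A j) = vip N (A j) (A i)" for i j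
    by (rule vip_commute)
  have "2 * vip N (A N) (A (N - 1)) = - 2 * vip N (A (N - 1)) (A (N - 1))"
    using cartan[of N "N - 1"] N by simp
  moreover have "2 * vip N (A (N - 1)) (A N) = - vip N (A N) (A N)"
    using cartan[of "N - 1" N] N by simp
  ultimately have "vip N (A N) (A N) = 2 * vip N (A (N - 1)) (A (N - 1))"
    using sym[of N "N - 1"] by linarith
  then have last: "vip N (A N) (A N) = 4" "vip N (A (N - 1)) (A (N - 1)) = 2"
    using norm[of N] norm[of "N - 1"] mem by auto
  have short: "vip N (A i) (A i) = 2" if "i \<in> {1..N - 1}" for i
  proof -
    have "i \<le> N - 1" "1 \<le> i"
      using that by auto
    then show ?thesis
    proof (induction rule: inc_induct)
      case base
      show ?case
        by (rule last)
    next
      case (step i)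
      have "i \<noteq> N" "Suc i \<noteq> N"
        using step by auto
      then have "2 * vip N (A i) (A (Suc i)) = - vip N (A (Suc i)) (A (Suc i))"
        "2 * vip N (A (Suc i)) (A i) = - vip N (A i) (A i)"
        using cartan[of i "Suc i"] cartan[of "Suc i" i] step by auto
      then show ?case
        using sym[of i "Suc i"] step by auto
    qed
  qed
  have AA: "vip N (A i) (A j) = (if i + 1 = j \<or> j + 1 = i then - 1 else 0)"
    if "i \<in> {1..N - 1}" "j \<in> {1..N - 1}" "i \<noteq> j" for i j
    using cartan[of i j] short[OF that(2)] that by auto
  have AN: "vip N (A i) (A N) = (if i + 1 = N then - 2 else 0)" if "i \<in> {1..N - 1}" for i
    using cartan[of i N] last(1) that by auto
  have dlast: "vip N v (dvec N A N) = vip N v (A N) / 2" for v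
    by (simp add: dvec_last vip_def sum_divide_distrib)
  have AD: "i \<in> {1..<j} \<Longrightarrow> vip N (A i) (dvec N A j) = (if j = Suc i then - 1 else 0)" if "j \<le> N" for i j
    using that
  proof (induction arbitrary: i rule: inc_induct)
    case base
    then show ?case
      using AN[of i] by (auto simp: dlast)
  next
    case (step j)
    have "vip N (A i) (dvec N A j) = vip N (A i) (A j) + vip N (A i) (dvec N A (Suc j))"
      using step by (simp add: dvec_rec vip_add)
    also have "vip N (A i) (dvec N A (Suc j)) = 0"
      using step by (subst step.IH) auto
    also have "vip N (A i) (A j) = (if j = Suc i then - 1 else 0)"
      using step by (subst AA) auto
    finally show ?case
      by simp
  qed
  have DD: "i \<in> {1..<j} \<Longrightarrow> j \<le> N \<Longrightarrow> vip N (dvec N A i) (dvec N A j) = 0" if "i \<le> N" and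
      unit: "\<And>j. j \<in> {1..N} \<Longrightarrow> vip N (dvec N A j) (dvec N A j) = 1" for i j
    using that(1)
  proof (induction arbitrary: j rule: inc_induct)
    case base
    then show ?case
      by auto
  next
    case (step i)
    have "vip N (dvec N A i) (dvec N A j) = vip N (A i) (dvec N A j) + vip N (dvec N A (Suc i)) (dvec N A j)"
      using step by (simp add: dvec_rec vip_add)
    also have "\<dots> = 0"
      using step unit[of j] AD[of j i] by (cases "j = Suc i") auto
    finally show ?case .
  qed
  have unit: "1 \<le> i \<Longrightarrow> \<exists>k t. k < N \<and> (t = 1 \<or> t = - 1) \<and> dvec N A i = uvec k t" if "i \<le> N" for i
    using that
  proof (induction rule: inc_induct)
    case base
    obtain a u where "a < N" "u = 1 \<or> u = - 1" "A N = uvec a (2 * u)"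
      using shape[of N] last(1) N by auto
    then show ?case
      by (intro exI[of _ a] exI[of _ u]) (auto simp: dvec_last uvec_def fun_eq_iff)
  next
    case (step i)
    have i: "i \<in> {1..N - 1}" "i \<in> {1..N}"
      using step by auto
    obtain k t where k: "k < N" "t = 1 \<or> t = - 1" "dvec N A (Suc i) = uvec k t"
      using step by auto
    obtain a b u w where A: "a \<noteq> b" "a < N" "b < N" "u = 1 \<or> u = - 1" "w = 1 \<or> w = - 1"
        "A i = (\<lambda>m. uvec a u m + uvec b w m)"
      using shape[OF i(2)] short[OF i(1)] by auto
    have "Suc i \<le> N"
      using step by simp
    then have "vip N (A i) (dvec N A (Suc i)) = - 1"
      using AD[of "Suc i" i] i by simp
    then have "u * uvec k t a + w * uvec k t b = - 1"
      unfolding A(6) k(3) using A(2,3) by (simp add: vip_add vip_uvec)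
    then have "(a = k \<and> u = - t) \<or> (b = k \<and> w = - t)"
      using A k by (auto simp: uvec_def split: if_splits)
    moreover have dv: "dvec N A i = (\<lambda>m. uvec a u m + uvec b w m + uvec k t m)"
      using dvec_rec[of i N A] step(2) unfolding A(6) k(3) by simp
    have "dvec N A i = uvec b w" if "a = k" "u = - t"
      unfolding dv that by (simp add: uvec_def fun_eq_iff)
    moreover have "dvec N A i = uvec a u" if "b = k" "w = - t"
      unfolding dv that by (simp add: uvec_def fun_eq_iff)
    ultimately have "dvec N A i = uvec b w \<or> dvec N A i = uvec a u"
      by blast
    then show ?case
      using A by blast
  qed
  then have "\<forall>i\<in>{1..N}. \<exists>k t. k < N \<and> (t = 1 \<or> t = - 1) \<and> dvec N A i = uvec k t"
    by auto
  then obtain \<pi> \<sigma> where \<pi>: "\<And>i. i \<in> {1..N} \<Longrightarrow> \<pi> i < N \<and> (\<sigma> i = 1 \<or> \<sigma> i = - 1) \<and> dvec N A i = uvec (\<pi> i) (\<sigma> i)"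
    by metis
  have one: "vip N (dvec N A j) (dvec N A j) = 1" if "j \<in> {1..N}" for j
    using \<pi>[OF that] by (auto simp: vip_uvec_uvec)
  have ne: "\<pi> i \<noteq> \<pi> j" if "i \<in> {1..<j}" "j \<le> N" for i j
  proof
    assume eq: "\<pi> i = \<pi> j"
    have "vip N (dvec N A i) (dvec N A j) = 0"
      using that by (intro DD one) auto
    then show False
      using \<pi>[of i] \<pi>[of j] that eq by (auto simp: vip_uvec_uvec)
  qed
  have "inj_on \<pi> {1..N}"
  proof (rule inj_onI, rule ccontr)
    fix i j assume "i \<in> {1..N}" "j \<in> {1..N}" "\<pi> i = \<pi> j" "i \<noteq> j"
    then show False
      using ne[of i j] ne[of j i] by (cases i j rule: linorder_cases) auto
  qed
  with \<pi> show ?thesis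
    by blast
qed

text \<open>Equal values of an antitone sequence are adjacent, so the pairs are \<open>{1, 2}, {3, 4}, \<dots>\<close>.\<close>

lemma adjacent_pairs:
  fixes d :: "nat \<Rightarrow> real"
  assumes anti: "\<And>i j. 1 \<le> i \<Longrightarrow> i \<le> j \<Longrightarrow> j \<le> N \<Longrightarrow> d j \<le> d i"
    and nz: "\<And>i. i \<in> {1..N} \<Longrightarrow> d i \<noteq> 0 \<longleftrightarrow> i \<le> 2 * q" and q: "2 * q \<le> N"
    and partner: "\<And>i. i \<in> {1..N} \<Longrightarrow> d i \<noteq> 0 \<Longrightarrow> \<exists>j\<in>{1..N}. j \<noteq> i \<and> d j = d i"
    and three: "\<And>i j k. i \<in> {1..N} \<Longrightarrow> j \<in> {1..N} \<Longrightarrow> k \<in> {1..N} \<Longrightarrow> d i \<noteq> 0 \<Longrightarrow> d j = d i \<Longrightarrow> d k = d i \<Longrightarrow>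
      i \<noteq> j \<Longrightarrow> i \<noteq> k \<Longrightarrow> j \<noteq> k \<Longrightarrow> False"
    and k: "k < q"
  shows "d (2 * k + 1) = d (2 * k + 2)"
  using k
proof (induction k rule: less_induct)
  case (less k)
  let ?i = "2 * k + 1"
  have i: "?i \<in> {1..N}" "d ?i \<noteq> 0"
    using less.prems q nz[of ?i] by auto
  obtain j where j: "j \<in> {1..N}" "j \<noteq> ?i" "d j = d ?i"
    using partner[OF i] by blast
  have "\<not> j < ?i"
  proof
    assume ji: "j < ?i"
    \<comment> \<open>The pair {2 m + 1, 2 m + 2} containing j; it is complete by induction, so
      \<open>?i\<close> would be a third index with the same value.\<close>
    define m where "m = (j - 1) div 2"
    have m: "m < k" "j = 2 * m + 1 \<or> j = 2 * m + 2"
      using ji j(1) by (auto simp: m_def)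
    have "d (2 * m + 1) = d (2 * m + 2)"
      using less.IH[OF m(1)] m(1) less.prems by simp
    then have "d (2 * m + 1) = d ?i" "d (2 * m + 2) = d ?i"
      using m(2) j(3) by auto
    then show False
      using three[of ?i "2 * m + 1" "2 * m + 2"] i m(1) by auto
  qed
  then have "2 * k + 2 \<le> j" "j \<le> N"
    using j by auto
  then have "d j \<le> d (2 * k + 2)" "d (2 * k + 2) \<le> d ?i"
    using anti[of "2 * k + 2" j] anti[of ?i "2 * k + 2"] by auto
  then show ?case
    using j(3) by simp
qed

section \<open>Satake data\<close>

locale satake_frame = witt_form s p + satake_data "quat_form.skew s" commutator a h "CARD('n)" \<alpha>
  for s :: "'n::finite \<Rightarrow> real" and p a h \<alpha> +
  fixes e
  assumes e: "frame e" and a_eq: "a = real_diagonal e" and h_eq: "h = diagonal e"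
    and labelling: "C_labelling" and card_ge_3: "CARD('n) \<ge> 3"
begin

definition lin :: "(nat \<Rightarrow> real) \<Rightarrow> 'n qmat \<times> 'n qmat \<Rightarrow> complex" where
  "lin r = (\<lambda>X. \<Sum>k<CARD('n). of_real (r k) * eps e k X)"

lemma lin_uvec: "k < CARD('n) \<Longrightarrow> lin (uvec k t) X = of_real t * eps e k X"
  by (simp add: lin_def uvec_def if_distrib[of "\<lambda>t. t * _"] if_distrib[of of_real] cong: if_cong)

lemma lin_simps: "lin (\<lambda>m. r m + r' m) X = lin r X + lin r' X" "lin (\<lambda>m. r m / c) X = lin r X / of_real c"
  "lin (\<lambda>m. \<Sum>i\<in>I. f i m) X = (\<Sum>i\<in>I. lin (f i) X)"
  by (simp_all add: lin_def sum.distrib algebra_simps sum_divide_distrib sum_distrib_left sum_distrib_right)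
    (rule sum.swap)

lemma root_fun_eq_lin: "k < CARD('n) \<Longrightarrow> l < CARD('n) \<Longrightarrow>
    root_fun e t k t' l = lin (\<lambda>m. uvec k t m + uvec l t' m)"
  by (simp add: root_fun_def[OF e] lin_simps lin_uvec fun_eq_iff)

text \<open>\<open>eps_surj\<close> provides a representing element and \<open>eps_inj\<close> its
  uniqueness, so the definite description denotes it. The denominator is the constant in
  \<open>ckilling_eps\<close>.\<close>

lemma dual_vec_lin:
  "dual_vec h (lin r) \<in> h \<times> h"
  "k < CARD('n) \<Longrightarrow> eps e k (dual_vec h (lin r)) = of_real (r k / (4 * (real CARD('n) + 1)))"
proof -
  define c where "c = 4 * (real CARD('n) + 1)"
  have c: "c > 0"
    by (simp add: c_def)
  obtain T where T: "T \<in> diagonal e \<times> diagonal e" "\<And>k. k < CARD('n) \<Longrightarrow> eps e k T = of_real (r k / c)"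
    using eps_surj[OF e, of "\<lambda>k. of_real (r k / c)"] by blast
  have *: "ckilling S H = lin r H \<longleftrightarrow> (\<Sum>k<CARD('n). of_real c * eps e k S * eps e k H) = (\<Sum>k<CARD('n). of_real (r k) * eps e k H)"
    if "S \<in> diagonal e \<times> diagonal e" "H \<in> diagonal e \<times> diagonal e" for S H
    unfolding ckilling_eps[OF e that] lin_def c_def by (simp add: sum_distrib_left mult.assoc)
  have "dual_vec h (lin r) = T"
    unfolding dual_vec_def h_eq
  proof (rule the_equality)
    show "T \<in> diagonal e \<times> diagonal e \<and> (\<forall>H\<in>diagonal e \<times> diagonal e. ckilling T H = lin r H)"
    proof (intro conjI ballI T(1))
      fix H assume H: "H \<in> diagonal e \<times> diagonal e"
      show "ckilling T H = lin r H"
        unfolding *[OF T(1) H] by (intro sum.cong refl) (use T(2) c in simp)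
    qed
    fix S assume S: "S \<in> diagonal e \<times> diagonal e \<and> (\<forall>H\<in>diagonal e \<times> diagonal e. ckilling S H = lin r H)"
    show "S = T"
    proof (rule eps_inj[OF e])
      fix k assume k: "k < CARD('n)"
      obtain H where H: "H \<in> diagonal e \<times> diagonal e" "\<And>l. l < CARD('n) \<Longrightarrow> eps e l H = (if l = k then 1 else 0)"
        using eps_surj[OF e, of "\<lambda>l. if l = k then 1 else 0"] by blast
      have "(\<Sum>k<CARD('n). of_real c * eps e k S * eps e k H) = (\<Sum>k<CARD('n). of_real (r k) * eps e k H)"
        using S H(1) *[of S H] by blast
      then have "of_real c * eps e k S = of_real (r k)"
        using k by (simp add: H(2) if_distrib[of "\<lambda>t. _ * t"] cong: if_cong)
      then have "of_real c * eps e k S = of_real c * eps e k T"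
        using T(2)[OF k] c by simp
      then show "eps e k S = eps e k T"
        using c by simp
    qed (use S T(1) in auto)
  qed
  then show "dual_vec h (lin r) \<in> h \<times> h"
    "k < CARD('n) \<Longrightarrow> eps e k (dual_vec h (lin r)) = of_real (r k / (4 * (real CARD('n) + 1)))"
    using T by (simp_all add: h_eq c_def)
qed

lemma cartan_number_lin:
  "cartan_number h (lin r) (lin r') = of_real (2 * vip CARD('n) r r' / vip CARD('n) r' r')"
proof -
  define c where "c = 4 * (real CARD('n) + 1)"
  have c: "c > 0"
    by (simp add: c_def)
  have "dual_form h (lin v) (lin w) = of_real (vip CARD('n) v w / c)" for v w
  proof -
    have "dual_form h (lin v) (lin w) = of_real c * (\<Sum>k<CARD('n). of_real (v k / c) * of_real (w k / c))"
      unfolding dual_form_def using dual_vec_lin(1)[of v] dual_vec_lin(2)[of _ v] dual_vec_lin(1)[of w] dual_vec_lin(2)[of _ w]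
      by (subst ckilling_eps[OF e]) (auto simp: h_eq c_def)
    also have "\<dots> = of_real (c * (\<Sum>k<CARD('n). v k / c * (w k / c)))"
      by simp
    also have "c * (\<Sum>k<CARD('n). v k / c * (w k / c)) = vip CARD('n) v w / c"
      using c by (simp add: vip_def sum_distrib_left sum_divide_distrib)
    finally show ?thesis .
  qed
  then show ?thesis
    using c by (simp add: cartan_number_def)
qed

lemma simple_root: "i \<in> {1..CARD('n)} \<Longrightarrow> \<alpha> i \<in> roots h"
  using basis by (auto simp: root_basis_def)

lemma signed_basis:
  "\<exists>\<pi> \<sigma>. (\<forall>i\<in>{1..CARD('n)}. \<pi> i < CARD('n) \<and> (\<sigma> i = 1 \<or> \<sigma> i = - 1)) \<and> inj_on \<pi> {1..CARD('n)} \<and>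
    (\<forall>i\<in>{1..CARD('n)}. \<forall>X. of_real (\<sigma> i) * eps e (\<pi> i) X = (\<Sum>m=i..<CARD('n). \<alpha> m X) + \<alpha> CARD('n) X / 2)"
proof -
  let ?N = "CARD('n)"
  have "\<exists>r. \<alpha> i = lin r \<and> (\<exists>a b u t. a < ?N \<and> b < ?N \<and> (u = 1 \<or> u = - 1) \<and> (t = 1 \<or> t = - 1) \<and>
      r = (\<lambda>m. uvec a u m + uvec b t m))" if i: "i \<in> {1..?N}" for i
  proof -
    obtain u k t l where *: "u = 1 \<or> u = - 1" "t = 1 \<or> t = - 1" "k < ?N" "l < ?N" "\<alpha> i = root_fun e u k t l"
      using root_is_root_fun[OF e] simple_root[OF i] unfolding h_eq by blast
    then have "\<alpha> i = lin (\<lambda>m. uvec k u m + uvec l t m)"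
      by (simp add: root_fun_eq_lin)
    with * show ?thesis
      by blast
  qed
  then have "\<forall>i\<in>{1..?N}. \<exists>r. \<alpha> i = lin r \<and> (\<exists>a b u t. a < ?N \<and> b < ?N \<and> (u = 1 \<or> u = - 1) \<and> (t = 1 \<or> t = - 1) \<and>
      r = (\<lambda>m. uvec a u m + uvec b t m))"
    by blast
  from bchoice[OF this] obtain A where A: "\<And>i. i \<in> {1..?N} \<Longrightarrow> \<alpha> i = lin (A i)"
      "\<And>i. i \<in> {1..?N} \<Longrightarrow> \<exists>a b u t. a < ?N \<and> b < ?N \<and> (u = 1 \<or> u = - 1) \<and> (t = 1 \<or> t = - 1) \<and>
      A i = (\<lambda>m. uvec a u m + uvec b t m)"
    by blast
  have nz: "A i \<noteq> (\<lambda>_. 0)" if "i \<in> {1..?N}" for i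
  proof
    assume "A i = (\<lambda>_. 0)"
    then have "\<alpha> i = (\<lambda>_. 0)"
      using A(1)[OF that] by (simp add: lin_def)
    then show False
      using simple_root[OF that] by (simp add: roots_def)
  qed
  \<comment> \<open>Division by zero yields 0, so a vanishing norm would contradict the diagonal
    Cartan number 2.\<close>
  have nzv: "vip ?N (A i) (A i) \<noteq> 0" if i: "i \<in> {1..?N}" for i
  proof
    assume 0: "vip ?N (A i) (A i) = 0"
    have "cartan_number h (\<alpha> i) (\<alpha> i) = 2"
      using labelling i unfolding C_labelling_def by simp
    then show False
      using 0 by (simp add: A(1)[OF i] cartan_number_lin)
  qed
  have "\<exists>\<pi> \<sigma>. (\<forall>i\<in>{1..?N}. \<pi> i < ?N \<and> (\<sigma> i = 1 \<or> \<sigma> i = - 1) \<and> dvec ?N A i = uvec (\<pi> i) (\<sigma> i)) \<and> inj_on \<pi> {1..?N}"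
  proof (rule type_C_basis[OF card_ge_3 A(2) nz])
    fix i j assume i: "i \<in> {1..?N}" and j: "j \<in> {1..?N}"
    define c :: real where "c = (if i = j then 2 else if i = ?N \<and> j + 1 = ?N then - 2 else if i + 1 = j \<or> j + 1 = i then - 1 else 0)"
    have "cartan_number h (\<alpha> i) (\<alpha> j) = of_real c"
      using labelling i j unfolding C_labelling_def c_def by simp
    then have "complex_of_real (2 * vip ?N (A i) (A j) / vip ?N (A j) (A j)) = of_real c"
      by (simp only: A(1)[OF i] A(1)[OF j] cartan_number_lin)
    then have "2 * vip ?N (A i) (A j) / vip ?N (A j) (A j) = c"
      by (simp only: of_real_eq_iff)
    then show "2 * vip ?N (A i) (A j) = (if i = j then 2 else if i = ?N \<and> j + 1 = ?N then - 2 else if i + 1 = j \<or> j + 1 = i then - 1 else 0) * vip ?N (A j) (A j)"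
      unfolding c_def[symmetric] using nzv[OF j] by (simp add: field_simps)
  qed
  then obtain \<pi> \<sigma> where \<pi>: "\<And>i. i \<in> {1..?N} \<Longrightarrow> \<pi> i < ?N \<and> (\<sigma> i = 1 \<or> \<sigma> i = - 1) \<and> dvec ?N A i = uvec (\<pi> i) (\<sigma> i)"
      "inj_on \<pi> {1..?N}"
    by blast
  have "of_real (\<sigma> i) * eps e (\<pi> i) X = (\<Sum>m=i..<?N. \<alpha> m X) + \<alpha> ?N X / 2" if i: "i \<in> {1..?N}" for i X
  proof -
    have "of_real (\<sigma> i) * eps e (\<pi> i) X = lin (dvec ?N A i) X"
      using \<pi>(1)[OF i] by (simp add: lin_uvec)
    also have "\<dots> = (\<Sum>m=i..<?N. lin (A m) X) + lin (A ?N) X / 2"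
      by (simp add: dvec_def lin_simps)
    also have "\<dots> = (\<Sum>m=i..<?N. \<alpha> m X) + \<alpha> ?N X / 2"
      using i A(1) by (auto intro!: sum.cong)
    finally show ?thesis .
  qed
  with \<pi> show ?thesis
    by blast
qed

end

section \<open>Root coordinates and the sets \<open>Phi_I\<close>\<close>

locale satake_signed = satake_frame s p a h \<alpha> e
  for s :: "'n::finite \<Rightarrow> real" and p a h \<alpha> e +
  fixes \<pi> :: "nat \<Rightarrow> nat" and \<sigma> :: "nat \<Rightarrow> real"
  assumes pi_less: "i \<in> {1..CARD('n)} \<Longrightarrow> \<pi> i < CARD('n)"
    and sigma: "i \<in> {1..CARD('n)} \<Longrightarrow> \<sigma> i = 1 \<or> \<sigma> i = - 1"
    and inj_pi: "inj_on \<pi> {1..CARD('n)}"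
    and signed_eq: "i \<in> {1..CARD('n)} \<Longrightarrow>
      of_real (\<sigma> i) * eps e (\<pi> i) X = (\<Sum>m=i..<CARD('n). \<alpha> m X) + \<alpha> CARD('n) X / 2"
begin

definition delta :: "nat \<Rightarrow> 'n qmat \<times> 'n qmat \<Rightarrow> complex" where
  "delta i = (\<lambda>X. of_real (\<sigma> i) * eps e (\<pi> i) X)"

definition dsum :: "int \<Rightarrow> nat \<Rightarrow> int \<Rightarrow> nat \<Rightarrow> 'n qmat \<times> 'n qmat \<Rightarrow> complex" where
  "dsum t i u j = (\<lambda>X. of_int t * delta i X + of_int u * delta j X)"

text \<open>
  Read off from \<open>delta i = \<alpha> i + \<dots> + \<alpha> (l - 1) + \<alpha> l / 2\<close>.
\<close>

definition dcoord :: "int \<Rightarrow> nat \<Rightarrow> int \<Rightarrow> nat \<Rightarrow> nat \<Rightarrow> int" where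
  "dcoord t i u j m = (if m \<in> {1..CARD('n)} then
     if m < CARD('n) then (if i \<le> m then t else 0) + (if j \<le> m then u else 0) else (t + u) div 2 else 0)"

abbreviation sgn1 :: "int \<Rightarrow> bool" where
  "sgn1 t \<equiv> t = 1 \<or> t = - 1"

lemma pi_surj: "k < CARD('n) \<Longrightarrow> \<exists>i\<in>{1..CARD('n)}. \<pi> i = k"
proof -
  assume k: "k < CARD('n)"
  have "\<pi> ` {1..CARD('n)} = {..<CARD('n)}"
    using pi_less inj_pi by (intro card_subset_eq) (auto simp: card_image)
  then have "k \<in> \<pi> ` {1..CARD('n)}"
    using k by simp
  then show ?thesis
    by blast
qed

lemma dsum_eq_root_fun: "dsum t i u j = root_fun e (of_int t * \<sigma> i) (\<pi> i) (of_int u * \<sigma> j) (\<pi> j)"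
  by (simp add: dsum_def delta_def root_fun_def[OF e] fun_eq_iff)

lemma delta_surj: "\<exists>X. \<forall>i\<in>{1..CARD('n)}. delta i X = \<zeta> i"
proof -
  define z where "z k = (\<Sum>i\<in>{1..CARD('n)}. if \<pi> i = k then of_real (\<sigma> i) * \<zeta> i else 0)" for k
  obtain X where X: "\<And>k. k < CARD('n) \<Longrightarrow> eps e k X = z k"
    using eps_surj[OF e, of z] by blast
  have "delta i X = \<zeta> i" if i: "i \<in> {1..CARD('n)}" for i
  proof -
    have "z (\<pi> i) = (\<Sum>j\<in>{1..CARD('n)}. if j = i then of_real (\<sigma> j) * \<zeta> j else 0)"
      unfolding z_def using i inj_onD[OF inj_pi] by (intro sum.cong refl) auto
    then have "z (\<pi> i) = of_real (\<sigma> i) * \<zeta> i"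
      using i by simp
    moreover have "complex_of_real (\<sigma> i) * of_real (\<sigma> i) = 1"
      using sigma[OF i] by auto
    ultimately show ?thesis
      using X[OF pi_less[OF i]] by (simp add: delta_def flip: mult.assoc)
  qed
  then show ?thesis
    by blast
qed

lemma dsum_nonzero:
  assumes ij: "i \<in> {1..CARD('n)}" "j \<in> {1..CARD('n)}" and tu: "sgn1 t" "sgn1 u" "i = j \<Longrightarrow> t = u"
  shows "dsum t i u j \<noteq> (\<lambda>_. 0)"
proof
  assume 0: "dsum t i u j = (\<lambda>_. 0)"
  obtain X where X: "\<And>m. m \<in> {1..CARD('n)} \<Longrightarrow> delta m X = (if m = i then 1 else 0)"
    using delta_surj[of "\<lambda>m. if m = i then 1 else 0"] by blast
  have "dsum t i u j X = 0"
    by (simp add: 0)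
  then show False
    using tu X[OF ij(1)] X[OF ij(2)] by (auto simp: dsum_def split: if_splits)
qed

lemma dsum_root:
  assumes ij: "i \<in> {1..CARD('n)}" "j \<in> {1..CARD('n)}" and tu: "sgn1 t" "sgn1 u" "i = j \<Longrightarrow> t = u"
  shows "dsum t i u j \<in> roots h"
  using dsum_nonzero[OF assms] tu sigma[OF ij(1)] sigma[OF ij(2)] pi_less[OF ij(1)] pi_less[OF ij(2)]
  unfolding dsum_eq_root_fun h_eq by (intro root_fun_is_root[OF e]) auto

lemma root_dsum:
  assumes b: "b \<in> roots h"
  shows "\<exists>t i u j. sgn1 t \<and> sgn1 u \<and> i \<in> {1..CARD('n)} \<and> j \<in> {1..CARD('n)} \<and> b = dsum t i u j"
proof -
  obtain t k u l where *: "t = 1 \<or> t = - 1" "u = 1 \<or> u = - 1" "k < CARD('n)" "l < CARD('n)" "b = root_fun e t k u l"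
    using root_is_root_fun[OF e] b unfolding h_eq by blast
  obtain i j where ij: "i \<in> {1..CARD('n)}" "\<pi> i = k" "j \<in> {1..CARD('n)}" "\<pi> j = l"
    using pi_surj[OF *(3)] pi_surj[OF *(4)] by blast
  have sg: "\<exists>t'. sgn1 t' \<and> of_int t' * \<sigma> m = w" if "m \<in> {1..CARD('n)}" "w = 1 \<or> w = - 1" for m w
    using sigma[OF that(1)] that(2)
    by (auto intro: exI[of _ 1] exI[of _ "- 1"])
  obtain t' where t': "sgn1 t'" "of_int t' * \<sigma> i = t"
    using sg[OF ij(1) *(1)] by blast
  obtain u' where u': "sgn1 u'" "of_int u' * \<sigma> j = u"
    using sg[OF ij(3) *(2)] by blast
  have "b = dsum t' i u' j"
    unfolding dsum_eq_root_fun using * ij t' u' by simp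
  then show ?thesis
    using t' u' ij by blast
qed

lemma delta_expansion:
  "i \<in> {1..CARD('n)} \<Longrightarrow> delta i X = (\<Sum>m=i..<CARD('n). \<alpha> m X) + \<alpha> CARD('n) X / 2"
  by (simp add: delta_def signed_eq)

lemma alpha_delta: "i \<in> {1..<CARD('n)} \<Longrightarrow> \<alpha> i = (\<lambda>X. delta i X - delta (Suc i) X)"
  by (rule ext) (simp add: delta_expansion sum.atLeast_Suc_lessThan)

lemma alpha_last: "\<alpha> CARD('n) = (\<lambda>X. 2 * delta CARD('n) X)"
  using card_ge_3 by (intro ext) (simp add: delta_expansion)

lemma dsum_expansion:
  assumes ij: "i \<in> {1..CARD('n)}" "j \<in> {1..CARD('n)}" and tu: "sgn1 t" "sgn1 u"
  shows "dsum t i u j = (\<lambda>X. \<Sum>m=1..CARD('n). of_int (dcoord t i u j m) * \<alpha> m X)"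
proof
  fix X
  let ?N = "CARD('n)"
  have N: "{1..?N} = insert ?N {1..<?N}"
    using card_ge_3 by auto
  have "(\<Sum>m=1..?N. of_int (dcoord t i u j m) * \<alpha> m X)
      = of_int ((t + u) div 2) * \<alpha> ?N X + (\<Sum>m=1..<?N. of_int (dcoord t i u j m) * \<alpha> m X)"
    unfolding N using card_ge_3 by (simp add: dcoord_def)
  also have "(\<Sum>m=1..<?N. of_int (dcoord t i u j m) * \<alpha> m X)
      = (\<Sum>m=1..<?N. if i \<le> m then of_int t * \<alpha> m X else 0) + (\<Sum>m=1..<?N. if j \<le> m then of_int u * \<alpha> m X else 0)"
    unfolding sum.distrib[symmetric] by (intro sum.cong refl) (auto simp: dcoord_def algebra_simps)
  also have "(\<Sum>m=1..<?N. if i \<le> m then of_int t * \<alpha> m X else 0) = of_int t * (\<Sum>m=i..<?N. \<alpha> m X)"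
  proof -
    have "(\<Sum>m=1..<?N. if i \<le> m then of_int t * \<alpha> m X else 0) = (\<Sum>m=i..<?N. of_int t * \<alpha> m X)"
      using ij by (intro sum.mono_neutral_cong_right) auto
    then show ?thesis
      by (simp add: sum_distrib_left)
  qed
  also have "(\<Sum>m=1..<?N. if j \<le> m then of_int u * \<alpha> m X else 0) = of_int u * (\<Sum>m=j..<?N. \<alpha> m X)"
  proof -
    have "(\<Sum>m=1..<?N. if j \<le> m then of_int u * \<alpha> m X else 0) = (\<Sum>m=j..<?N. of_int u * \<alpha> m X)"
      using ij by (intro sum.mono_neutral_cong_right) auto
    then show ?thesis
      by (simp add: sum_distrib_left)
  qed
  also have "of_int ((t + u) div 2) = (of_int t + of_int u) / (2 :: complex)"
    using tu by auto
  finally show "dsum t i u j X = (\<Sum>m=1..?N. of_int (dcoord t i u j m) * \<alpha> m X)"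
    using ij by (simp add: dsum_def delta_expansion algebra_simps add_divide_distrib)
qed

text \<open>\<open>basis\<close> gives independence for coefficients on the set of simple roots;
  \<open>inj_simple\<close> transfers it to coefficients indexed by nodes.\<close>

lemma alpha_independent:
  fixes c c' :: "nat \<Rightarrow> int"
  assumes eq: "(\<lambda>X. \<Sum>m=1..CARD('n). of_int (c m) * \<alpha> m X) = (\<lambda>X. \<Sum>m=1..CARD('n). of_int (c' m) * \<alpha> m X)"
    and m: "m \<in> {1..CARD('n)}"
  shows "c m = c' m"
proof -
  define d where "d f = real_of_int (c (the_inv_into {1..CARD('n)} \<alpha> f) - c' (the_inv_into {1..CARD('n)} \<alpha> f))" for f
  have d: "d (\<alpha> i) = real_of_int (c i - c' i)" if "i \<in> {1..CARD('n)}" for i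
    by (simp only: d_def the_inv_into_f_f[OF inj_simple that])
  have "(\<Sum>f\<in>\<alpha> ` {1..CARD('n)}. of_real (d f) * f X) = 0" for X
  proof -
    have "(\<Sum>f\<in>\<alpha> ` {1..CARD('n)}. of_real (d f) * f X) = (\<Sum>i=1..CARD('n). of_real (d (\<alpha> i)) * \<alpha> i X)"
      by (subst sum.reindex[OF inj_simple]) simp
    also have "\<dots> = (\<Sum>i=1..CARD('n). of_int (c i) * \<alpha> i X) - (\<Sum>i=1..CARD('n). of_int (c' i) * \<alpha> i X)"
      unfolding sum_subtractf[symmetric] by (intro sum.cong refl) (simp add: d algebra_simps)
    also have "\<dots> = 0"
      using fun_cong[OF eq, of X] by simp
    finally show ?thesis .
  qed
  then have "\<forall>f\<in>\<alpha> ` {1..CARD('n)}. d f = 0"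
    using basis unfolding root_basis_def by blast
  then show ?thesis
    using d[OF m] m by auto
qed

lemma root_coords_dsum:
  assumes ij: "i \<in> {1..CARD('n)}" "j \<in> {1..CARD('n)}" and tu: "sgn1 t" "sgn1 u"
  shows "root_coords (dsum t i u j) = dcoord t i u j"
  unfolding root_coords_def
proof (rule the_equality)
  show "dsum t i u j = (\<lambda>X. \<Sum>m=1..CARD('n). of_int (dcoord t i u j m) * \<alpha> m X) \<and>
      (\<forall>m. m \<notin> {1..CARD('n)} \<longrightarrow> dcoord t i u j m = 0)"
    using dsum_expansion[OF assms] by (simp add: dcoord_def)
  fix c assume c: "dsum t i u j = (\<lambda>X. \<Sum>m=1..CARD('n). of_int (c m) * \<alpha> m X) \<and> (\<forall>m. m \<notin> {1..CARD('n)} \<longrightarrow> c m = 0)"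
  then have eq: "(\<lambda>X. \<Sum>m=1..CARD('n). of_int (c m) * \<alpha> m X) = (\<lambda>X. \<Sum>m=1..CARD('n). of_int (dcoord t i u j m) * \<alpha> m X)"
    using dsum_expansion[OF assms] by simp
  show "c = dcoord t i u j"
  proof
    fix m
    show "c m = dcoord t i u j m"
    proof (cases "m \<in> {1..CARD('n)}")
      case True
      then show ?thesis
        by (rule alpha_independent[OF eq])
    next
      case False
      then have "c m = 0"
        using c by blast
      with False show ?thesis
        by (simp only: dcoord_def if_False)
    qed
  qed
qed

lemma one_in_index: "1 \<in> {1..CARD('n)}"
  using card_ge_3 by simp

lemma dcoord_le: "sgn1 t \<Longrightarrow> sgn1 u \<Longrightarrow> dcoord t i u j m \<le> dcoord 1 1 1 1 m"
  by (auto simp: dcoord_def)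

text \<open>By \<open>dcoord_le\<close> twice the first \<delta> dominates all roots; a second
  dominating root has the same coordinates and hence the same expansion.\<close>

lemma maximal_root_eq: "maximal_root = dsum 1 1 1 1"
  unfolding maximal_root_def
proof (rule the_equality)
  show "dsum 1 1 1 1 \<in> roots h \<and> (\<forall>b'\<in>roots h. \<forall>i\<in>{1..CARD('n)}. root_coords b' i \<le> root_coords (dsum 1 1 1 1) i)"
  proof (intro conjI ballI)
    show "dsum 1 1 1 1 \<in> roots h"
      by (intro dsum_root one_in_index) auto
    fix b' m assume "b' \<in> roots h"
    then obtain t i u j where *: "sgn1 t" "sgn1 u" "i \<in> {1..CARD('n)}" "j \<in> {1..CARD('n)}" "b' = dsum t i u j"
      using root_dsum by blast
    then show "root_coords b' m \<le> root_coords (dsum 1 1 1 1) m"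
      using dcoord_le one_in_index by (simp add: root_coords_dsum)
  qed
  fix b assume b: "b \<in> roots h \<and> (\<forall>b'\<in>roots h. \<forall>i\<in>{1..CARD('n)}. root_coords b' i \<le> root_coords b i)"
  then obtain t i u j where *: "sgn1 t" "sgn1 u" "i \<in> {1..CARD('n)}" "j \<in> {1..CARD('n)}" "b = dsum t i u j"
    using root_dsum by blast
  have "dsum 1 1 1 1 \<in> roots h"
    by (intro dsum_root one_in_index) auto
  then have "root_coords (dsum 1 1 1 1) m \<le> root_coords b m" if "m \<in> {1..CARD('n)}" for m
    using b that by blast
  then have "dcoord 1 1 1 1 m \<le> dcoord t i u j m" if "m \<in> {1..CARD('n)}" for m
    using that * one_in_index by (simp add: root_coords_dsum)
  then have eq: "dcoord t i u j m = dcoord 1 1 1 1 m" if "m \<in> {1..CARD('n)}" for m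
    using that dcoord_le[OF *(1,2), of i j m] by (intro order.antisym) auto
  show "b = dsum 1 1 1 1"
    unfolding *(5) dsum_expansion[OF *(3,4,1,2)] dsum_expansion[OF one_in_index one_in_index disjI1[OF refl] disjI1[OF refl]]
    by (intro ext sum.cong refl) (simp only: eq)
qed

text \<open>At node k the maximal root has coordinate 2, or 1 at the last node. A sum of two signed
  \<delta> reaches this value only with both signs positive and both indices at most k.\<close>

lemma Phi_I_eq:
  assumes k: "k \<in> {1..CARD('n)}"
  shows "Phi_I {k} = {dsum 1 i 1 j | i j. i \<in> {1..k} \<and> j \<in> {1..k}}"
proof (intro equalityI subsetI)
  fix b assume b: "b \<in> Phi_I {k}"
  then have "b \<in> roots h"
    by (simp add: Phi_I_def)
  then obtain t i u j where *: "sgn1 t" "sgn1 u" "i \<in> {1..CARD('n)}" "j \<in> {1..CARD('n)}" "b = dsum t i u j"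
    using root_dsum by blast
  have "root_coords b k = root_coords maximal_root k"
    using b by (simp add: Phi_I_def)
  then have eq: "dcoord t i u j k = dcoord 1 1 1 1 k"
    using * one_in_index by (simp add: maximal_root_eq root_coords_dsum)
  then have "t = 1 \<and> u = 1 \<and> i \<le> k \<and> j \<le> k"
    using k *(1-4) by (auto simp: dcoord_def split: if_splits)
  then show "b \<in> {dsum 1 i 1 j | i j. i \<in> {1..k} \<and> j \<in> {1..k}}"
    using * by auto
next
  fix b assume "b \<in> {dsum 1 i 1 j | i j. i \<in> {1..k} \<and> j \<in> {1..k}}"
  then obtain i j where b: "b = dsum 1 i 1 j" "i \<in> {1..k}" "j \<in> {1..k}"
    by blast
  then have ij: "i \<in> {1..CARD('n)}" "j \<in> {1..CARD('n)}"
    using k by auto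
  have "b \<in> roots h"
    unfolding b(1) by (intro dsum_root ij) auto
  moreover have "root_coords b k = root_coords maximal_root k"
    using b k ij one_in_index by (simp add: maximal_root_eq root_coords_dsum, simp add: dcoord_def)
  ultimately show "b \<in> Phi_I {k}"
    by (simp add: Phi_I_def)
qed

subsection \<open>Restriction to the split part\<close>

definition rdelta :: "nat \<Rightarrow> 'n qmat \<Rightarrow> real" where
  "rdelta i x = \<sigma> i * Re (wt e x (\<pi> i))"

lemma real_diagonal_subset: "real_diagonal e \<subseteq> diagonal e"
proof
  fix x assume x: "x \<in> real_diagonal e"
  have "\<exists>z. x *v e k = rsc (e k) (cq z)" if "k < CARD('n)" for k
    using real_diagonalD(2)[OF x that] by (metis cq_simps(8) rsc_of_real)
  then show "x \<in> diagonal e"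
    using real_diagonalD(1)[OF x] by (simp add: diagonal_def)
qed

lemma a_diagonal: "x \<in> a \<Longrightarrow> x \<in> diagonal e"
  using a_eq real_diagonal_subset by blast

lemma wt_a:
  assumes x: "x \<in> a" and k: "k < CARD('n)"
  shows "wt e x k = of_real (Re (wt e x k))" "wt e x (tau p k) = - wt e x k" "x *v e k = Re (wt e x k) *\<^sub>R e k"
proof -
  obtain t where t: "x *v e k = t *\<^sub>R e k"
    using real_diagonalD(2)[of x e k] x k a_eq by blast
  then have "wt e x k = of_real t"
    by (intro wt_eq[OF e _ k]) (simp add: rsc_of_real)
  then show 1: "wt e x k = of_real (Re (wt e x k))" and "x *v e k = Re (wt e x k) *\<^sub>R e k"
    using t by simp_all
  show "wt e x (tau p k) = - wt e x k"
    using wt_tau[OF e a_diagonal[OF x] k] 1 by (metis complex_cnj_complex_of_real)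
qed

lemma wt_a_black: "x \<in> a \<Longrightarrow> k < CARD('n) \<Longrightarrow> \<not> k < 2 * p \<Longrightarrow> wt e x k = 0"
  using wt_a(2)[of x k] by (simp add: tau_outside)

lemma a_surj:
  assumes t: "\<And>k. t (tau p k) = - t k"
  shows "\<exists>x\<in>a. \<forall>k<CARD('n). wt e x k = of_real (t k)"
proof (intro bexI allI impI)
  show "diag_matrix e (\<lambda>k. of_real (t k)) \<in> a"
    unfolding a_eq by (rule diag_matrix_in_real_diagonal[OF e, of t]) (rule t)
qed (rule wt_diag_matrix[OF e])

lemma delta_restr: "x \<in> a \<Longrightarrow> delta i (x, 0) = of_real (\<sigma> i) * wt e x (\<pi> i)"
  using a_diagonal[of x] subspace_0[OF subspace_diagonal, of e] by (simp add: delta_def eps_def wt_simps)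

lemma restr_dsum: "restr a (dsum t i u j) = (\<lambda>x. if x \<in> a then of_int t * rdelta i x + of_int u * rdelta j x else 0)"
  by (auto simp: restr_def dsum_def delta_restr rdelta_def fun_eq_iff)

lemma alpha_dsum: "i \<in> {1..<CARD('n)} \<Longrightarrow> \<alpha> i = dsum 1 i (- 1) (Suc i)" "\<alpha> CARD('n) = dsum 1 CARD('n) 1 CARD('n)"
  by (simp_all add: alpha_delta alpha_last dsum_def)

definition regular :: "'n qmat \<Rightarrow> bool" where
  "regular x \<longleftrightarrow> x \<in> a \<and> (\<forall>f\<in>restricted_roots a (roots h). f x \<noteq> 0) \<and>
     (\<forall>i\<in>{1..CARD('n)}. \<alpha> i \<notin> black_roots a (roots h) \<longrightarrow> restr a (\<alpha> i) x > 0)"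

lemma regular_exists: "\<exists>x. regular x"
proof -
  let ?P = "restr a ` (positive_roots (roots h) (\<alpha> ` {1..CARD('n)}) - black_roots a (roots h))"
  obtain x where x: "x \<in> a" "\<forall>f\<in>restricted_roots a (roots h). f x \<noteq> 0" "?P = {f \<in> restricted_roots a (roots h). f x > 0}"
    using restricted_positive unfolding positive_system_def by blast
  have "restr a (\<alpha> i) x > 0" if i: "i \<in> {1..CARD('n)}" and nb: "\<alpha> i \<notin> black_roots a (roots h)" for i
  proof -
    define c where "c f = (if f = \<alpha> i then 1 else 0 :: int)" for f
    have "\<alpha> i = (\<lambda>X. \<Sum>f\<in>\<alpha> ` {1..CARD('n)}. of_int (c f) * f X)"
      using i by (auto simp: c_def if_distrib[of of_int] if_distrib[of "\<lambda>t. t * _"] cong: if_cong)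
    then have "\<alpha> i \<in> positive_roots (roots h) (\<alpha> ` {1..CARD('n)})"
      using simple_root[OF i] unfolding positive_roots_def by (auto intro!: exI[of _ c] simp: c_def)
    then have "restr a (\<alpha> i) \<in> ?P"
      using nb by blast
    then show ?thesis
      unfolding x(3) by simp
  qed
  then show ?thesis
    using x by (auto simp: regular_def)
qed

text \<open>A root that vanishes at a regular element does not give a restricted root, so it
  vanishes on a. Equalities of weights at one point thus become identities on a.\<close>

lemma regular_nonzero:
  assumes x: "regular x" and b: "b \<in> roots h" and 0: "restr a b x = 0" and y: "y \<in> a"
  shows "restr a b y = 0"
proof (rule ccontr)
  assume "restr a b y \<noteq> 0"
  then have "restr a b \<noteq> (\<lambda>_. 0)"
    by auto
  then have "restr a b \<in> restricted_roots a (roots h)"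
    using b by (auto simp: restricted_roots_def black_roots_def)
  then show False
    using x 0 by (auto simp: regular_def)
qed

end

section \<open>The order of the weights at a regular element\<close>

context satake_signed
begin

lemma elementary_a:
  assumes k: "k < 2 * p"
  shows "\<exists>y\<in>a. \<forall>l<CARD('n). wt e y l = (if l = k then 1 else if l = tau p k then - 1 else 0)"
proof -
  define t where "t l = (if l = k then 1 else if l = tau p k then - 1 else 0 :: real)" for l
  have "t (tau p l) = - t l" for l
    using tau_neq[OF k] tau_tau[of p l] by (auto simp: t_def)
  note ex = a_surj[of t, OF this]
  have "complex_of_real (t l) = (if l = k then 1 else if l = tau p k then - 1 else 0)" for l
    by (simp add: t_def)
  with ex show ?thesis
    by (simp only:)
qed

context
  fixes x assumes x: "regular x"
begin

lemma regular_in_a: "x \<in> a"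
  using x by (simp add: regular_def)

lemma restr_alpha:
  assumes y: "y \<in> a"
  shows "i \<in> {1..<CARD('n)} \<Longrightarrow> restr a (\<alpha> i) y = rdelta i y - rdelta (Suc i) y"
    "restr a (\<alpha> CARD('n)) y = 2 * rdelta CARD('n) y"
  using y by (simp_all add: alpha_dsum restr_dsum)

lemma alpha_nonneg:
  assumes i: "i \<in> {1..CARD('n)}"
  shows "restr a (\<alpha> i) x \<ge> 0" "white i \<longleftrightarrow> restr a (\<alpha> i) x > 0"
proof -
  show "white i \<longleftrightarrow> restr a (\<alpha> i) x > 0"
    using x i simple_root[OF i] by (auto simp: white_def regular_def black_roots_def)
  show "restr a (\<alpha> i) x \<ge> 0"
  proof (cases "\<alpha> i \<in> black_roots a (roots h)")
    case True
    then show ?thesis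
      by (simp add: black_roots_def)
  next
    case False
    then show ?thesis
      using x i by (auto simp: regular_def intro: less_imp_le)
  qed
qed

text \<open>Consecutive differences are the values of simple roots at x, which are positive at white
  nodes and 0 at black ones.\<close>

lemma rdelta_antitone:
  assumes "1 \<le> i" "i \<le> j" "j \<le> CARD('n)"
  shows "rdelta j x \<le> rdelta i x"
  using assms(2,3)
proof (induction j rule: dec_induct)
  case (step j)
  have "restr a (\<alpha> j) x \<ge> 0"
    using step assms by (intro alpha_nonneg) auto
  then show ?case
    using step assms restr_alpha(1)[OF regular_in_a, of j] by simp
qed simp

lemma rdelta_nonneg:
  assumes i: "i \<in> {1..CARD('n)}"
  shows "rdelta i x \<ge> 0"
proof -
  have "restr a (\<alpha> CARD('n)) x \<ge> 0"
    using i by (intro alpha_nonneg) auto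
  then have "rdelta CARD('n) x \<ge> 0"
    by (simp add: restr_alpha(2)[OF regular_in_a])
  then show ?thesis
    using rdelta_antitone[of i "CARD('n)"] i by auto
qed

lemma rdelta_black:
  assumes "y \<in> a" "i \<in> {1..CARD('n)}" "\<not> \<pi> i < 2 * p"
  shows "rdelta i y = 0"
  using wt_a_black[OF assms(1) pi_less[OF assms(2)] assms(3)] by (simp add: rdelta_def)

text \<open>If the weight were 0 at x, the root 2 \<delta> would vanish on all of a; but a contains
  an element with weight 1 at any given hyperbolic index.\<close>

lemma rdelta_nonzero_iff:
  assumes i: "i \<in> {1..CARD('n)}"
  shows "rdelta i x \<noteq> 0 \<longleftrightarrow> \<pi> i < 2 * p"
proof
  assume "rdelta i x \<noteq> 0"
  then show "\<pi> i < 2 * p"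
    using rdelta_black[OF regular_in_a i] by blast
next
  assume pi: "\<pi> i < 2 * p"
  show "rdelta i x \<noteq> 0"
  proof
    assume 0: "rdelta i x = 0"
    have root: "dsum 1 i 1 i \<in> roots h"
      by (intro dsum_root i) auto
    obtain y where y: "y \<in> a" "\<forall>l<CARD('n). wt e y l = (if l = \<pi> i then 1 else if l = tau p (\<pi> i) then - 1 else 0)"
      using elementary_a[OF pi] by blast
    have "restr a (dsum 1 i 1 i) y = 0"
      by (rule regular_nonzero[OF x root _ y(1)]) (simp add: restr_dsum 0)
    then have "rdelta i y = 0"
      using y(1) by (simp add: restr_dsum)
    then show False
      using y(2) pi_less[OF i] sigma[OF i] by (auto simp: rdelta_def)
  qed
qed

lemma rdelta_eq:
  assumes ij: "i \<in> {1..CARD('n)}" "j \<in> {1..CARD('n)}" "i \<noteq> j" and eq: "rdelta i x = rdelta j x" and y: "y \<in> a"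
  shows "rdelta i y = rdelta j y"
proof -
  have root: "dsum 1 i (- 1) j \<in> roots h"
    using ij by (intro dsum_root) auto
  have "restr a (dsum 1 i (- 1) j) y = 0"
    by (rule regular_nonzero[OF x root _ y]) (simp add: restr_dsum eq)
  then show ?thesis
    using y by (simp add: restr_dsum)
qed

text \<open>The difference of the two weights vanishes on a. Tested on the element supported on the
  pair of \<open>\<pi> i\<close>, this leaves only the partner for \<open>\<pi> j\<close>.\<close>

lemma rdelta_eq_tau:
  assumes ij: "i \<in> {1..CARD('n)}" "j \<in> {1..CARD('n)}" "i \<noteq> j" and eq: "rdelta i x = rdelta j x"
    and nz: "rdelta i x \<noteq> 0"
  shows "\<pi> j = tau p (\<pi> i)"
proof -
  have pi: "\<pi> i < 2 * p"
    using nz rdelta_nonzero_iff[OF ij(1)] by blast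
  obtain y where y: "y \<in> a" "\<forall>l<CARD('n). wt e y l = (if l = \<pi> i then 1 else if l = tau p (\<pi> i) then - 1 else 0)"
    using elementary_a[OF pi] by blast
  have "rdelta i y = rdelta j y"
    by (rule rdelta_eq) fact+
  moreover have "rdelta i y \<noteq> 0"
    using y(2) pi_less[OF ij(1)] sigma[OF ij(1)] by (auto simp: rdelta_def)
  ultimately have "wt e y (\<pi> j) \<noteq> 0"
    by (auto simp: rdelta_def)
  then have "\<pi> j = \<pi> i \<or> \<pi> j = tau p (\<pi> i)"
    using y(2) pi_less[OF ij(2)] by (auto split: if_splits)
  moreover have "\<pi> j \<noteq> \<pi> i"
    using ij inj_onD[OF inj_pi] by blast
  ultimately show ?thesis
    by blast
qed

text \<open>The candidate belongs to the hyperbolic partner; its weight agrees up to sign, and at x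
  both weights are nonnegative.\<close>

lemma rdelta_partner:
  assumes i: "i \<in> {1..CARD('n)}" and nz: "rdelta i x \<noteq> 0"
  shows "\<exists>j\<in>{1..CARD('n)}. j \<noteq> i \<and> rdelta j x = rdelta i x"
proof -
  have pi: "\<pi> i < 2 * p"
    using nz rdelta_nonzero_iff[OF i] by blast
  obtain j where j: "j \<in> {1..CARD('n)}" "\<pi> j = tau p (\<pi> i)"
    using pi_surj[of "tau p (\<pi> i)"] pi_less[OF i] by auto
  have "j \<noteq> i"
    using j(2) tau_neq[OF pi] by auto
  moreover have "\<bar>rdelta j x\<bar> = \<bar>rdelta i x\<bar>"
    using wt_a(2)[OF regular_in_a pi_less[OF i]] sigma[OF i] sigma[OF j(1)] by (auto simp: rdelta_def j(2) abs_mult)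
  then have "rdelta j x = rdelta i x"
    using rdelta_nonneg[OF i] rdelta_nonneg[OF j(1)] by simp
  ultimately show ?thesis
    using j(1) by blast
qed

lemma rdelta_three:
  assumes "i \<in> {1..CARD('n)}" "j \<in> {1..CARD('n)}" "k \<in> {1..CARD('n)}" "rdelta i x \<noteq> 0"
    "rdelta j x = rdelta i x" "rdelta k x = rdelta i x" "i \<noteq> j" "i \<noteq> k" "j \<noteq> k"
  shows False
proof -
  have "\<pi> j = tau p (\<pi> i)" "\<pi> k = tau p (\<pi> i)"
    using assms by (intro rdelta_eq_tau; simp)+
  then show False
    using inj_onD[OF inj_pi, of j k] assms by simp
qed

text \<open>The 2 p labels with nonzero weight are closed downwards, because the weights are
  nonnegative and antitone; so they form an initial segment.\<close>

lemma rdelta_support: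
  assumes i: "i \<in> {1..CARD('n)}"
  shows "rdelta i x \<noteq> 0 \<longleftrightarrow> i \<le> 2 * p"
proof -
  define S where "S = {j \<in> {1..CARD('n)}. \<pi> j < 2 * p}"
  have "\<pi> ` S = {..<2 * p}"
  proof (intro equalityI subsetI)
    fix k assume k: "k \<in> {..<2 * p}"
    then obtain j where "j \<in> {1..CARD('n)}" "\<pi> j = k"
      using pi_surj[of k] two_p_le by auto
    with k show "k \<in> \<pi> ` S"
      unfolding S_def by blast
  qed (auto simp: S_def)
  moreover have "inj_on \<pi> S"
    using inj_pi by (rule inj_on_subset) (auto simp: S_def)
  ultimately have card: "card S = 2 * p"
    by (metis card_image card_lessThan)
  have "S \<subseteq> {1..2 * p}"
  proof
    fix j assume j: "j \<in> S"
    then have jN: "j \<in> {1..CARD('n)}" "rdelta j x \<noteq> 0"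
      using rdelta_nonzero_iff by (auto simp: S_def)
    have "{1..j} \<subseteq> S"
    proof
      fix k assume k: "k \<in> {1..j}"
      then have "k \<in> {1..CARD('n)}" "rdelta j x \<le> rdelta k x"
        using jN rdelta_antitone[of k j] by auto
      then show "k \<in> S"
        using jN rdelta_nonneg[of j] rdelta_nonzero_iff[of k] by (auto simp: S_def)
    qed
    then have "card {1..j} \<le> card S"
      by (intro card_mono) (auto simp: S_def)
    then show "j \<in> {1..2 * p}"
      using jN card by simp
  qed
  then have "S = {1..2 * p}"
    by (intro card_subset_eq) (auto simp: card)
  then have "i \<in> S \<longleftrightarrow> i \<le> 2 * p"
    using i by auto
  then show ?thesis
    using i rdelta_nonzero_iff[OF i] by (simp add: S_def)
qed

lemma rdelta_pair:
  assumes k: "k \<in> {1..p}"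
  shows "rdelta (2 * k - 1) x = rdelta (2 * k) x"
    "y \<in> a \<Longrightarrow> rdelta (2 * k - 1) y = rdelta (2 * k) y"
    "\<pi> (2 * k - 1) = tau p (\<pi> (2 * k))"
proof -
  have mem: "2 * k - 1 \<in> {1..CARD('n)}" "2 * k \<in> {1..CARD('n)}" "2 * k - 1 \<noteq> 2 * k" "2 * k \<noteq> 2 * k - 1"
    using k two_p_le by auto
  have "rdelta (2 * (k - 1) + 1) x = rdelta (2 * (k - 1) + 2) x"
  proof (rule adjacent_pairs[where N = "CARD('n)" and q = p])
    show "rdelta j x \<le> rdelta i x" if "1 \<le> i" "i \<le> j" "j \<le> CARD('n)" for i j
      by (rule rdelta_antitone[OF that])
    show "(rdelta i x \<noteq> 0) = (i \<le> 2 * p)" if "i \<in> {1..CARD('n)}" for i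
      by (rule rdelta_support[OF that])
    show "\<exists>j\<in>{1..CARD('n)}. j \<noteq> i \<and> rdelta j x = rdelta i x" if "i \<in> {1..CARD('n)}" "rdelta i x \<noteq> 0" for i
      by (rule rdelta_partner[OF that])
  qed (use k two_p_le rdelta_three in auto)
  moreover have "2 * (k - 1) + 1 = 2 * k - 1" "2 * (k - 1) + 2 = 2 * k"
    using k by auto
  ultimately show eq: "rdelta (2 * k - 1) x = rdelta (2 * k) x"
    by simp
  show "rdelta (2 * k - 1) y = rdelta (2 * k) y" if "y \<in> a"
    by (rule rdelta_eq[OF mem(1-3) eq that])
  show "\<pi> (2 * k - 1) = tau p (\<pi> (2 * k))"
    by (rule rdelta_eq_tau[OF mem(2,1,4) eq[symmetric]]) (use k rdelta_support[OF mem(2)] in simp)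
qed

lemma rdelta_strict:
  assumes k: "k \<in> {1..p}" "2 * k < CARD('n)"
  shows "rdelta (Suc (2 * k)) x < rdelta (2 * k) x"
proof (rule ccontr)
  have mem: "2 * k - 1 \<in> {1..CARD('n)}" "2 * k \<in> {1..CARD('n)}" "Suc (2 * k) \<in> {1..CARD('n)}"
    using k by auto
  have ne: "2 * k \<noteq> 2 * k - 1" "2 * k - 1 \<noteq> Suc (2 * k)"
    using k by auto
  assume "\<not> ?thesis"
  moreover have "rdelta (Suc (2 * k)) x \<le> rdelta (2 * k) x"
    using k by (intro rdelta_antitone) auto
  ultimately have "rdelta (Suc (2 * k)) x = rdelta (2 * k) x"
    by simp
  moreover have "rdelta (2 * k) x \<noteq> 0"
    using k rdelta_support[OF mem(2)] by simp
  ultimately show False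
    using rdelta_three[OF mem(2,1,3)] rdelta_pair(1)[OF k(1)] ne by simp
qed

text \<open>The frame index whose weight on a equals \<open>rdelta (2 * k)\<close>; a negative sign
  is absorbed by passing to the partner, whose weight is opposite.\<close>

definition weight_index :: "nat \<Rightarrow> nat" where
  "weight_index k = (if \<sigma> (2 * k) = 1 then \<pi> (2 * k) else tau p (\<pi> (2 * k)))"

lemma even_in_index: "k \<in> {1..p} \<Longrightarrow> 2 * k \<in> {1..CARD('n)}"
  using two_p_le by auto

lemma weight_index_less: "k \<in> {1..p} \<Longrightarrow> weight_index k < 2 * p" "k \<in> {1..p} \<Longrightarrow> weight_index k < CARD('n)"
proof -
  assume k: "k \<in> {1..p}"
  have "\<pi> (2 * k) < 2 * p"
    using rdelta_nonzero_iff[OF even_in_index[OF k]] rdelta_support[OF even_in_index[OF k]] k by simp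
  then show "weight_index k < 2 * p"
    by (simp add: weight_index_def)
  then show "weight_index k < CARD('n)"
    using two_p_le by simp
qed

lemma rdelta_weight_index:
  assumes k: "k \<in> {1..p}" and y: "y \<in> a"
  shows "rdelta (2 * k) y = Re (wt e y (weight_index k))"
  using sigma[OF even_in_index[OF k]] wt_a(2)[OF y pi_less[OF even_in_index[OF k]]] by (auto simp: rdelta_def weight_index_def)

text \<open>The partner of \<open>\<pi> (2 * j)\<close> is \<open>\<pi> (2 * j - 1)\<close>, an odd
  label, so two even labels never belong to the same pair unless they are equal.\<close>

lemma weight_index_distinct:
  assumes i: "i \<in> {1..p}" and j: "j \<in> {1..p}"
  shows "weight_index i = weight_index j \<longleftrightarrow> i = j" "weight_index i \<noteq> tau p (weight_index j)"
proof -
  have ne: "\<pi> (2 * i) \<noteq> tau p (\<pi> (2 * j))"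
  proof
    assume "\<pi> (2 * i) = tau p (\<pi> (2 * j))"
    then have "\<pi> (2 * i) = \<pi> (2 * j - 1)"
      by (simp only: rdelta_pair(3)[OF j])
    moreover have "2 * j - 1 \<in> {1..CARD('n)}"
      using j two_p_le by auto
    ultimately have "2 * i = 2 * j - 1"
      using inj_onD[OF inj_pi] even_in_index[OF i] by blast
    then show False
      using j by auto presburger
  qed
  then have ne': "tau p (\<pi> (2 * i)) \<noteq> \<pi> (2 * j)"
    by (metis tau_tau)
  have eq: "\<pi> (2 * i) = \<pi> (2 * j) \<longleftrightarrow> i = j"
    using inj_onD[OF inj_pi _ even_in_index[OF i] even_in_index[OF j]] by auto
  show *: "weight_index i = weight_index j \<longleftrightarrow> i = j"
    using ne ne' eq by (auto simp: weight_index_def)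
  show "weight_index i \<noteq> tau p (weight_index j)"
  proof (cases "i = j")
    case True
    then show ?thesis
      using tau_neq[OF weight_index_less(1)[OF j]] by simp
  next
    case False
    then show ?thesis
      using ne ne' eq by (auto simp: weight_index_def)
  qed
qed

lemma weight_index_element:
  assumes ij: "i \<in> {1..p}" "j \<in> {1..p}"
  shows "\<exists>y\<in>a. \<forall>l<CARD('n). wt e y l = (if l = weight_index i \<or> l = weight_index j then 1
    else if l = tau p (weight_index i) \<or> l = tau p (weight_index j) then - 1 else 0)"
proof -
  define t where "t l = (if l = weight_index i \<or> l = weight_index j then 1
    else if l = tau p (weight_index i) \<or> l = tau p (weight_index j) then - 1 else 0 :: real)" for l
  have "t (tau p l) = - t l" for l
    using weight_index_distinct(2)[OF ij(1,1)] weight_index_distinct(2)[OF ij(1,2)] weight_index_distinct(2)[OF ij(2,1)] weight_index_distinct(2)[OF ij(2,2)]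
      tau_tau[of p l] tau_tau[of p "weight_index i"] tau_tau[of p "weight_index j"]
    unfolding t_def by (smt (verit, best))
  note ex = a_surj[of t, OF this]
  have "complex_of_real (t l) = (if l = weight_index i \<or> l = weight_index j then 1
    else if l = tau p (weight_index i) \<or> l = tau p (weight_index j) then - 1 else 0)" for l
    by (simp add: t_def)
  with ex show ?thesis
    by (simp only:)
qed

text \<open>The hyperbolic pairs of e in the order of the labels 2, 4, ..., 2 p, with the vector of
  weight \<open>rdelta (2 * k)\<close> in the even place of its pair.\<close>

definition kframe :: "nat \<Rightarrow> quat ^ 'n" where
  "kframe m = (if even m then e (weight_index (Suc (m div 2))) else e (tau p (weight_index (Suc (m div 2)))))"

lemma kframe_wsys: "wsys p (2 * p) (\<lambda>_. 1) kframe"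
  unfolding wsys_def
proof (intro conjI allI impI)
  fix m l assume ml: "m < 2 * p" "l < 2 * p"
  let ?i = "Suc (m div 2)" and ?j = "Suc (l div 2)"
  have ij: "?i \<in> {1..p}" "?j \<in> {1..p}"
    using ml by auto
  note k = weight_index_distinct[OF ij] weight_index_distinct(2)[OF ij(2,1)] weight_index_less[OF ij(1)] weight_index_less[OF ij(2)]
  have sgn: "fsign (weight_index ?i) = 1" "fsign (weight_index ?j) = 1"
    using k by (simp_all add: fsign_def)
  have tau: "l = tau p m \<longleftrightarrow> m div 2 = l div 2 \<and> (even m \<longleftrightarrow> odd l)"
    using ml by (auto simp: tau_def elim!: evenE oddE) presburger
  have k': "tau p (weight_index ?j) \<noteq> weight_index ?i" "weight_index ?j \<noteq> tau p (weight_index ?i)"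
    using k by metis+
  have kN: "weight_index ?i < CARD('n)" "weight_index ?j < CARD('n)"
    using k by auto
  have eq: "weight_index ?j = weight_index ?i \<longleftrightarrow> m div 2 = l div 2"
    using k(1) by auto
  show "form (kframe m) (kframe l) = (if l = tau p m then of_real 1 else 0)"
    unfolding kframe_def tau
    by (cases "even m"; cases "even l") (simp_all add: frame_form[OF e] kN k' sgn eq)
qed auto

lemma weight_index_in_even_span: "i \<in> {1..k} \<Longrightarrow> e (weight_index i) \<in> even_span kframe k"
proof -
  assume "i \<in> {1..k}"
  then have "i - 1 < k" "Suc (i - 1) = i"
    by auto
  then show ?thesis
    using even_span_base[of "i - 1" k kframe] by (simp add: kframe_def)
qed

text \<open>An element u of a with weight 1 at both indices scales z by 2, while all its weights lie
  between -1 and 1. So z maps into the weight space for 1, spanned by the frame vectors at these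
  indices.\<close>

lemma restricted_space_subset:
  assumes k: "k \<le> p" and ij: "i \<in> {1..k}" "j \<in> {1..k}"
    and z: "z \<in> skew" "\<And>u. u \<in> a \<Longrightarrow> commutator u z = (Re (wt e u (weight_index i)) + Re (wt e u (weight_index j))) *\<^sub>R z"
  shows "z \<in> ideal_of (even_span kframe k)"
proof -
  have ijp: "i \<in> {1..p}" "j \<in> {1..p}"
    using ij k by auto
  note U = hsubspace_even_span[of kframe k]
  obtain u where u: "u \<in> a" "\<And>l. l < CARD('n) \<Longrightarrow> wt e u l = (if l = weight_index i \<or> l = weight_index j then 1
    else if l = tau p (weight_index i) \<or> l = tau p (weight_index j) then - 1 else 0)"
    using weight_index_element[OF ijp] by blast
  have zero: "entry e z m l = 0" if ml: "m < CARD('n)" "l < CARD('n)" "m \<noteq> weight_index i" "m \<noteq> weight_index j" for m l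
  proof -
    have c: "cq (wt e u m) = of_real (Re (wt e u m))" "cq (wt e u l) = of_real (Re (wt e u l))"
      using wt_a(1)[OF u(1) ml(1)] wt_a(1)[OF u(1) ml(2)] cq_simps(8) by metis+
    have "entry e (commutator u z) m l = (Re (wt e u (weight_index i)) + Re (wt e u (weight_index j))) *\<^sub>R entry e z m l"
      by (simp add: z(2)[OF u(1)] entry_def[OF e] mv_scaleR_left form_scaleR)
    also have "Re (wt e u (weight_index i)) + Re (wt e u (weight_index j)) = 2"
      using weight_index_less(2)[OF ijp(1)] weight_index_less(2)[OF ijp(2)] by (simp add: u(2))
    finally have "2 *\<^sub>R entry e z m l = cq (wt e u m) * entry e z m l - entry e z m l * cq (wt e u l)"
      using entry_commutator[OF e a_diagonal[OF u(1)] ml(1,2), of z] by simp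
    also have "\<dots> = (Re (wt e u m) - Re (wt e u l)) *\<^sub>R entry e z m l"
      unfolding c by (simp add: of_real_def scaleR_left_diff_distrib)
    finally have "(2 - (Re (wt e u m) - Re (wt e u l))) *\<^sub>R entry e z m l = 0"
      by (simp add: scaleR_left_diff_distrib del: scaleR_eq_0_iff)
    moreover have "Re (wt e u m) \<le> 0" "Re (wt e u l) \<ge> - 1"
      using ml by (auto simp: u(2))
    ultimately show ?thesis
      by auto
  qed
  have col: "z *v e l \<in> even_span kframe k" if l: "l < CARD('n)" for l
  proof -
    have "z *v e l = (\<Sum>m<CARD('n). rsc (e m) (fsign m *\<^sub>R entry e z m l))"
      unfolding entry_def[OF e] by (rule frame_expansion[OF e])
    also have "\<dots> \<in> even_span kframe k"
    proof (rule hsubspace_sum[OF U])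
      fix m assume m: "m \<in> {..<CARD('n)}"
      show "rsc (e m) (fsign m *\<^sub>R entry e z m l) \<in> even_span kframe k"
      proof (cases "m = weight_index i \<or> m = weight_index j")
        case True
        then have "e m \<in> even_span kframe k"
          using weight_index_in_even_span ij by blast
        then show ?thesis
          using U by (simp add: hsubspace_def)
      next
        case False
        then show ?thesis
          using zero[of m l] m l U by (simp add: hsubspace_def)
      qed
    qed
    finally show ?thesis .
  qed
  have "z *v v \<in> even_span kframe k" for v
  proof -
    have "z *v v = (\<Sum>l<CARD('n). rsc (z *v e l) (fsign l *\<^sub>R form (e (tau p l)) v))"
      by (subst frame_expansion[OF e, of v]) (simp add: mv_sum_right mv_rsc)
    also have "\<dots> \<in> even_span kframe k"
      by (rule hsubspace_sum[OF U]) (use col U in \<open>auto simp: hsubspace_def\<close>)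
    finally show ?thesis .
  qed
  then show ?thesis
    using z(1) by (simp add: ideal_of_def)
qed

lemma B_I_eq:
  assumes k: "k \<in> {1..p}"
  shows "B_I {2 * k} = ideal_of (even_span kframe k)"
proof (intro equalityI)
  note Phi = Phi_I_eq[OF even_in_index[OF k]]
  show "B_I {2 * k} \<subseteq> ideal_of (even_span kframe k)"
    unfolding B_I_def
  proof (rule span_minimal[OF _ subspace_ideal_even_span], safe)
    fix b z assume b: "b \<in> Phi_I {2 * k}" and z: "z \<in> restricted_space a (restr a b)"
    obtain i j where ij: "b = dsum 1 i 1 j" "i \<in> {1..2 * k}" "j \<in> {1..2 * k}"
      using b unfolding Phi by blast
    \<comment> \<open>The labels 2 m' - 1 and 2 m' have the same restriction;
      \<open>Suc m div 2\<close> is half of m rounded up.\<close>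
    have half: "Suc m div 2 \<in> {1..k} \<and> (\<forall>y\<in>a. rdelta m y = Re (wt e y (weight_index (Suc m div 2))))"
      if m: "m \<in> {1..2 * k}" for m
    proof -
      define m' where "m' = Suc m div 2"
      have m': "m' \<in> {1..k}" "m = 2 * m' \<or> m = 2 * m' - 1"
        using m by (auto simp: m'_def)
      then have "m' \<in> {1..p}"
        using k by auto
      then have "rdelta m y = Re (wt e y (weight_index m'))" if "y \<in> a" for y
        using m'(2) rdelta_pair(2)[OF _ that] rdelta_weight_index[OF _ that] by auto
      then show ?thesis
        using m'(1) by (simp add: m'_def)
    qed
    show "z \<in> ideal_of (even_span kframe k)"
    proof (rule restricted_space_subset[of k "Suc i div 2" "Suc j div 2"])
      fix u assume "u \<in> a"
      then show "commutator u z = (Re (wt e u (weight_index (Suc i div 2))) + Re (wt e u (weight_index (Suc j div 2)))) *\<^sub>R z"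
        using z half[OF ij(2)] half[OF ij(3)] by (simp add: restricted_space_def ij(1) restr_dsum)
    qed (use z half[OF ij(2)] half[OF ij(3)] k in \<open>auto simp: restricted_space_def\<close>)
  qed
  show "ideal_of (even_span kframe k) \<subseteq> B_I {2 * k}"
  proof
    fix z assume z: "z \<in> ideal_of (even_span kframe k)"
    have kp: "k \<le> p"
      using k by simp
    have "z = (1 / 2) *\<^sub>R (\<Sum>i<k. \<Sum>j<k. skew_outer (kframe (2 * i))
        (form (kframe (Suc (2 * i))) (z *v kframe (Suc (2 * j)))) (kframe (2 * j)))"
      by (rule ideal_of_expansion[OF z]) (rule even_span_expansion[OF kframe_wsys kp])
    also have "\<dots> \<in> B_I {2 * k}"
      unfolding B_I_def
    proof (intro span_scale span_sum)
      fix i j assume ij: "i \<in> {..<k}" "j \<in> {..<k}"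
      have mem: "Suc i \<in> {1..p}" "Suc j \<in> {1..p}"
        using ij k by auto
      have "skew_outer (e (weight_index (Suc i))) q (e (weight_index (Suc j))) \<in> (\<Union>b\<in>Phi_I {2 * k}. restricted_space a (restr a b))" for q
      proof
        \<comment> \<open>Even labels suffice because the odd ones restrict alike;
          \<open>Suc\<close> converts places counted from 0 into pairs counted from 1.\<close>
        show "dsum 1 (2 * Suc i) 1 (2 * Suc j) \<in> Phi_I {2 * k}"
          unfolding Phi using ij by (intro CollectI exI conjI refl) auto
        show "skew_outer (e (weight_index (Suc i))) q (e (weight_index (Suc j))) \<in> restricted_space a (restr a (dsum 1 (2 * Suc i) 1 (2 * Suc j)))"
          unfolding restricted_space_def
        proof (intro CollectI conjI ballI skew_outer_in_skew)
          fix u assume u: "u \<in> a"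
          then have us: "u \<in> skew"
            using a_diagonal diagonalD(1) by blast
          have r: "restr a (dsum 1 (2 * Suc i) 1 (2 * Suc j)) u = Re (wt e u (weight_index (Suc i))) + Re (wt e u (weight_index (Suc j)))"
            using u rdelta_weight_index[OF mem(1) u] rdelta_weight_index[OF mem(2) u] by (simp only: restr_dsum if_True)
          note w = wt_a(3)[OF u weight_index_less(2)[OF mem(1)]] wt_a(3)[OF u weight_index_less(2)[OF mem(2)]]
          show "commutator u (skew_outer (e (weight_index (Suc i))) q (e (weight_index (Suc j))))
              = restr a (dsum 1 (2 * Suc i) 1 (2 * Suc j)) u *\<^sub>R skew_outer (e (weight_index (Suc i))) q (e (weight_index (Suc j)))"
            unfolding r skew_outer_def
            by (rule matrix_eqI)
              (simp add: commutator_simps skew_mult_outer[OF us] w mv_simps form_scaleR rsc_scaleR algebra_simps)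
        qed
      qed
      then show "skew_outer (kframe (2 * i)) (form (kframe (Suc (2 * i))) (z *v kframe (Suc (2 * j)))) (kframe (2 * j))
          \<in> span (\<Union>b\<in>Phi_I {2 * k}. restricted_space a (restr a b))"
        by (intro span_base) (simp add: kframe_def)
    qed
    finally show "z \<in> B_I {2 * k}" .
  qed
qed

text \<open>Apart from the long root, the node gives the difference of the weights 2 k and 2 k + 1.
  The latter restricts like 2 k + 2, or to 0 when k = p.\<close>

lemma restr_alpha_even:
  assumes k: "k \<in> {1..p}" and y: "y \<in> a"
  shows "restr a (\<alpha> (2 * k)) y = (if 2 * k = CARD('n) then 2 * Re (wt e y (weight_index k))
    else Re (wt e y (weight_index k)) - (if k < p then Re (wt e y (weight_index (Suc k))) else 0))"
proof (cases "2 * k = CARD('n)")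
  case True
  then have "restr a (\<alpha> (2 * k)) y = 2 * rdelta (2 * k) y"
    using restr_alpha(2)[OF y] by simp
  with True show ?thesis
    using rdelta_weight_index[OF k y] by simp
next
  case False
  then have "2 * k \<in> {1..<CARD('n)}" and mem: "Suc (2 * k) \<in> {1..CARD('n)}"
    using even_in_index[OF k] by auto
  then have "restr a (\<alpha> (2 * k)) y = rdelta (2 * k) y - rdelta (Suc (2 * k)) y"
    using restr_alpha(1)[OF y] by simp
  moreover have "rdelta (Suc (2 * k)) y = (if k < p then Re (wt e y (weight_index (Suc k))) else 0)"
  proof (cases "k < p")
    case True
    then have "Suc k \<in> {1..p}" "2 * Suc k - 1 = Suc (2 * k)"
      by auto
    then show ?thesis
      using rdelta_pair(2)[of "Suc k" y] rdelta_weight_index[of "Suc k" y] y True by simp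
  next
    case False
    then have "\<not> \<pi> (Suc (2 * k)) < 2 * p"
      using rdelta_nonzero_iff[OF mem] rdelta_support[OF mem] k by simp
    then show ?thesis
      using False rdelta_black[OF y mem] by simp
  qed
  ultimately show ?thesis
    using False by (simp add: rdelta_weight_index[OF k y])
qed

lemma white_even: "k \<in> {1..p} \<Longrightarrow> white (2 * k)"
proof -
  assume k: "k \<in> {1..p}"
  have "restr a (\<alpha> (2 * k)) x > 0"
  proof (cases "2 * k = CARD('n)")
    case True
    have "rdelta (2 * k) x > 0"
      using rdelta_nonneg[OF even_in_index[OF k]] rdelta_support[OF even_in_index[OF k]] k by simp
    then show ?thesis
      using True restr_alpha(2)[OF regular_in_a] by simp
  next
    case False
    then have "2 * k \<in> {1..<CARD('n)}" "2 * k < CARD('n)"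
      using even_in_index[OF k] by auto
    then show ?thesis
      using restr_alpha(1)[OF regular_in_a, of "2 * k"] rdelta_strict[OF k] by simp
  qed
  then show ?thesis
    using alpha_nonneg(2)[OF even_in_index[OF k]] by simp
qed

text \<open>At an odd label up to 2 p the two weights of the simple root form a pair and cancel on
  a; beyond 2 p all weights vanish at x.\<close>

lemma white_imp_even:
  assumes "white j"
  shows "\<exists>m\<in>{1..p}. j = 2 * m"
proof -
  have j: "j \<in> {1..CARD('n)}"
    using assms by (simp add: white_def)
  have pos: "restr a (\<alpha> j) x > 0"
    using alpha_nonneg(2)[OF j] assms by simp
  have le: "j \<le> 2 * p"
  proof (rule ccontr)
    assume "\<not> j \<le> 2 * p"
    then have 0: "rdelta j x = 0"
      using rdelta_support[OF j] by simp
    show False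
    proof (cases "j = CARD('n)")
      case True
      then show False
        using pos 0 restr_alpha(2)[OF regular_in_a] by simp
    next
      case False
      then have "restr a (\<alpha> j) x = rdelta j x - rdelta (Suc j) x" "rdelta (Suc j) x \<ge> 0"
        using j restr_alpha(1)[OF regular_in_a, of j] rdelta_nonneg[of "Suc j"] by auto
      then show False
        using pos 0 by simp
    qed
  qed
  have "even j"
  proof (rule ccontr)
    assume "odd j"
    then obtain m where m: "j = 2 * m + 1"
      by (auto elim: oddE)
    then have "j < 2 * p"
      using le by presburger
    then have "Suc m \<in> {1..p}" "j \<in> {1..<CARD('n)}"
      using m j two_p_le by auto
    then have "restr a (\<alpha> j) x = 0"
      using restr_alpha(1)[OF regular_in_a, of j] rdelta_pair(1)[of "Suc m"] m by simp
    then show False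
      using pos by simp
  qed
  then show ?thesis
    using le j by (auto elim!: evenE)
qed

text \<open>The element of a with weight 1 on the k-th pair and 0 on the others makes this simple
  root positive and all other white ones nonpositive, so no arrow starts here.\<close>

lemma admissible_even:
  assumes k: "k \<in> {1..p}"
  shows "admissible {2 * k}"
proof -
  have "j = 2 * k" if arrow: "arrow (2 * k) j" for j
  proof (rule ccontr)
    assume "j \<noteq> 2 * k"
    have "white j"
      using arrow by (simp add: arrow_def)
    then obtain m where m: "m \<in> {1..p}" "j = 2 * m"
      using white_imp_even by blast
    have mk: "m \<noteq> k"
      using \<open>j \<noteq> 2 * k\<close> m by simp
    obtain y where y: "y \<in> a" "\<And>l. l < CARD('n) \<Longrightarrow> wt e y l = (if l = weight_index k \<or> l = weight_index k then 1
      else if l = tau p (weight_index k) \<or> l = tau p (weight_index k) then - 1 else 0)"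
      using weight_index_element[OF k k] by blast
    have wt: "Re (wt e y (weight_index i)) = (if i = k then 1 else 0)" if "i \<in> {1..p}" for i
      using that weight_index_distinct[OF that k] weight_index_less(2)[OF that] by (simp add: y(2))
    have "restr a (\<alpha> (2 * k)) y > 0"
      using k wt[OF k] wt[of "Suc k"] by (simp add: restr_alpha_even[OF k y(1)])
    moreover have "restr a (\<alpha> (2 * m)) y \<le> 0"
      using m mk wt[OF m(1)] wt[of "Suc m"] by (simp add: restr_alpha_even[OF m(1) y(1)])
    moreover have "restr a (\<alpha> (2 * k)) = restr a (\<alpha> (2 * m))"
      using arrow m by (simp add: arrow_def)
    ultimately show False
      by simp
  qed
  then show ?thesis
    using white_even[OF k] by (simp add: admissible_def)
qed

lemma satake_frame_exists:
  "\<exists>f. frame f \<and> (\<forall>k\<in>{1..p}. admissible {2 * k} \<and> B_I {2 * k} = ideal_of (even_span f k))"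
proof -
  obtain f where f: "frame f" "even_span f p = even_span kframe p" "\<forall>i<2 * p. f i = kframe i"
    using split_family_frame[OF split_family_empty kframe_wsys]
      by (metis (no_types, lifting) empty_iff even_span_cong mult_less_cancel1 real_eigenvector_def zero_less_numeral)
  have "even_span f k = even_span kframe k" if "k \<in> {1..p}" for k
    by (rule even_span_cong) (use f(3) that in simp)
  then show ?thesis
    using f(1) admissible_even B_I_eq by auto
qed

end

end

section \<open>Transfer to the given algebra\<close>

context witt_form
begin

theorem satake_chain:
  assumes S: "satake_data skew commutator a h CARD('n) \<alpha>"
    and lab: "satake_data.C_labelling skew commutator h CARD('n) \<alpha>" and n: "CARD('n) \<ge> 3"
  shows "\<exists>f. frame f \<and> (\<forall>k\<in>{1..p}. satake_data.admissible skew commutator a h CARD('n) \<alpha> {2 * k} \<and>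
    satake_data.B_I skew commutator a h CARD('n) \<alpha> {2 * k} = ideal_of (even_span f k))"
proof -
  interpret S: satake_data skew commutator a h "CARD('n)" \<alpha>
    by (rule S)
  obtain e where e: "frame e" "a = real_diagonal e" "h = diagonal e"
    using maximal_abelian_frame[OF S.a_maximal S.h_maximal S.a_subset_h] by blast
  interpret F: satake_frame s p a h \<alpha> e
    by unfold_locales (use e lab n in auto)
  obtain \<pi> \<sigma> where \<pi>: "\<forall>i\<in>{1..CARD('n)}. \<pi> i < CARD('n) \<and> (\<sigma> i = 1 \<or> \<sigma> i = - 1)" "inj_on \<pi> {1..CARD('n)}"
    "\<forall>i\<in>{1..CARD('n)}. \<forall>X. of_real (\<sigma> i) * eps e (\<pi> i) X = (\<Sum>m=i..<CARD('n). \<alpha> m X) + \<alpha> CARD('n) X / 2"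
    using F.signed_basis by blast
  interpret G: satake_signed s p a h \<alpha> e \<pi> \<sigma>
    by unfold_locales (use \<pi> in auto)
  obtain x where "G.regular x"
    using G.regular_exists by blast
  then show ?thesis
    by (rule G.satake_frame_exists)
qed

end

text \<open>Position in a finite linear order is a strictly increasing bijection onto the numbers
  below \<open>CARD('n)\<close>.\<close>

lemma card_rank_less:
  assumes "p \<le> CARD('n::{finite,linorder})"
  shows "card {i :: 'n. card {k. k < i} < p} = p"
proof -
  define r where "r i = card {k. k < i}" for i :: 'n
  have mono: "r i < r j" if "i < j" for i j
    unfolding r_def using that by (intro psubset_card_mono) auto
  have inj: "inj r"
    by (rule injI) (metis mono less_irrefl linorder_neqE)
  have "r i < CARD('n)" for i
    unfolding r_def by (rule psubset_card_mono) auto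
  then have surj: "range r = {..<CARD('n)}"
    using inj by (intro card_subset_eq) (auto simp: card_image)
  have "r ` {i. r i < p} = {..<p}"
  proof (intro equalityI subsetI)
    fix k assume k: "k \<in> {..<p}"
    then have "k \<in> range r"
      using surj assms by auto
    then show "k \<in> r ` {i. r i < p}"
      using k by auto
  qed auto
  then have "card {i. r i < p} = p"
    using card_image[of r "{i. r i < p}"] inj by (simp add: inj_on_subset)
  then show ?thesis
    by (simp add: r_def)
qed

lemma witt_form_sign_pq:
  assumes "2 * p \<le> CARD('n::{finite,linorder})"
  shows "witt_form (sign_pq p :: 'n \<Rightarrow> real) p"
proof -
  interpret quat_form "sign_pq p :: 'n \<Rightarrow> real"
    by (rule quat_form_sign_pq)
  have "{i :: 'n. sign_pq p i = 1} = {i. card {k. k < i} < p}"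
    by (auto simp: sign_pq_def)
  then show ?thesis
    using assms card_rank_less[where 'n = 'n, of p] by unfold_locales auto
qed

text \<open>The number of classes and the bound on chains do not refer to Satake data; the chain of
  the \<open>B_I\<close> is then described for every choice of such data and labelling.\<close>

theorem proposition4p3:
  fixes l p :: nat
    and g :: "('n :: {finite, linorder}) qmat set"
  assumes l: "CARD('n) = l" "l \<ge> 3"
    and p: "2 * p \<le> l"
    and g: "g = sp p"
  shows
    "finite (real_lie_algebra.nonzero_abelian_inner_ideals g commutator //
        real_lie_algebra.conjugacy g commutator) \<and>
     card (real_lie_algebra.nonzero_abelian_inner_ideals g commutator //
        real_lie_algebra.conjugacy g commutator) = p \<and>
     (\<forall>C. subset.chain (real_lie_algebra.nonzero_abelian_inner_ideals g commutator) C
        \<longrightarrow> finite C \<and> card C \<le> p) \<and>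
     (\<forall>a h \<alpha>. satake_data g commutator a h l \<alpha> \<and>
              satake_data.C_labelling g commutator h l \<alpha> \<longrightarrow>
        (\<forall>k\<in>{1..p}.
           satake_data.admissible g commutator a h l \<alpha> {2 * k} \<and>
           satake_data.B_I g commutator a h l \<alpha> {2 * k}
             \<in> real_lie_algebra.nonzero_abelian_inner_ideals g commutator) \<and>
        (\<forall>k\<in>{1..<p}.
           satake_data.B_I g commutator a h l \<alpha> {2 * k}
             \<subset> satake_data.B_I g commutator a h l \<alpha> {2 * (k + 1)}) \<and>
        (\<forall>B\<in>real_lie_algebra.nonzero_abelian_inner_ideals g commutator.
           \<exists>!k. k \<in> {1..p} \<and>
             real_lie_algebra.conjugate g commutator B
               (satake_data.B_I g commutator a h l \<alpha> {2 * k})))"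
proof -
  interpret W: witt_form "sign_pq p :: 'n \<Rightarrow> real" p
    by (rule witt_form_sign_pq) (use l p in simp)
  have g': "g = W.skew"
    by (simp add: g sp_eq_skew)
  have 4: "(\<forall>k\<in>{1..p}. satake_data.admissible W.skew commutator a h l \<alpha> {2 * k} \<and>
           satake_data.B_I W.skew commutator a h l \<alpha> {2 * k} \<in> W.nonzero_abelian_inner_ideals) \<and>
        (\<forall>k\<in>{1..<p}. satake_data.B_I W.skew commutator a h l \<alpha> {2 * k}
             \<subset> satake_data.B_I W.skew commutator a h l \<alpha> {2 * (k + 1)}) \<and>
        (\<forall>B\<in>W.nonzero_abelian_inner_ideals. \<exists>!k. k \<in> {1..p} \<and>
             W.conjugate B (satake_data.B_I W.skew commutator a h l \<alpha> {2 * k}))"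
    if S: "satake_data W.skew commutator a h l \<alpha>" "satake_data.C_labelling W.skew commutator h l \<alpha>"
    for a h \<alpha>
  proof -
    obtain f where f: "W.frame f" "\<And>k. k \<in> {1..p} \<Longrightarrow> satake_data.admissible W.skew commutator a h l \<alpha> {2 * k}"
      "\<And>k. k \<in> {1..p} \<Longrightarrow> satake_data.B_I W.skew commutator a h l \<alpha> {2 * k} = W.ideal_of (W.even_span f k)"
      using W.satake_chain[of a h \<alpha>] S l by auto
    show ?thesis
    proof (intro conjI ballI)
      fix B assume "B \<in> W.nonzero_abelian_inner_ideals"
      then obtain e k where B: "W.frame e" "k \<in> {1..p}" "B = W.ideal_of (W.even_span e k)"
        by (rule W.nonzero_abelian_inner_idealE)
      have "W.conjugate B (satake_data.B_I W.skew commutator a h l \<alpha> {2 * j}) \<longleftrightarrow> k = j" if "j \<in> {1..p}" for j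
        unfolding f(3)[OF that] B(3) by (rule W.ideal_even_span_conjugate_iff) (use B f that in auto)
      then show "\<exists>!k. k \<in> {1..p} \<and> W.conjugate B (satake_data.B_I W.skew commutator a h l \<alpha> {2 * k})"
        using B(2) by (intro ex1I[of _ k]) auto
    next
      fix k assume k: "k \<in> {1..<p}"
      then have mem: "k \<in> {1..p}" "k + 1 \<in> {1..p}"
        by auto
      show "satake_data.B_I W.skew commutator a h l \<alpha> {2 * k}
             \<subset> satake_data.B_I W.skew commutator a h l \<alpha> {2 * (k + 1)}"
        unfolding f(3)[OF mem(1)] f(3)[OF mem(2)]
        by (rule W.ideal_even_span_psubset[OF f(1)]) (use k in auto)
    qed (simp_all add: f(2,3) W.ideal_even_span_nonzero[OF f(1)])
  qed
  show ?thesis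
    unfolding g' using W.conjugacy_classes W.chain_length 4 by blast
qed

end
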